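(* Let $X(\mathbb{R})$ be a separable Banach function space such that the Hardy-Littlewood maximal operator $M$ is bounded on $X(\mathbb{R})$ and on its associate space $X'(\mathbb{R})$. Suppose that $\psi$ is an orthonormal differentiable wavelet such that $\psi$ and $\psi'$ have a common radial decreasing $L^1$-majorant $W$ satisfying $\int_0^\infty sW(s)\,ds<\infty$, and such that $\psi_{j,k}\in X'(\mathbb{R})$ for all $j,k\in\mathbb{Z}$. Then the sublinear operator \[ (Vf)(x)=\Big(\sum_{j\in\mathbb{Z}}\sum_{k\in\mathbb{Z}}|\langle f,\psi_{j,k}\rangle\psi_{j,k}(x)|^2\Big)^{1/2},\quad x\in\mathbb{R}, \] is bounded on $X(\mathbb{R})$, i.e. there is $C>0$ with $\|Vf\|_{X(\mathbb{R})}\le C\|f\|_{X(\mathbb{R})}$ for all $f\in X(\mathbb{R})$.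
   Context: A Banach function norm is a map $\rho$ from nonnegative measurable functions on $\mathbb{R}$ to $[0,\infty]$ that is a norm-like functional ($\rho(f)=0\iff f=0$ a.e., positive homogeneous, subadditive), has the lattice property, the Fatou property ($0\le f_n\uparrow f$ a.e. implies $\rho(f_n)\uparrow\rho(f)$), satisfies $\rho(\chi_E)<\infty$ and $\int_E f\,dx\le C_E\rho(f)$ for every measurable $E$ with $|E|<\infty$. $X(\mathbb{R})$ is the set of measurable $f$ with $\|f\|_{X(\mathbb{R})}:=\rho(|f|)<\infty$; the associate space $X'(\mathbb{R})$ is given by $\rho'(g)=\sup\{\int fg: f\ge0,\ \rho(f)\le1\}$. $M$ is the Hardy-Littlewood maximal operator $(Mf)(x)=\sup_{Q\ni x}\frac1{|Q|}\int_Q|f|$ over bounded intervals $Q\ni x$. A function $\psi\in L^2(\mathbb{R})$ is an orthonormal wavelet if $\psi_{j,k}(x)=2^{j/2}\psi(2^jx-k)$, $j,k\in\mathbb{Z}$, form an orthonormal basis of $L^2(\mathbb{R})$. $W:[0,\infty)\to(0,\infty)$ is a radial decreasing $L^1$-majorant of $g$ if $|g(x)|\le W(|x|)$ a.e., $W\in L^1([0,\infty))$, $W$ decreasing, $W(0)<\infty$. $\langle f,g\rangle=\int_\mathbb{R} f\overline g\,dx$, well defined for $f\in X(\mathbb{R})$, $g\in X'(\mathbb{R})$. *)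

theory Defs
  imports "HOL-Analysis.Analysis"
begin

text \<open>Functions on the real line; measurability refers to Lebesgue measure.
  Nonnegative measurable functions are modelled as maps into ennreal (so they may take
  the value infinity). Elements of X and X' are complex-valued.\<close>

type_synonym bfnorm = "(real \<Rightarrow> ennreal) \<Rightarrow> ennreal"

definition banach_function_norm :: "bfnorm \<Rightarrow> bool" where
  "banach_function_norm \<rho> \<longleftrightarrow>
     (\<forall>f\<in>borel_measurable lebesgue. \<rho> f = 0 \<longleftrightarrow> (AE x in lebesgue. f x = 0)) \<and>
     (\<forall>f\<in>borel_measurable lebesgue. \<forall>c::real. c \<ge> 0 \<longrightarrow>
        \<rho> (\<lambda>x. ennreal c * f x) = ennreal c * \<rho> f) \<and>
     (\<forall>f\<in>borel_measurable lebesgue. \<forall>g\<in>borel_measurable lebesgue.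
        \<rho> (\<lambda>x. f x + g x) \<le> \<rho> f + \<rho> g) \<and>
     (\<forall>f\<in>borel_measurable lebesgue. \<forall>g\<in>borel_measurable lebesgue.
        (AE x in lebesgue. g x \<le> f x) \<longrightarrow> \<rho> g \<le> \<rho> f) \<and>
     (\<forall>fs f. (\<forall>n. fs n \<in> borel_measurable lebesgue) \<longrightarrow> f \<in> borel_measurable lebesgue \<longrightarrow>
        (AE x in lebesgue. incseq (\<lambda>n. fs n x) \<and> (\<lambda>n. fs n x) \<longlonglongrightarrow> f x) \<longrightarrow>
        (\<lambda>n. \<rho> (fs n)) \<longlonglongrightarrow> \<rho> f) \<and>
     (\<forall>E\<in>sets lebesgue. emeasure lebesgue E < \<infinity> \<longrightarrow>
        \<rho> (indicator E) < \<infinity> \<and>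
        (\<exists>C::real. \<forall>f\<in>borel_measurable lebesgue.
           (\<integral>\<^sup>+ x\<in>E. f x \<partial>lebesgue) \<le> ennreal C * \<rho> f))"

definition bfs :: "bfnorm \<Rightarrow> (real \<Rightarrow> complex) set" where
  "bfs \<rho> = {f \<in> borel_measurable lebesgue. \<rho> (\<lambda>x. ennreal (cmod (f x))) < \<infinity>}"

definition bfs_norm :: "bfnorm \<Rightarrow> (real \<Rightarrow> complex) \<Rightarrow> real" where
  "bfs_norm \<rho> f = enn2real (\<rho> (\<lambda>x. ennreal (cmod (f x))))"

definition assoc_norm :: "bfnorm \<Rightarrow> bfnorm" where
  "assoc_norm \<rho> g = (SUP f \<in> {f \<in> borel_measurable lebesgue. \<rho> f \<le> 1}.
                        \<integral>\<^sup>+ x. f x * g x \<partial>lebesgue)"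

definition separable_bfs :: "bfnorm \<Rightarrow> bool" where
  "separable_bfs \<rho> \<longleftrightarrow> (\<exists>D. countable D \<and> D \<subseteq> bfs \<rho> \<and>
     (\<forall>f\<in>bfs \<rho>. \<forall>e>0. \<exists>d\<in>D. bfs_norm \<rho> (\<lambda>x. f x - d x) < e))"

definition maximal_op :: "(real \<Rightarrow> complex) \<Rightarrow> real \<Rightarrow> ennreal" where
  "maximal_op f x = (SUP ab \<in> {(a, b). a \<le> x \<and> x \<le> b \<and> a < b}.
      ennreal (1 / (snd ab - fst ab)) *
        (\<integral>\<^sup>+ y\<in>{fst ab..snd ab}. ennreal (cmod (f y)) \<partial>lebesgue))"

definition maximal_bounded_on :: "bfnorm \<Rightarrow> bool" where
  "maximal_bounded_on \<rho> \<longleftrightarrow> (\<exists>C::real. C > 0 \<and>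
     (\<forall>f\<in>bfs \<rho>. \<rho> (maximal_op f) \<le> ennreal C * \<rho> (\<lambda>x. ennreal (cmod (f x)))))"

definition wavelet_dil :: "(real \<Rightarrow> complex) \<Rightarrow> int \<Rightarrow> int \<Rightarrow> real \<Rightarrow> complex" where
  "wavelet_dil \<psi> j k x = complex_of_real (2 powr (real_of_int j / 2)) *
                           \<psi> (2 powr (real_of_int j) * x - real_of_int k)"

definition L2_fun :: "(real \<Rightarrow> complex) \<Rightarrow> bool" where
  "L2_fun f \<longleftrightarrow> f \<in> borel_measurable lebesgue \<and> integrable lebesgue (\<lambda>x. (cmod (f x))\<^sup>2)"

definition L2_inner :: "(real \<Rightarrow> complex) \<Rightarrow> (real \<Rightarrow> complex) \<Rightarrow> complex" where
  "L2_inner f g = (\<integral> x. f x * cnj (g x) \<partial>lebesgue)"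

definition orthonormal_wavelet :: "(real \<Rightarrow> complex) \<Rightarrow> bool" where
  "orthonormal_wavelet \<psi> \<longleftrightarrow> L2_fun \<psi> \<and>
     (\<forall>j k j' k'. L2_inner (wavelet_dil \<psi> j k) (wavelet_dil \<psi> j' k') =
                    (if j = j' \<and> k = k' then 1 else 0)) \<and>
     (\<forall>f. L2_fun f \<longrightarrow> (\<forall>j k. L2_inner f (wavelet_dil \<psi> j k) = 0) \<longrightarrow>
          (AE x in lebesgue. f x = 0))"

definition radial_decr_L1_majorant :: "(real \<Rightarrow> real) \<Rightarrow> (real \<Rightarrow> complex) \<Rightarrow> bool" where
  "radial_decr_L1_majorant W g \<longleftrightarrow>
     (\<forall>s\<ge>0. W s > 0) \<and>
     (\<forall>s t. 0 \<le> s \<longrightarrow> s \<le> t \<longrightarrow> W t \<le> W s) \<and>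
     set_integrable lborel {0..} W \<and>
     (AE x in lebesgue. cmod (g x) \<le> W \<bar>x\<bar>)"

definition ennreal_sqrt :: "ennreal \<Rightarrow> ennreal" where
  "ennreal_sqrt s = (if s = \<infinity> then \<infinity> else ennreal (sqrt (enn2real s)))"

definition wavelet_sqfun :: "(real \<Rightarrow> complex) \<Rightarrow> (real \<Rightarrow> complex) \<Rightarrow> real \<Rightarrow> ennreal" where
  "wavelet_sqfun \<psi> f x = ennreal_sqrt
     (\<integral>\<^sup>+ jk. ennreal ((cmod (L2_inner f (wavelet_dil \<psi> (fst jk) (snd jk)) *
                               wavelet_dil \<psi> (fst jk) (snd jk) x))\<^sup>2)
        \<partial>count_space (UNIV :: (int \<times> int) set))"

end

theory Submission
  imports Defs
begin

text \<open>
  Truncating the square function to finitely many indices, it suffices by duality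
  (\<open>\<rho> \<le> \<rho>''\<close>, proved by projecting onto the unit ball of \<open>\<rho>\<close> in \<open>L\<^sup>2\<close>) to show
  \<open>\<integral> (V f) g \<le> C \<integral> (M f) (M g)\<close> for bounded \<open>f\<close>, \<open>g\<close>, uniformly in the truncation. Sort the dyadic
  intervals \<open>I\<close> by the sizes of \<open>inf\<^sub>I M f\<close> and \<open>inf\<^sub>I M g\<close>. On one level, below a maximal
  interval \<open>J\<close>, every \<open>I\<close> contains points where the two maximal functions are at most \<open>1\<close>, after scaling,
  and the contribution is at most a constant times the length of \<open>J\<close>: split \<open>f\<close> at the maximal dyadic
  intervals with large mean into a bounded part, handled by Bessel's inequality, and mean-zero parts,
  whose contributions are absolutely summable by the decay and the Lipschitz bound of \<open>\<psi>\<close>.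
  All tails are controlled by majorizing \<open>\<psi>\<close> with \<open>\<Sum>i. c i * indicator {-(i+1)..i+1}\<close>, where
  \<open>\<Sum>i. c i * (i+1)\<^sup>2 < \<infinity>\<close> is what \<open>\<integral> s W(s) ds < \<infinity>\<close> provides.
\<close>

section \<open>Dyadic intervals and stopping families\<close>

text \<open>What is known about \<open>X\<close> is that \<open>M\<close> acts on it and on
  \<open>X'\<close>. Hence the form of the bilinear bound: Hoelder's inequality between
  \<open>X\<close> and \<open>X'\<close> turns it into the product of two operator norms. The
  obstacle is that the terms of the square function are not absolutely summable over all scales, so
  orthogonality must enter; it can do so only for a bounded function tested against a bounded
  weight. Therefore \<open>g\<close> needs a reduction as much as \<open>f\<close> does: it is
  replaced by its mean on stopped intervals of its own. This is legitimate for the coarser wavelets,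
  since their square function hardly oscillates there. The finer wavelets cause no diagonal terms:
  an interval of the level contains a point where the maximal function is small, so it cannot lie
  inside a stopped interval and is disjoint from it. What is left are interactions between separated
  intervals; these sum absolutely, by a geometric series over scales, to a multiple of the length of
  one interval. This is why all constants are explicit polynomials in the single number
  \<open>D\<close>.\<close>

definition dyadic :: "int \<Rightarrow> int \<Rightarrow> real set" where
  "dyadic j k = {x. \<lfloor>2 powr real_of_int j * x\<rfloor> = k}"

definition dlen :: "int \<Rightarrow> real" where
  "dlen j = 2 powr (- real_of_int j)"

text \<open>In other terms, the uncentred maximal function of \<open>h\<close> at \<open>x\<close>
  is at most \<open>a\<close>. The inequality is multiplied out by the length, so that it applies
  directly to \<open>ennreal\<close>-valued \<open>h\<close> and is easily checked for constants and
  rescalings.\<close>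

definition avg_bound :: "(real \<Rightarrow> ennreal) \<Rightarrow> real \<Rightarrow> real \<Rightarrow> bool" where
  "avg_bound h a x \<longleftrightarrow> (\<forall>l r. l \<le> x \<longrightarrow> x \<le> r \<longrightarrow> l < r \<longrightarrow>
     (\<integral>\<^sup>+ y\<in>{l..r}. h y \<partial>lebesgue) \<le> ennreal (a * (r - l)))"

lemma avg_boundD:
  "avg_bound h a x \<Longrightarrow> l \<le> x \<Longrightarrow> x \<le> r \<Longrightarrow> l < r \<Longrightarrow>
    (\<integral>\<^sup>+ y\<in>{l..r}. h y \<partial>lebesgue) \<le> ennreal (a * (r - l))"
  by (auto simp: avg_bound_def)

lemma avg_bound_const: "avg_bound (\<lambda>_. ennreal a) a x" if "a \<ge> 0"
  using that by (auto simp: avg_bound_def nn_integral_cmult_indicator ennreal_mult)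

lemma dlen_pos [simp]: "dlen j > 0"
  by (simp add: dlen_def)

lemma dlen_nonneg [simp]: "dlen j \<ge> 0"
  by (simp add: dlen_def)

lemma powr_dlen [simp]: "2 powr real_of_int j * dlen j = 1" "dlen j * 2 powr real_of_int j = 1"
  by (simp_all add: dlen_def powr_minus field_simps)

lemma dlen_half: "2 powr (- (real_of_int j / 2)) * 2 powr (real_of_int j / 2) = 1"
  "2 powr (- (real_of_int j / 2)) * 2 powr (- (real_of_int j / 2)) = dlen j"
  by (simp_all add: dlen_def powr_add [symmetric])

lemma dlen_Suc: "dlen (j + 1) = dlen j / 2"
  by (simp add: dlen_def powr_add powr_diff powr_minus field_simps)

lemma dyadic_iff: "x \<in> dyadic j k \<longleftrightarrow> k * dlen j \<le> x \<and> x < (k + 1) * dlen j"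
proof -
  have "x \<in> dyadic j k \<longleftrightarrow> k \<le> 2 powr j * x \<and> 2 powr j * x < k + 1"
    by (auto simp: dyadic_def floor_eq_iff)
  also have "\<dots> \<longleftrightarrow> k * dlen j \<le> x \<and> x < (k + 1) * dlen j"
    by (simp add: dlen_def powr_minus field_simps)
  finally show ?thesis by simp
qed

lemma dyadic_eq: "dyadic j k = {k * dlen j ..< (k + 1) * dlen j}"
  by (auto simp: dyadic_iff)

lemma dyadic_sets [measurable]: "dyadic j k \<in> sets lebesgue" "dyadic j k \<in> sets borel"
  by (auto simp: dyadic_eq)

lemma emeasure_dyadic [simp]: "emeasure lebesgue (dyadic j k) = ennreal (dlen j)"
  by (simp add: dyadic_eq algebra_simps mult_right_mono)

lemma dyadic_nonempty: "k * dlen j \<in> dyadic j k"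
  by (simp add: dyadic_iff algebra_simps)

lemma dyadic_disjoint: "k \<noteq> k' \<Longrightarrow> dyadic j k \<inter> dyadic j k' = {}"
  by (auto simp: dyadic_def)

lemma dlen_diff: "i \<le> j \<Longrightarrow> dlen i = 2 ^ nat (j - i) * dlen j"
  by (simp add: dlen_def powr_realpow [symmetric] powr_add [symmetric])

text \<open>The encoding by the floor pays off here: dividing by a power of two commutes with taking
  the floor, so the index of an ancestor is an integer quotient, also for negative
  \<open>k\<close>.\<close>

lemma dyadic_parent:
  assumes "i \<le> j" shows "dyadic j k \<subseteq> dyadic i (k div 2 ^ nat (j - i))"
proof
  fix x assume "x \<in> dyadic j k"
  then have k: "\<lfloor>2 powr j * x\<rfloor> = k" by (simp add: dyadic_def)
  have "2 powr real_of_int i = 2 powr real_of_int j / 2 ^ nat (j - i)"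
    using assms by (simp add: powr_realpow [symmetric] powr_diff [symmetric])
  then have "2 powr i * x = (2 powr j * x) / real_of_int (2 ^ nat (j - i))"
    by simp
  then show "x \<in> dyadic i (k div 2 ^ nat (j - i))"
    using floor_divide_real_eq_div [of "2 ^ nat (j - i)" "2 powr j * x"] k by (simp add: dyadic_def)
qed

lemma dyadic_nested:
  assumes "i \<le> j" "dyadic j k \<inter> dyadic i l \<noteq> {}" shows "dyadic j k \<subseteq> dyadic i l"
proof -
  have "dyadic i (k div 2 ^ nat (j - i)) \<inter> dyadic i l \<noteq> {}"
    using assms dyadic_parent [OF assms(1)] by blast
  then have "k div 2 ^ nat (j - i) = l" using dyadic_disjoint by blast
  then show ?thesis using dyadic_parent [OF assms(1)] by metis
qed

lemma dyadic_subset_imp_le: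
  assumes "dyadic j k \<subseteq> dyadic i l" shows "i \<le> j"
proof -
  have "emeasure lebesgue (dyadic j k) \<le> emeasure lebesgue (dyadic i l)"
    by (rule emeasure_mono[OF assms]) simp
  then have "dlen j \<le> dlen i" by simp
  then show ?thesis by (simp add: dlen_def)
qed

lemma dyadic_children:
  "dyadic j k = dyadic (j + 1) (2 * k) \<union> dyadic (j + 1) (2 * k + 1)"
  "dyadic (j + 1) (2 * k) \<inter> dyadic (j + 1) (2 * k + 1) = {}"
  unfolding dyadic_eq dlen_Suc by (auto simp: field_simps)

lemma avg_bound_dyadic:
  assumes "avg_bound h a x" "x \<in> dyadic j k"
  shows "(\<integral>\<^sup>+ y\<in>dyadic j k. h y \<partial>lebesgue) \<le> ennreal (a * dlen j)"
proof -
  have "(\<integral>\<^sup>+ y\<in>dyadic j k. h y \<partial>lebesgue) \<le> (\<integral>\<^sup>+ y\<in>{k * dlen j .. (k + 1) * dlen j}. h y \<partial>lebesgue)"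
    by (intro nn_integral_mono) (auto simp: dyadic_eq split: split_indicator)
  also have "\<dots> \<le> ennreal (a * ((k + 1) * dlen j - k * dlen j))"
    using assms(2) by (intro avg_boundD [OF assms(1)]) (auto simp: dyadic_iff algebra_simps)
  finally show ?thesis by (simp add: algebra_simps)
qed

text \<open>One identity between indicators encodes that the members cover \<open>dyadic j k\<close>
  and are disjoint, and it lets integrals be split by summation. The bound \<open>2\<close> on the
  mean is what a parent of mean at most \<open>1\<close> hands down to its children. Members at the
  finest scale \<open>M\<close> carry no lower bound on the mean.\<close>

definition stopping_family :: "(real \<Rightarrow> ennreal) \<Rightarrow> int \<Rightarrow> int \<Rightarrow> int \<Rightarrow> (int \<times> int) set \<Rightarrow> bool" where
  "stopping_family h M j k P \<longleftrightarrow> finite P \<and>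
     (\<forall>x. indicator (dyadic j k) x = (\<Sum>I\<in>P. indicator (dyadic (fst I) (snd I)) x :: ennreal)) \<and>
     (\<forall>I\<in>P. dyadic (fst I) (snd I) \<subseteq> dyadic j k \<and>
        (\<integral>\<^sup>+ y\<in>dyadic (fst I) (snd I). h y \<partial>lebesgue) \<le> ennreal (2 * dlen (fst I)) \<and>
        (fst I = M \<or> (\<integral>\<^sup>+ y\<in>dyadic (fst I) (snd I). h y \<partial>lebesgue) > ennreal (dlen (fst I))))"

lemma stopping_family_Un:
  assumes "stopping_family h M (j + 1) (2 * k) P1" "stopping_family h M (j + 1) (2 * k + 1) P2"
  shows "stopping_family h M j k (P1 \<union> P2)"
proof -
  have sub: "dyadic (j + 1) (2 * k) \<subseteq> dyadic j k" "dyadic (j + 1) (2 * k + 1) \<subseteq> dyadic j k"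
    using dyadic_children(1) [of j k] by auto
  have "P1 \<inter> P2 = {}"
  proof -
    have False if a: "I \<in> P1" "I \<in> P2" for I
    proof -
      have "dyadic (fst I) (snd I) \<subseteq> dyadic (j + 1) (2 * k) \<inter> dyadic (j + 1) (2 * k + 1)"
        using assms a unfolding stopping_family_def by blast
      then show False
        using dyadic_children(2) [of j k] dyadic_nonempty [of "snd I" "fst I"] by blast
    qed
    then show ?thesis by auto
  qed
  moreover have "indicator (dyadic j k) x = (indicator (dyadic (j + 1) (2 * k)) x +
        indicator (dyadic (j + 1) (2 * k + 1)) x :: ennreal)" for x
    using dyadic_children [of j k] by (auto split: split_indicator)
  ultimately have "indicator (dyadic j k) x = (\<Sum>I\<in>P1 \<union> P2. indicator (dyadic (fst I) (snd I)) x :: ennreal)" for x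
    using assms by (simp add: stopping_family_def sum.union_disjoint)
  moreover have "finite (P1 \<union> P2)" using assms by (simp add: stopping_family_def)
  ultimately show ?thesis
    unfolding stopping_family_def
  proof (intro conjI ballI allI)
    fix I assume "I \<in> P1 \<union> P2"
    then consider "I \<in> P1" | "I \<in> P2" by blast
    then show "dyadic (fst I) (snd I) \<subseteq> dyadic j k"
      "(\<integral>\<^sup>+ y\<in>dyadic (fst I) (snd I). h y \<partial>lebesgue) \<le> ennreal (2 * dlen (fst I))"
      "fst I = M \<or> (\<integral>\<^sup>+ y\<in>dyadic (fst I) (snd I). h y \<partial>lebesgue) > ennreal (dlen (fst I))"
      by (cases; use assms sub in \<open>unfold stopping_family_def, blast\<close>)+
  qed
qed

text \<open>Stopping at the maximal dyadic subintervals on which the average of \<open>h\<close> exceeds \<open>1\<close>,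
  or at the finest scale \<open>M\<close>; the latter keeps the family finite and makes Lebesgue's
  differentiation theorem superfluous.\<close>

lemma stopping_family_exists:
  assumes "j \<le> M" "(\<integral>\<^sup>+ y\<in>dyadic j k. h y \<partial>lebesgue) \<le> ennreal (2 * dlen j)"
  shows "\<exists>P. stopping_family h M j k P"
  using assms
proof (induction "nat (M - j)" arbitrary: j k)
  case 0
  then show ?case by (intro exI [of _ "{(j, k)}"]) (simp add: stopping_family_def)
next
  case (Suc n)
  show ?case
  proof (cases "(\<integral>\<^sup>+ y\<in>dyadic j k. h y \<partial>lebesgue) > ennreal (dlen j)")
    case True
    then show ?thesis using Suc.prems by (intro exI [of _ "{(j, k)}"]) (simp add: stopping_family_def)
  next
    case False
    \<comment> \<open>The induction invariant is a mean of at most \<open>2\<close>. The interval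
      was not stopped, so its mean is at most \<open>1\<close>, and a child of half the length has
      mean at most \<open>2\<close>.\<close>
    have ch: "\<exists>P. stopping_family h M (j + 1) k' P" if "dyadic (j + 1) k' \<subseteq> dyadic j k" for k'
    proof (rule Suc.hyps(1))
      show "n = nat (M - (j + 1))" "j + 1 \<le> M" using Suc.hyps(2) by auto
      have "(\<integral>\<^sup>+ y\<in>dyadic (j + 1) k'. h y \<partial>lebesgue) \<le> (\<integral>\<^sup>+ y\<in>dyadic j k. h y \<partial>lebesgue)"
        using that by (intro nn_integral_mono) (auto split: split_indicator)
      also have "\<dots> \<le> ennreal (dlen j)" using False by simp
      finally show "(\<integral>\<^sup>+ y\<in>dyadic (j + 1) k'. h y \<partial>lebesgue) \<le> ennreal (2 * dlen (j + 1))"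
        by (simp add: dlen_Suc)
    qed
    have sub: "dyadic (j + 1) (2 * k) \<subseteq> dyadic j k" "dyadic (j + 1) (2 * k + 1) \<subseteq> dyadic j k"
      using dyadic_children(1) [of j k] by auto
    obtain P1 where P1: "stopping_family h M (j + 1) (2 * k) P1" using ch [OF sub(1)] by blast
    obtain P2 where P2: "stopping_family h M (j + 1) (2 * k + 1) P2" using ch [OF sub(2)] by blast
    show ?thesis using stopping_family_Un [OF P1 P2] by blast
  qed
qed

text \<open>Each scale occurs once in \<open>A\<close>, so the sum is dominated by the geometric
  series that starts at the coarsest admissible scale \<open>p\<close>.\<close>

lemma sum_dlen_le:
  assumes "finite A" "\<And>j. j \<in> A \<Longrightarrow> p \<le> j"
  shows "(\<Sum>j\<in>A. dlen j) \<le> 2 * dlen p"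
proof -
  have "(\<Sum>j\<in>A. dlen j) = (\<Sum>n\<in>(\<lambda>j. nat (j - p)) ` A. dlen p * (1/2) ^ n)"
  proof (subst sum.reindex)
    show "inj_on (\<lambda>j. nat (j - p)) A" using assms(2) by (intro inj_onI) (metis diff_add_cancel diff_ge_0_iff_ge eq_nat_nat_iff)
    show "(\<Sum>j\<in>A. dlen j) = (\<Sum>j\<in>A. ((\<lambda>n. dlen p * (1/2) ^ n) \<circ> (\<lambda>j. nat (j - p))) j)"
    proof (rule sum.cong [OF refl])
      fix j assume "j \<in> A"
      then have "dlen p = 2 ^ nat (j - p) * dlen j" by (intro dlen_diff assms(2))
      then show "dlen j = ((\<lambda>n. dlen p * (1/2) ^ n) \<circ> (\<lambda>j. nat (j - p))) j"
        by (simp add: power_one_over)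
    qed
  qed
  also have "\<dots> \<le> (\<Sum>n. dlen p * (1/2) ^ n)"
    using assms(1) by (intro sum_le_suminf summable_mult summable_geometric) (auto intro!: mult_nonneg_nonneg)
  also have "\<dots> = dlen p * 2"
    by (subst suminf_mult) (auto intro!: summable_geometric simp: suminf_geometric)
  finally show ?thesis by simp
qed

text \<open>Reflecting \<open>j\<close> to \<open>-j\<close> turns this into the preceding geometric
  series. It is the form in which scales coarser than \<open>p\<close> are summed.\<close>

lemma sum_powr_le:
  assumes "finite A" "\<And>j. j \<in> A \<Longrightarrow> j < p"
  shows "(\<Sum>j\<in>A. 2 powr real_of_int j) * dlen p \<le> 1"
proof -
  have "(\<Sum>j\<in>A. 2 powr real_of_int j) = (\<Sum>j\<in>uminus ` A. dlen j)"
    by (subst sum.reindex) (auto simp: dlen_def)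
  also have "\<dots> \<le> 2 * dlen (1 - p)"
    using assms by (intro sum_dlen_le) (auto simp: less_imp_le dest!: assms(2))
  also have "\<dots> = 2 powr p"
    by (simp add: dlen_def powr_diff)
  finally have "(\<Sum>j\<in>A. 2 powr real_of_int j) * dlen p \<le> 2 powr p * dlen p"
    by (rule mult_right_mono) simp
  then show ?thesis by simp
qed

section \<open>Kernel estimates\<close>

text \<open>A layer-cake representation of an even decreasing profile, whose weights
  \<open>c i\<close> will be the drops of the profile. It reduces every tail estimate to counting
  the intervals whose dilate by \<open>i + 1\<close> reaches a given set.\<close>

definition majorant :: "(nat \<Rightarrow> real) \<Rightarrow> real \<Rightarrow> ennreal" where
  "majorant c u = (\<Sum>i. ennreal (c i) * indicator {- (real i + 1)..real i + 1} u)"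

lemma borel_measurable_majorant [measurable]: "majorant c \<in> borel_measurable borel"
  unfolding majorant_def by measurable

lemma card_int_interval_le:
  fixes t :: real
  assumes "finite K"
  shows "card {k\<in>K. \<bar>t - real_of_int k\<bar> \<le> real i + 1} \<le> 3 * (i + 1)"
proof -
  have "{k\<in>K. \<bar>t - real_of_int k\<bar> \<le> real i + 1} \<subseteq> {\<lfloor>t\<rfloor> - int i .. \<lfloor>t\<rfloor> + int i + 1} \<union> {\<lfloor>t\<rfloor> - int i - 1}"
  proof
    fix k assume "k \<in> {k\<in>K. \<bar>t - real_of_int k\<bar> \<le> real i + 1}"
    then have "t - k \<le> real i + 1" "k - t \<le> real i + 1" by auto
    then have "k \<le> \<lfloor>t\<rfloor> + int i + 1" "\<lfloor>t\<rfloor> - int i - 1 \<le> k" by linarith+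
    then show "k \<in> {\<lfloor>t\<rfloor> - int i .. \<lfloor>t\<rfloor> + int i + 1} \<union> {\<lfloor>t\<rfloor> - int i - 1}" by auto
  qed
  then have "card {k\<in>K. \<bar>t - real_of_int k\<bar> \<le> real i + 1}
      \<le> card ({\<lfloor>t\<rfloor> - int i .. \<lfloor>t\<rfloor> + int i + 1} \<union> {\<lfloor>t\<rfloor> - int i - 1})"
    by (intro card_mono) auto
  also have "\<dots> \<le> card {\<lfloor>t\<rfloor> - int i .. \<lfloor>t\<rfloor> + int i + 1} + card {\<lfloor>t\<rfloor> - int i - 1}"
    by (rule card_Un_le)
  also have "\<dots> \<le> 3 * (i + 1)" by simp
  finally show ?thesis .
qed

text \<open>Measured in units of \<open>dlen j\<close>, an interval of a coarser scale
  \<open>p\<close> has integer endpoints, so that the position of finer intervals relative to it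
  becomes a matter of integer inequalities.\<close>

lemma dyadic_rescaled:
  assumes "p \<le> j"
  shows "x \<in> dyadic p q \<longleftrightarrow> real_of_int (q * 2 ^ nat (j - p)) \<le> 2 powr j * x \<and>
    2 powr j * x < real_of_int ((q + 1) * 2 ^ nat (j - p))"
proof -
  have "m * dlen j \<le> x \<longleftrightarrow> m \<le> 2 powr j * x" "x < m * dlen j \<longleftrightarrow> 2 powr j * x < m" for m
    by (simp_all add: dlen_def powr_minus field_simps)
  moreover have "dlen p = 2 ^ nat (j - p) * dlen j" using assms by (rule dlen_diff)
  then have "real_of_int m * dlen p = real_of_int (m * 2 ^ nat (j - p)) * dlen j" for m
    by simp
  ultimately show ?thesis unfolding dyadic_iff by (metis of_int_1 of_int_add)
qed

lemma dyadic_rescaled_left: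
  assumes "p \<le> j"
  shows "real_of_int k * dlen j \<in> dyadic p q \<longleftrightarrow> q * 2 ^ nat (j - p) \<le> k \<and> k < (q + 1) * 2 ^ nat (j - p)"
proof -
  have "2 powr j * (real_of_int k * dlen j) = real_of_int k"
    using powr_dlen(1) [of j] by (simp add: mult.left_commute)
  then show ?thesis unfolding dyadic_rescaled [OF assms] by (simp only: of_int_le_iff of_int_less_iff)
qed

text \<open>After dilation only intervals within about \<open>i + 1\<close> units of one of the two
  endpoints of \<open>dyadic p q\<close> can reach it, so the count does not grow with the ratio of
  the lengths. This independence is what makes the sum over all finer scales converge.\<close>

lemma card_near_dyadic:
  assumes "p \<le> j" "finite K" "\<And>k. k \<in> K \<Longrightarrow> dyadic j k \<inter> dyadic p q = {}"
  shows "card {k\<in>K. \<exists>x\<in>dyadic p q. \<bar>2 powr real_of_int j * x - real_of_int k\<bar> \<le> real i + 1} \<le> 4 * (i + 1)"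
proof -
  define l r where "l = q * 2 ^ nat (j - p)" and "r = (q + 1) * 2 ^ nat (j - p)"
  have "{k\<in>K. \<exists>x\<in>dyadic p q. \<bar>2 powr real_of_int j * x - real_of_int k\<bar> \<le> real i + 1}
    \<subseteq> {l - int i - 1..l - 1} \<union> {r..r + int i + 1}"
  proof
    fix k assume "k \<in> {k\<in>K. \<exists>x\<in>dyadic p q. \<bar>2 powr real_of_int j * x - real_of_int k\<bar> \<le> real i + 1}"
    then obtain x where x: "k \<in> K" "x \<in> dyadic p q" "\<bar>2 powr real_of_int j * x - real_of_int k\<bar> \<le> real i + 1"
      by auto
    have "real_of_int k * dlen j \<notin> dyadic p q"
      using assms(3) [OF x(1)] dyadic_nonempty [of k j] by auto
    then have "k < l \<or> r \<le> k"
      unfolding dyadic_rescaled_left [OF assms(1)] l_def r_def by linarith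
    moreover have "real_of_int l \<le> 2 powr j * x" "2 powr j * x < real_of_int r"
      using x(2) unfolding dyadic_rescaled [OF assms(1)] l_def r_def by auto
    then have "real_of_int l - real i - 1 \<le> k" "real_of_int k \<le> real_of_int r + real i + 1" using x(3) by linarith+
    then have "l - int i - 1 \<le> k" "k \<le> r + int i + 1" by linarith+
    ultimately show "k \<in> {l - int i - 1..l - 1} \<union> {r..r + int i + 1}" by auto
  qed
  then have "card {k\<in>K. \<exists>x\<in>dyadic p q. \<bar>2 powr real_of_int j * x - real_of_int k\<bar> \<le> real i + 1}
    \<le> card ({l - int i - 1..l - 1} \<union> {r..r + int i + 1})"
    by (intro card_mono) auto
  also have "\<dots> \<le> card {l - int i - 1..l - 1} + card {r..r + int i + 1}" by (rule card_Un_le)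
  also have "\<dots> \<le> 4 * (i + 1)" by simp
  finally show ?thesis .
qed

text \<open>The mirror image of the preceding count: an interval inside whose dilate sticks out must
  again lie close to an endpoint.\<close>

lemma card_near_complement:
  assumes "p \<le> j" "finite K" "\<And>k. k \<in> K \<Longrightarrow> dyadic j k \<subseteq> dyadic p q"
  shows "card {k\<in>K. \<exists>x\<in>- dyadic p q. \<bar>2 powr real_of_int j * x - real_of_int k\<bar> \<le> real i + 1} \<le> 4 * (i + 1)"
proof -
  define l r where "l = q * 2 ^ nat (j - p)" and "r = (q + 1) * 2 ^ nat (j - p)"
  have "{k\<in>K. \<exists>x\<in>- dyadic p q. \<bar>2 powr real_of_int j * x - real_of_int k\<bar> \<le> real i + 1}
    \<subseteq> {l..l + int i + 1} \<union> {r - int i - 1..r - 1}"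
  proof
    fix k assume "k \<in> {k\<in>K. \<exists>x\<in>- dyadic p q. \<bar>2 powr real_of_int j * x - real_of_int k\<bar> \<le> real i + 1}"
    then obtain x where x: "k \<in> K" "x \<notin> dyadic p q" "\<bar>2 powr real_of_int j * x - real_of_int k\<bar> \<le> real i + 1"
      by auto
    have "real_of_int k * dlen j \<in> dyadic p q"
      using assms(3) [OF x(1)] dyadic_nonempty [of k j] by auto
    then have "l \<le> k" "k < r"
      unfolding dyadic_rescaled_left [OF assms(1)] l_def r_def by auto
    moreover have "2 powr j * x < real_of_int l \<or> real_of_int r \<le> 2 powr j * x"
      using x(2) unfolding dyadic_rescaled [OF assms(1)] l_def r_def by linarith
    then have "real_of_int k \<le> l + real i + 1 \<or> real_of_int r - real i - 1 \<le> real_of_int k" using x(3) by linarith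
    then have "k \<le> l + int i + 1 \<or> r - int i - 1 \<le> k" by linarith
    ultimately show "k \<in> {l..l + int i + 1} \<union> {r - int i - 1..r - 1}" by auto
  qed
  then have "card {k\<in>K. \<exists>x\<in>- dyadic p q. \<bar>2 powr real_of_int j * x - real_of_int k\<bar> \<le> real i + 1}
    \<le> card ({l..l + int i + 1} \<union> {r - int i - 1..r - 1})"
    by (intro card_mono) auto
  also have "\<dots> \<le> card {l..l + int i + 1} + card {r - int i - 1..r - 1}" by (rule card_Un_le)
  also have "\<dots> \<le> 4 * (i + 1)" by simp
  finally show ?thesis .
qed

lemma sum_fiberwise:
  assumes "finite F"
  shows "(\<Sum>I\<in>F. f (fst I) (snd I)) = (\<Sum>j\<in>fst ` F. \<Sum>k\<in>{k. (j, k) \<in> F}. f j k)"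
proof -
  have fin: "finite {k. (j, k) \<in> F}" for j
    by (rule finite_subset [OF _ finite_imageI [OF assms, of snd]]) force
  have "F = Sigma (fst ` F) (\<lambda>j. {k. (j, k) \<in> F})" by force
  then have "(\<Sum>I\<in>F. f (fst I) (snd I)) = (\<Sum>(j, k)\<in>Sigma (fst ` F) (\<lambda>j. {k. (j, k) \<in> F}). f j k)"
    by (simp add: split_beta)
  also have "\<dots> = (\<Sum>j\<in>fst ` F. \<Sum>k\<in>{k. (j, k) \<in> F}. f j k)"
    using assms fin by (intro sum.Sigma [symmetric]) auto
  finally show ?thesis .
qed

lemma finite_fiber: "finite F \<Longrightarrow> finite {k. (j, k) \<in> F}"
  by (rule finite_subset [OF _ finite_imageI [of F snd]]) force+

text \<open>Size and smoothness of the wavelet as the estimates use them. The bounds hold at every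
  point and not just almost everywhere, because increments are taken from individual points of an
  interval. The square in \<open>c_summable\<close> pays for two factors \<open>i + 1\<close>: the
  length of a dilated interval, and the number of intervals whose dilate reaches a given
  set.\<close>

locale wavelet_kernel =
  fixes \<psi> :: "real \<Rightarrow> complex" and c :: "nat \<Rightarrow> real"
  assumes c_nonneg: "c i \<ge> 0"
    and c_summable: "summable (\<lambda>i. c i * (real i + 1)\<^sup>2)"
    and psi_measurable [measurable]: "\<psi> \<in> borel_measurable borel"
    and psi_le: "ennreal (cmod (\<psi> u)) \<le> majorant c u"
    and psi_diff_le: "\<bar>u - v\<bar> \<le> 1 \<Longrightarrow> ennreal (cmod (\<psi> u - \<psi> v)) \<le> ennreal \<bar>u - v\<bar> * majorant c u"
begin

abbreviation apsi :: "int \<times> int \<Rightarrow> real \<Rightarrow> ennreal" where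
  "apsi I x \<equiv> ennreal (cmod (wavelet_dil \<psi> (fst I) (snd I) x))"

text \<open>The square root of the interval length. It is the order of the integral of
  \<open>apsi I\<close>, hence of the coefficient of a function of height one; sums of coefficients
  are estimated after multiplication by it, which makes them comparable to lengths.\<close>

abbreviation scale :: "int \<times> int \<Rightarrow> ennreal" where
  "scale I \<equiv> ennreal (2 powr - (real_of_int (fst I) / 2))"

abbreviation psi :: "int \<times> int \<Rightarrow> real \<Rightarrow> complex" where
  "psi I \<equiv> wavelet_dil \<psi> (fst I) (snd I)"

definition D :: real where "D = (\<Sum>i. c i * (real i + 1)\<^sup>2)"

lemma D_nonneg: "D \<ge> 0"
  unfolding D_def using c_nonneg by (intro suminf_nonneg c_summable) auto

lemma suminf_c_le:
  assumes "\<And>i. f i \<le> ennreal (B * (real i + 1)\<^sup>2)" "B \<ge> 0"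
  shows "(\<Sum>i. ennreal (c i) * f i) \<le> ennreal (B * D)"
proof -
  have "(\<Sum>i. ennreal (c i) * f i) \<le> (\<Sum>i. ennreal (B * (c i * (real i + 1)\<^sup>2)))"
  proof (rule suminf_le)
    fix i
    have "ennreal (c i) * f i \<le> ennreal (c i) * ennreal (B * (real i + 1)\<^sup>2)"
      by (intro mult_left_mono assms) auto
    also have "\<dots> = ennreal (B * (c i * (real i + 1)\<^sup>2))"
      using c_nonneg [of i] assms(2) by (simp add: ennreal_mult [symmetric] mult.left_commute)
    finally show "ennreal (c i) * f i \<le> ennreal (B * (c i * (real i + 1)\<^sup>2))" .
  qed auto
  also have "\<dots> = ennreal (\<Sum>i. B * (c i * (real i + 1)\<^sup>2))"
    using assms(2) c_nonneg by (intro suminf_ennreal2 summable_mult c_summable) auto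
  also have "(\<Sum>i. B * (c i * (real i + 1)\<^sup>2)) = B * D"
    unfolding D_def by (intro suminf_mult c_summable)
  finally show ?thesis .
qed

lemma majorant_le_D: "majorant c u \<le> ennreal D"
proof -
  have "majorant c u \<le> ennreal (1 * D)"
    unfolding majorant_def
    by (rule suminf_c_le) (auto split: split_indicator)
  then show ?thesis by simp
qed

lemma psi_bounded: "cmod (\<psi> u) \<le> D"
  using order_trans [OF psi_le majorant_le_D] D_nonneg by (simp add: ennreal_le_iff)

lemma psi_dil_measurable_borel [measurable]: "wavelet_dil \<psi> j k \<in> borel_measurable borel"
  unfolding wavelet_dil_def by measurable

lemma psi_dil_measurable [measurable]: "wavelet_dil \<psi> j k \<in> borel_measurable lebesgue"
  using psi_dil_measurable_borel by (simp add: measurable_completion)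

lemma cmod_psi_dil: "cmod (wavelet_dil \<psi> j k x) = 2 powr (j / 2) * cmod (\<psi> (2 powr j * x - k))"
  by (simp add: wavelet_dil_def norm_mult)

lemma psi_dil_bounded: "cmod (wavelet_dil \<psi> j k x) \<le> 2 powr (j / 2) * D"
  unfolding cmod_psi_dil by (intro mult_left_mono psi_bounded) auto

lemma psi_dil_le:
  "ennreal (cmod (wavelet_dil \<psi> j k x)) \<le> ennreal (2 powr (j / 2)) * majorant c (2 powr j * x - k)"
  unfolding cmod_psi_dil by (simp add: ennreal_mult mult_left_mono psi_le)

text \<open>Integrating the layers of the majorant one by one replaces the kernel by the masses of
  \<open>h\<close> on the dilates of \<open>dyadic j k\<close>.\<close>

lemma set_nn_integral_psi_le:
  assumes [measurable]: "h \<in> borel_measurable lebesgue" "S \<in> sets lebesgue"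
  shows "(\<integral>\<^sup>+ x\<in>S. (h x * ennreal (cmod (wavelet_dil \<psi> j k x))) \<partial>lebesgue) \<le> ennreal (2 powr (j / 2)) *
    (\<Sum>i. ennreal (c i) * (\<integral>\<^sup>+ x\<in>S \<inter> {x. \<bar>2 powr real_of_int j * x - k\<bar> \<le> real i + 1}. h x \<partial>lebesgue))"
proof -
  define T where "T i = {x. \<bar>2 powr real_of_int j * x - k\<bar> \<le> real i + 1}" for i
  have [measurable]: "T i \<in> sets lebesgue" for i
    unfolding T_def by (rule sets_completionI_sets) (simp, measurable)
  have "(\<integral>\<^sup>+ x\<in>S. (h x * ennreal (cmod (wavelet_dil \<psi> j k x))) \<partial>lebesgue)
    \<le> (\<integral>\<^sup>+ x. ennreal (2 powr (j / 2)) * (\<Sum>i. ennreal (c i) *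
        (h x * indicator (S \<inter> T i) x)) \<partial>lebesgue)"
  proof (rule nn_integral_mono)
    fix x
    have "h x * ennreal (cmod (wavelet_dil \<psi> j k x)) * indicator S x
      \<le> (h x * indicator S x) * (ennreal (2 powr (j / 2)) * majorant c (2 powr j * x - k))"
      using mult_left_mono [OF psi_dil_le, of "h x * indicator S x" j k x] by (simp add: mult_ac)
    also have "\<dots> = ennreal (2 powr (j / 2)) * (\<Sum>i. (h x * indicator S x) *
         (ennreal (c i) * indicator {- (real i + 1)..real i + 1} (2 powr j * x - k)))"
      unfolding majorant_def ennreal_suminf_cmult by (rule mult.left_commute)
    also have "(\<lambda>i. (h x * indicator S x) *
         (ennreal (c i) * indicator {- (real i + 1)..real i + 1} (2 powr j * x - k))) =
       (\<lambda>i. ennreal (c i) * (h x * indicator (S \<inter> T i) x))"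
      by (auto split: split_indicator simp: T_def mult_ac fun_eq_iff abs_le_iff)
    finally show "h x * ennreal (cmod (wavelet_dil \<psi> j k x)) * indicator S x \<le>
      ennreal (2 powr (j / 2)) * (\<Sum>i. ennreal (c i) *
        (h x * indicator (S \<inter> T i) x))" .
  qed
  also have "\<dots> = ennreal (2 powr (j / 2)) * (\<Sum>i. ennreal (c i) *
      (\<integral>\<^sup>+ x\<in>S \<inter> T i. h x \<partial>lebesgue))"
    apply (subst nn_integral_cmult, measurable)
    apply (subst nn_integral_suminf, measurable)
    apply (subst nn_integral_cmult, measurable)
    done
  finally show ?thesis unfolding T_def .
qed

text \<open>The dilate contains all of \<open>dyadic j k\<close>, hence the point \<open>x\<close>
  at which the averages of \<open>h\<close> are controlled; its length is \<open>2 * (i + 1)\<close>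
  units.\<close>

lemma avg_bound_dilated:
  assumes "avg_bound h a x" "x \<in> dyadic j k"
  shows "(\<integral>\<^sup>+ y\<in>{y. \<bar>2 powr real_of_int j * y - k\<bar> \<le> real i + 1}. h y \<partial>lebesgue)
    \<le> ennreal (2 * a * dlen j * (real i + 1))"
proof -
  have "{y. \<bar>2 powr real_of_int j * y - k\<bar> \<le> real i + 1} = {(k - (real i + 1)) * dlen j .. (k + (real i + 1)) * dlen j}"
    by (auto simp: dlen_def powr_minus field_simps abs_le_iff)
  moreover have "(\<integral>\<^sup>+ y\<in>{(k - (real i + 1)) * dlen j .. (k + (real i + 1)) * dlen j}. h y \<partial>lebesgue)
    \<le> ennreal (a * ((k + (real i + 1)) * dlen j - (k - (real i + 1)) * dlen j))"
  proof (rule avg_boundD [OF assms(1)])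
    have "k * dlen j \<le> x" "x < (k + 1) * dlen j" using assms(2) by (auto simp: dyadic_iff)
    moreover have "(k - (real i + 1)) * dlen j \<le> k * dlen j" "(k + 1) * dlen j \<le> (k + (real i + 1)) * dlen j"
      by (intro mult_right_mono; simp)+
    ultimately show "(k - (real i + 1)) * dlen j \<le> x" "x \<le> (k + (real i + 1)) * dlen j" by linarith+
    show "(k - (real i + 1)) * dlen j < (k + (real i + 1)) * dlen j"
      by (intro mult_strict_right_mono) auto
  qed
  ultimately show ?thesis by (simp add: algebra_simps)
qed

text \<open>In layer \<open>i\<close> at most \<open>4 * (i + 1)\<close> indices contribute, each
  with mass at most \<open>2 * a * dlen j * (i + 1)\<close>. The product is quadratic in
  \<open>i + 1\<close>, which is exactly what the series \<open>D\<close> absorbs. The position of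
  \<open>S\<close> enters only through the count \<open>cnt\<close>.\<close>

lemma tail_sum_scale:
  assumes [measurable]: "h \<in> borel_measurable lebesgue" "S \<in> sets lebesgue"
    and "finite K" "a \<ge> 0" and avg: "\<And>k. k \<in> K \<Longrightarrow> \<exists>x\<in>dyadic j k. avg_bound h a x"
    and cnt: "\<And>i. card {k\<in>K. \<exists>x\<in>S. \<bar>2 powr real_of_int j * x - real_of_int k\<bar> \<le> real i + 1} \<le> 4 * (i + 1)"
  shows "(\<Sum>k\<in>K. ennreal (2 powr - (j / 2)) * (\<integral>\<^sup>+ x\<in>S. (h x * ennreal (cmod (wavelet_dil \<psi> j k x))) \<partial>lebesgue))
    \<le> ennreal (8 * a * D * dlen j)"
proof -
  define T where "T i k = {x. \<bar>2 powr real_of_int j * x - real_of_int k\<bar> \<le> real i + 1}" for i k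
  have [measurable]: "T i k \<in> sets lebesgue" for i k
    unfolding T_def by (rule sets_completionI_sets) (simp, measurable)
  have "(\<Sum>k\<in>K. ennreal (2 powr - (j / 2)) * (\<integral>\<^sup>+ x\<in>S. (h x * ennreal (cmod (wavelet_dil \<psi> j k x))) \<partial>lebesgue))
    \<le> (\<Sum>k\<in>K. \<Sum>i. ennreal (c i) * (\<integral>\<^sup>+ x\<in>S \<inter> T i k. h x \<partial>lebesgue))"
  proof (rule sum_mono)
    fix k
    have "ennreal (2 powr - (j / 2)) * (\<integral>\<^sup>+ x\<in>S. (h x * ennreal (cmod (wavelet_dil \<psi> j k x))) \<partial>lebesgue)
      \<le> ennreal (2 powr - (j / 2)) * (ennreal (2 powr (j / 2)) *
         (\<Sum>i. ennreal (c i) * (\<integral>\<^sup>+ x\<in>S \<inter> T i k. h x \<partial>lebesgue)))"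
      unfolding T_def by (intro mult_left_mono set_nn_integral_psi_le assms) auto
    also have "\<dots> = ennreal (2 powr - (j / 2) * 2 powr (j / 2)) *
        (\<Sum>i. ennreal (c i) * (\<integral>\<^sup>+ x\<in>S \<inter> T i k. h x \<partial>lebesgue))"
      by (simp add: ennreal_mult mult.assoc)
    also have "\<dots> = (\<Sum>i. ennreal (c i) * (\<integral>\<^sup>+ x\<in>S \<inter> T i k. h x \<partial>lebesgue))"
      by (simp only: dlen_half) simp
    finally show "ennreal (2 powr - (j / 2)) * (\<integral>\<^sup>+ x\<in>S. (h x * ennreal (cmod (wavelet_dil \<psi> j k x))) \<partial>lebesgue)
      \<le> (\<Sum>i. ennreal (c i) * (\<integral>\<^sup>+ x\<in>S \<inter> T i k. h x \<partial>lebesgue))" .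
  qed
  also have "\<dots> = (\<Sum>i. ennreal (c i) * (\<Sum>k\<in>K. \<integral>\<^sup>+ x\<in>S \<inter> T i k. h x \<partial>lebesgue))"
    by (subst suminf_sum [symmetric]) (auto simp: sum_distrib_left)
  also have "\<dots> \<le> ennreal ((8 * a * dlen j) * D)"
  proof (rule suminf_c_le)
    fix i
    let ?K = "{k\<in>K. \<exists>x\<in>S. \<bar>2 powr real_of_int j * x - real_of_int k\<bar> \<le> real i + 1}"
    \<comment> \<open>Indices whose dilated interval misses \<open>S\<close> contribute zero; after
      they are dropped the index set is the one counted by \<open>cnt\<close>.\<close>
    have "(\<Sum>k\<in>K. \<integral>\<^sup>+ x\<in>S \<inter> T i k. h x \<partial>lebesgue) = (\<Sum>k\<in>?K. \<integral>\<^sup>+ x\<in>S \<inter> T i k. h x \<partial>lebesgue)"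
    proof (rule sum.mono_neutral_right)
      show "\<forall>k\<in>K - ?K. (\<integral>\<^sup>+ x\<in>S \<inter> T i k. h x \<partial>lebesgue) = 0"
      proof
        fix k assume "k \<in> K - ?K"
        then have "S \<inter> T i k = {}" by (auto simp: T_def)
        then show "(\<integral>\<^sup>+ x\<in>S \<inter> T i k. h x \<partial>lebesgue) = 0" by simp
      qed
    qed (use assms in auto)
    also have "\<dots> \<le> (\<Sum>k\<in>?K. ennreal (2 * a * dlen j * (real i + 1)))"
    proof (rule sum_mono)
      fix k assume "k \<in> ?K"
      then obtain x where "x \<in> dyadic j k" "avg_bound h a x" using avg by blast
      then have "(\<integral>\<^sup>+ x\<in>T i k. h x \<partial>lebesgue) \<le> ennreal (2 * a * dlen j * (real i + 1))"
        unfolding T_def by (intro avg_bound_dilated)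
      moreover have "(\<integral>\<^sup>+ x\<in>S \<inter> T i k. h x \<partial>lebesgue) \<le> (\<integral>\<^sup>+ x\<in>T i k. h x \<partial>lebesgue)"
        by (intro nn_integral_mono) (auto split: split_indicator)
      ultimately show "(\<integral>\<^sup>+ x\<in>S \<inter> T i k. h x \<partial>lebesgue) \<le> ennreal (2 * a * dlen j * (real i + 1))"
        by (rule order_trans [rotated])
    qed
    also have "\<dots> = ennreal (real (card ?K) * (2 * a * dlen j * (real i + 1)))"
      using assms(4) by (simp add: ennreal_mult' ennreal_of_nat_eq_real_of_nat)
    also have "\<dots> \<le> ennreal (real (4 * (i + 1)) * (2 * a * dlen j * (real i + 1)))"
      using assms(4) cnt [of i] by (intro ennreal_leI mult_right_mono) (auto simp only: of_nat_le_iff, auto)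
    also have "real (4 * (i + 1)) * (2 * a * dlen j * (real i + 1)) = 8 * a * dlen j * (real i + 1)\<^sup>2"
      by (simp add: power2_eq_square algebra_simps)
    finally show "(\<Sum>k\<in>K. \<integral>\<^sup>+ x\<in>S \<inter> T i k. h x \<partial>lebesgue) \<le> ennreal (8 * a * dlen j * (real i + 1)\<^sup>2)" .
  qed (use assms(4) in auto)
  finally show ?thesis by (simp add: mult_ac)
qed

text \<open>The bound for one scale is proportional to \<open>dlen j\<close>, so summing it over the
  scales from \<open>p\<close> on costs just another factor \<open>2\<close>.\<close>

lemma tail_sum:
  assumes [measurable]: "h \<in> borel_measurable lebesgue" "S \<in> sets lebesgue"
    and "finite F" "a \<ge> 0" and avg: "\<And>j k. (j, k) \<in> F \<Longrightarrow> \<exists>x\<in>dyadic j k. avg_bound h a x"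
    and sc: "\<And>j k. (j, k) \<in> F \<Longrightarrow> p \<le> j"
    and cnt: "\<And>j i. card {k. (j, k) \<in> F \<and> (\<exists>x\<in>S. \<bar>2 powr real_of_int j * x - real_of_int k\<bar> \<le> real i + 1)} \<le> 4 * (i + 1)"
  shows "(\<Sum>I\<in>F. scale I * (\<integral>\<^sup>+ x\<in>S. (h x * apsi I x) \<partial>lebesgue))
    \<le> ennreal (16 * a * D * dlen p)"
proof -
  have "(\<Sum>I\<in>F. scale I * (\<integral>\<^sup>+ x\<in>S. (h x * apsi I x) \<partial>lebesgue)) =
    (\<Sum>j\<in>fst ` F. \<Sum>k\<in>{k. (j, k) \<in> F}.
      ennreal (2 powr - (j / 2)) * (\<integral>\<^sup>+ x\<in>S. (h x * ennreal (cmod (wavelet_dil \<psi> j k x))) \<partial>lebesgue))"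
    by (rule sum_fiberwise [OF assms(3), of "\<lambda>j k. ennreal (2 powr - (j / 2)) * (\<integral>\<^sup>+ x\<in>S. (h x * ennreal (cmod (wavelet_dil \<psi> j k x))) \<partial>lebesgue)"])
  also have "\<dots> \<le> (\<Sum>j\<in>fst ` F. ennreal (8 * a * D * dlen j))"
    by (intro sum_mono tail_sum_scale finite_fiber assms) (use avg cnt in auto)
  also have "\<dots> = ennreal (8 * a * D * (\<Sum>j\<in>fst ` F. dlen j))"
    using assms(4) D_nonneg by (subst sum_ennreal) (auto simp: sum_distrib_left)
  also have "\<dots> \<le> ennreal (8 * a * D * (2 * dlen p))"
    using assms(3,4) sc D_nonneg by (intro ennreal_leI mult_left_mono sum_dlen_le) auto
  finally show ?thesis by (simp add: mult_ac)
qed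

text \<open>Intervals that are not coarser than \<open>dyadic p q\<close> and lie outside it leak
  into it only near its endpoints, so that the count for neighbouring intervals applies at every
  scale.\<close>

lemma tail_sum_near:
  assumes "h \<in> borel_measurable lebesgue" "finite F" "a \<ge> 0"
    and "\<And>j k. (j, k) \<in> F \<Longrightarrow> \<exists>x\<in>dyadic j k. avg_bound h a x"
    and "\<And>j k. (j, k) \<in> F \<Longrightarrow> p \<le> j" "\<And>j k. (j, k) \<in> F \<Longrightarrow> dyadic j k \<inter> dyadic p q = {}"
  shows "(\<Sum>I\<in>F. scale I * (\<integral>\<^sup>+ x\<in>dyadic p q. (h x * apsi I x) \<partial>lebesgue))
    \<le> ennreal (16 * a * D * dlen p)"
proof (rule tail_sum)
  fix j i
  show "card {k. (j, k) \<in> F \<and> (\<exists>x\<in>dyadic p q. \<bar>2 powr real_of_int j * x - real_of_int k\<bar> \<le> real i + 1)} \<le> 4 * (i + 1)"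
  proof (cases "p \<le> j")
    case True
    then show ?thesis
      using card_near_dyadic [OF True finite_fiber [OF assms(2)], of j q i] assms(6) by simp
  next
    case False
    then have "{k. (j, k) \<in> F \<and> (\<exists>x\<in>dyadic p q. \<bar>2 powr real_of_int j * x - real_of_int k\<bar> \<le> real i + 1)} = {}"
      using assms(5) by auto
    then show ?thesis by (simp only: card.empty)
  qed
qed (use assms in auto)

text \<open>The opposite leak, from intervals inside to the outside. Containment itself forces
  \<open>p \<le> j\<close>, so no separate condition on the scales appears.\<close>

lemma tail_sum_complement:
  assumes "h \<in> borel_measurable lebesgue" "finite F" "a \<ge> 0"
    and "\<And>j k. (j, k) \<in> F \<Longrightarrow> \<exists>x\<in>dyadic j k. avg_bound h a x"
    and "\<And>j k. (j, k) \<in> F \<Longrightarrow> dyadic j k \<subseteq> dyadic p q"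
  shows "(\<Sum>I\<in>F. scale I * (\<integral>\<^sup>+ x\<in>- dyadic p q. (h x * apsi I x) \<partial>lebesgue))
    \<le> ennreal (16 * a * D * dlen p)"
proof (rule tail_sum)
  show *: "p \<le> j" if "(j, k) \<in> F" for j k
    using assms(5) [OF that] by (rule dyadic_subset_imp_le)
  fix j i
  show "card {k. (j, k) \<in> F \<and> (\<exists>x\<in>- dyadic p q. \<bar>2 powr real_of_int j * x - real_of_int k\<bar> \<le> real i + 1)} \<le> 4 * (i + 1)"
  proof (cases "p \<le> j")
    case True
    then show ?thesis
      using card_near_complement [OF True finite_fiber [OF assms(2)], of j q i] assms(5) by simp
  next
    case False
    then have "{k. (j, k) \<in> F \<and> (\<exists>x\<in>- dyadic p q. \<bar>2 powr real_of_int j * x - real_of_int k\<bar> \<le> real i + 1)} = {}"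
      using * by auto
    then show ?thesis by (simp only: card.empty)
  qed
qed (use assms in auto)

text \<open>The estimate for one scale with \<open>S = UNIV\<close> and a single index, where the
  count \<open>1\<close> is below the permitted \<open>4 * (i + 1)\<close>; multiplying by
  \<open>2 powr (j / 2)\<close> then removes the scale factor.\<close>

lemma nn_integral_psi_le:
  assumes "h \<in> borel_measurable lebesgue" "a \<ge> 0" "x \<in> dyadic j k" "avg_bound h a x"
  shows "(\<integral>\<^sup>+ x. h x * ennreal (cmod (wavelet_dil \<psi> j k x)) \<partial>lebesgue) \<le> ennreal (8 * a * D * 2 powr - (j / 2))"
proof -
  have "(\<Sum>k\<in>{k}. ennreal (2 powr - (j / 2)) * (\<integral>\<^sup>+ x\<in>UNIV. (h x * ennreal (cmod (wavelet_dil \<psi> j k x))) \<partial>lebesgue))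
    \<le> ennreal (8 * a * D * dlen j)"
  proof (rule tail_sum_scale)
    fix i
    have "card {k'\<in>{k}. \<exists>x\<in>UNIV. \<bar>2 powr real_of_int j * x - real_of_int k'\<bar> \<le> real i + 1} \<le> card {k}"
      by (intro card_mono) auto
    then show "card {k'\<in>{k}. \<exists>x\<in>UNIV. \<bar>2 powr real_of_int j * x - real_of_int k'\<bar> \<le> real i + 1} \<le> 4 * (i + 1)"
      by simp
  qed (use assms in auto)
  then have *: "ennreal (2 powr - (j / 2)) * (\<integral>\<^sup>+ x. h x * ennreal (cmod (wavelet_dil \<psi> j k x)) \<partial>lebesgue)
    \<le> ennreal (8 * a * D * dlen j)" by simp
  have "(\<integral>\<^sup>+ x. h x * ennreal (cmod (wavelet_dil \<psi> j k x)) \<partial>lebesgue) =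
    ennreal (2 powr - (j / 2) * 2 powr (j / 2)) * (\<integral>\<^sup>+ x. h x * ennreal (cmod (wavelet_dil \<psi> j k x)) \<partial>lebesgue)"
    by (simp only: dlen_half) simp
  also have "\<dots> = ennreal (2 powr (j / 2)) * (ennreal (2 powr - (j / 2)) * (\<integral>\<^sup>+ x. h x * ennreal (cmod (wavelet_dil \<psi> j k x)) \<partial>lebesgue))"
    by (simp add: ennreal_mult mult_ac)
  also have "\<dots> \<le> ennreal (2 powr (j / 2)) * ennreal (8 * a * D * dlen j)"
    by (intro mult_left_mono *) auto
  also have "\<dots> = ennreal (8 * a * D * (dlen j * 2 powr (j / 2)))"
    using assms D_nonneg by (simp add: ennreal_mult [symmetric] mult_ac)
  also have "dlen j * 2 powr (j / 2) = 2 powr - (j / 2)"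
    by (simp add: dlen_def powr_add [symmetric])
  finally show ?thesis .
qed

text \<open>In layer \<open>i\<close> a point belongs to at most \<open>3 * (i + 1)\<close> integer
  translates, and this linear growth is again summed by \<open>D\<close>.\<close>

lemma sum_majorant_le:
  assumes "finite K"
  shows "(\<Sum>k\<in>K. majorant c (t - real_of_int k)) \<le> ennreal (3 * D)"
proof -
  have "(\<Sum>k\<in>K. majorant c (t - real_of_int k)) =
    (\<Sum>i. ennreal (c i) * (\<Sum>k\<in>K. indicator {- (real i + 1)..real i + 1} (t - real_of_int k)))"
    unfolding majorant_def by (subst suminf_sum [symmetric]) (auto simp: sum_distrib_left)
  also have "\<dots> \<le> ennreal (3 * D)"
  proof (rule suminf_c_le)
    fix i
    have "(\<Sum>k\<in>K. indicator {- (real i + 1)..real i + 1} (t - real_of_int k) :: ennreal) =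
      (\<Sum>k\<in>{k\<in>K. \<bar>t - real_of_int k\<bar> \<le> real i + 1}. 1)"
      using assms by (subst sum.inter_filter) (auto intro!: sum.cong split: split_indicator)
    also have "\<dots> = ennreal (real (card {k\<in>K. \<bar>t - real_of_int k\<bar> \<le> real i + 1}))"
      by (simp add: ennreal_of_nat_eq_real_of_nat)
    also have "\<dots> \<le> ennreal (3 * (real i + 1)\<^sup>2)"
    proof (rule ennreal_leI)
      have "real (card {k\<in>K. \<bar>t - real_of_int k\<bar> \<le> real i + 1}) \<le> real (3 * (i + 1))"
        using card_int_interval_le [OF assms] by (simp only: of_nat_le_iff)
      also have "\<dots> \<le> 3 * (real i + 1)\<^sup>2" by (simp add: power2_eq_square algebra_simps)
      finally show "real (card {k\<in>K. \<bar>t - real_of_int k\<bar> \<le> real i + 1}) \<le> 3 * (real i + 1)\<^sup>2" .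
    qed
    finally show "(\<Sum>k\<in>K. indicator {- (real i + 1)..real i + 1} (t - real_of_int k)) \<le> ennreal (3 * (real i + 1)\<^sup>2)" .
  qed auto
  finally show ?thesis .
qed

text \<open>For \<open>j < p\<close> the rescaled points are at distance at most
  \<open>2 powr j * dlen p \<le> 1\<close>, so the Lipschitz bound applies and gains this very
  factor. The overlap bound for translates handles the sum over \<open>k\<close>, and the gain
  decays geometrically towards coarse scales.\<close>

lemma oscillation_sum:
  assumes "finite F" "\<And>j k. (j, k) \<in> F \<Longrightarrow> j < p" "x \<in> dyadic p q" "y \<in> dyadic p q"
  shows "(\<Sum>I\<in>F. scale I * ennreal (cmod (psi I x - psi I y))) \<le> ennreal (3 * D)"
proof -
  have "q * dlen p \<le> x" "x < q * dlen p + dlen p" "q * dlen p \<le> y" "y < q * dlen p + dlen p"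
    using assms(3,4) by (simp_all add: dyadic_iff distrib_right)
  then have xy: "\<bar>x - y\<bar> \<le> dlen p" by linarith
  have *: "ennreal (2 powr - (j / 2)) * ennreal (cmod (wavelet_dil \<psi> j k x - wavelet_dil \<psi> j k y))
    \<le> ennreal (2 powr j * dlen p) * majorant c (2 powr j * x - real_of_int k)" if "j < p" for j k
  proof -
    define u v where "u = 2 powr j * x - k" and "v = 2 powr j * y - k"
    have uv0: "u - v = 2 powr j * (x - y)" by (simp add: u_def v_def algebra_simps)
    have "\<bar>u - v\<bar> = 2 powr j * \<bar>x - y\<bar>" unfolding uv0 abs_mult by simp
    then have uv: "\<bar>u - v\<bar> \<le> 2 powr j * dlen p" using xy by simp
    also have "\<dots> = 2 powr real_of_int (j - p)" by (simp add: dlen_def powr_add [symmetric])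
    also have "\<dots> \<le> 2 powr 0" using that by (intro powr_mono) auto
    also have "\<dots> = 1" by simp
    finally have uv1: "\<bar>u - v\<bar> \<le> 1" .
    have "ennreal (2 powr - (j / 2)) * ennreal (cmod (wavelet_dil \<psi> j k x - wavelet_dil \<psi> j k y)) =
      ennreal (2 powr - (j / 2) * 2 powr (j / 2) * cmod (\<psi> u - \<psi> v))"
      unfolding wavelet_dil_def u_def v_def right_diff_distrib [symmetric] norm_mult
      by (simp add: ennreal_mult mult.assoc)
    also have "\<dots> = ennreal (cmod (\<psi> u - \<psi> v))" by (simp only: dlen_half) simp
    also have "\<dots> \<le> ennreal \<bar>u - v\<bar> * majorant c u" using uv1 by (rule psi_diff_le)
    also have "\<dots> \<le> ennreal (2 powr j * dlen p) * majorant c u"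
      using uv by (intro mult_right_mono ennreal_leI) auto
    finally show ?thesis by (simp add: u_def)
  qed
  have "(\<Sum>I\<in>F. scale I * ennreal (cmod (psi I x - psi I y))) \<le>
    (\<Sum>I\<in>F. ennreal (2 powr real_of_int (fst I) * dlen p) * majorant c (2 powr real_of_int (fst I) * x - real_of_int (snd I)))"
  proof (intro sum_mono *)
    fix I assume "I \<in> F"
    then show "fst I < p" using assms(2) [of "fst I" "snd I"] by simp
  qed
  also have "\<dots> = (\<Sum>j\<in>fst ` F. \<Sum>k\<in>{k. (j, k) \<in> F}. ennreal (2 powr j * dlen p) * majorant c (2 powr j * x - real_of_int k))"
    by (rule sum_fiberwise [OF assms(1), of "\<lambda>j k. ennreal (2 powr j * dlen p) * majorant c (2 powr j * x - real_of_int k)"])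
  also have "\<dots> \<le> (\<Sum>j\<in>fst ` F. ennreal (2 powr j * dlen p) * ennreal (3 * D))"
    unfolding sum_distrib_left [symmetric]
    by (intro sum_mono mult_left_mono sum_majorant_le finite_fiber assms(1)) auto
  also have "\<dots> = ennreal ((\<Sum>j\<in>fst ` F. 2 powr j) * dlen p * (3 * D))"
  proof -
    have "(\<Sum>j\<in>fst ` F. ennreal (2 powr j * dlen p) * ennreal (3 * D)) =
        (\<Sum>j\<in>fst ` F. ennreal (2 powr j * dlen p * (3 * D)))"
      by (intro sum.cong refl ennreal_mult [symmetric]) (use D_nonneg in auto)
    also have "\<dots> = ennreal (\<Sum>j\<in>fst ` F. 2 powr j * dlen p * (3 * D))"
      by (intro sum_ennreal) (use D_nonneg in auto)
    finally show ?thesis by (simp only: sum_distrib_right)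
  qed
  also have "\<dots> \<le> ennreal (1 * (3 * D))"
    using assms(1,2) D_nonneg by (intro ennreal_leI mult_right_mono sum_powr_le) auto
  finally show ?thesis by simp
qed

end

section \<open>Orthogonality and the truncated square function\<close>

lemma cnj_borel_measurable [measurable]: "cnj \<in> borel_measurable borel"
  by (intro borel_measurable_continuous_onI continuous_intros)

lemma integrable_mult_cnj_L2:
  assumes [measurable]: "f \<in> borel_measurable lebesgue" "g \<in> borel_measurable lebesgue"
    and "integrable lebesgue (\<lambda>x. (cmod (f x))\<^sup>2)" "integrable lebesgue (\<lambda>x. (cmod (g x))\<^sup>2)"
  shows "integrable lebesgue (\<lambda>x. f x * cnj (g x))"
proof (rule Bochner_Integration.integrable_bound)
  show "integrable lebesgue (\<lambda>x. (cmod (f x))\<^sup>2 + (cmod (g x))\<^sup>2)" using assms by simp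
  show "(\<lambda>x. f x * cnj (g x)) \<in> borel_measurable lebesgue"  by measurable
  have "cmod (f x) * cmod (g x) \<le> (cmod (f x))\<^sup>2 + (cmod (g x))\<^sup>2" for x
  proof -
    have "2 * cmod (f x) * cmod (g x) \<le> (cmod (f x))\<^sup>2 + (cmod (g x))\<^sup>2" by (rule sum_squares_bound)
    moreover have "0 \<le> cmod (f x) * cmod (g x)" by simp
    ultimately show ?thesis by linarith
  qed
  then show "AE x in lebesgue. norm (f x * cnj (g x)) \<le> norm ((cmod (f x))\<^sup>2 + (cmod (g x))\<^sup>2)"
    by (simp add: norm_mult)
qed

lemma stopping_family_nn_integral:
  assumes P: "stopping_family h M j k P" and [measurable]: "u \<in> borel_measurable lebesgue"
  shows "(\<Sum>I\<in>P. \<integral>\<^sup>+ x\<in>dyadic (fst I) (snd I). u x \<partial>lebesgue) = (\<integral>\<^sup>+ x\<in>dyadic j k. u x \<partial>lebesgue)"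
proof -
  have "(\<Sum>I\<in>P. \<integral>\<^sup>+ x\<in>dyadic (fst I) (snd I). u x \<partial>lebesgue) =
    (\<integral>\<^sup>+ x. (\<Sum>I\<in>P. u x * indicator (dyadic (fst I) (snd I)) x) \<partial>lebesgue)"
    by (subst nn_integral_sum) auto
  also have "\<dots> = (\<integral>\<^sup>+ x\<in>dyadic j k. u x \<partial>lebesgue)"
    using P by (simp add: stopping_family_def sum_distrib_left [symmetric])
  finally show ?thesis .
qed

lemma stopping_family_sum_dlen:
  assumes "stopping_family h M j k P"
  shows "(\<Sum>I\<in>P. ennreal (dlen (fst I))) = ennreal (dlen j)"
  using stopping_family_nn_integral [OF assms, of "\<lambda>_. 1"] by simp

lemma stopping_family_indicator:
  assumes "stopping_family h M j k P"
  shows "indicator (dyadic j k) x = (\<Sum>I\<in>P. indicator (dyadic (fst I) (snd I)) x :: real)"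
proof -
  have "ennreal (indicator (dyadic j k) x) = ennreal (\<Sum>I\<in>P. indicator (dyadic (fst I) (snd I)) x)"
    using assms by (subst sum_ennreal [symmetric]) (auto simp: stopping_family_def ennreal_indicator)
  then show ?thesis by (subst (asm) ennreal_inj) (auto intro!: sum_nonneg)
qed

text \<open>If \<open>dyadic j k\<close> met the stopped interval, it would be contained in it. The
  stopped interval would then contain \<open>x\<close> and have mean at most \<open>1\<close>,
  although it was selected for a larger mean; the other reason for selection, \<open>p = M\<close>,
  is excluded by \<open>p \<le> j < M\<close>. This is the mechanism that removes all diagonal
  terms.\<close>

lemma stopping_family_disjoint:
  assumes P: "stopping_family h M j0 k0 P" "(p, q) \<in> P"
    and x: "x \<in> dyadic j k" "avg_bound h 1 x" and "j < M" "p \<le> j"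
  shows "dyadic j k \<inter> dyadic p q = {}"
proof (rule ccontr)
  assume "dyadic j k \<inter> dyadic p q \<noteq> {}"
  then have "dyadic j k \<subseteq> dyadic p q" using dyadic_nested assms(6) by blast
  then have "(\<integral>\<^sup>+ y\<in>dyadic p q. h y \<partial>lebesgue) \<le> ennreal (1 * dlen p)"
    using x by (intro avg_bound_dyadic) auto
  moreover have "p = M \<or> ennreal (dlen p) < (\<integral>\<^sup>+ y\<in>dyadic p q. h y \<partial>lebesgue)"
    using P unfolding stopping_family_def by (metis fst_conv snd_conv)
  ultimately show False using assms(5,6) by (auto simp: not_less [symmetric])
qed

locale wavelet_system = wavelet_kernel +
  assumes orth: "L2_inner (wavelet_dil \<psi> j k) (wavelet_dil \<psi> j' k') = (if j = j' \<and> k = k' then 1 else 0)"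
begin

abbreviation coef :: "(real \<Rightarrow> complex) \<Rightarrow> int \<times> int \<Rightarrow> complex" where
  "coef f I \<equiv> L2_inner f (psi I)"

text \<open>Writing the truncated square function as a Euclidean norm makes Minkowski's inequality
  available, and for a finite index set it keeps the values real.\<close>

definition sqV :: "(int \<times> int) set \<Rightarrow> (real \<Rightarrow> complex) \<Rightarrow> real \<Rightarrow> real" where
  "sqV F f x = L2_set (\<lambda>I. cmod (coef f I) * cmod (psi I x)) F"

lemma sqV_nonneg [simp]: "0 \<le> sqV F f x"
  by (simp add: sqV_def)

lemma sqV_measurable [measurable]: "sqV F f \<in> borel_measurable lebesgue"
  unfolding sqV_def [abs_def] L2_set_def by measurable

lemma psi_L2: "integrable lebesgue (\<lambda>x. (cmod (psi I x))\<^sup>2)"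
proof -
  \<comment> \<open>The Bochner integral of a function that is not integrable is \<open>0\<close> by
    convention, whereas orthonormality says that this integral is \<open>1\<close>.\<close>
  have "integrable lebesgue (\<lambda>x. psi I x * cnj (psi I x))"
    using orth [of "fst I" "snd I" "fst I" "snd I"] not_integrable_integral_eq
    unfolding L2_inner_def by fastforce
  then have "integrable lebesgue (\<lambda>x. complex_of_real ((cmod (psi I x))\<^sup>2))"
    by (simp only: complex_norm_square [symmetric] of_real_power)
  then show ?thesis by (simp only: complex_of_real_integrable_eq)
qed

lemma integral_psi_sq: "(\<integral>\<^sup>+ x. ennreal ((cmod (psi I x))\<^sup>2) \<partial>lebesgue) = 1"
proof -
  have "complex_of_real (\<integral>x. (cmod (psi I x))\<^sup>2 \<partial>lebesgue) = (\<integral>x. psi I x * cnj (psi I x) \<partial>lebesgue)"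
    by (simp only: complex_norm_square [symmetric] of_real_power [symmetric] integral_complex_of_real)
  also have "\<dots> = 1" using orth [of "fst I" "snd I" "fst I" "snd I"] by (simp add: L2_inner_def)
  finally have "(\<integral>x. (cmod (psi I x))\<^sup>2 \<partial>lebesgue) = 1" by (simp only: of_real_eq_1_iff)
  then show ?thesis using psi_L2 [of I] by (subst nn_integral_eq_integral) auto
qed

lemma coef_integrable:
  assumes "integrable lebesgue f"
  shows "integrable lebesgue (\<lambda>x. f x * cnj (psi I x))"
proof (rule Bochner_Integration.integrable_bound)
  show "integrable lebesgue (\<lambda>x. (2 powr (fst I / 2) * D) * cmod (f x))" using assms by simp
  have [measurable]: "f \<in> borel_measurable lebesgue" using assms by simp
  show "(\<lambda>x. f x * cnj (psi I x)) \<in> borel_measurable lebesgue" by measurable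
  have "cmod (f x) * cmod (psi I x) \<le> (2 powr (fst I / 2) * D) * cmod (f x)" for x
    using mult_left_mono [OF psi_dil_bounded, of "cmod (f x)" "fst I" "snd I" x] by (simp add: mult_ac)
  then show "AE x in lebesgue. norm (f x * cnj (psi I x)) \<le> norm ((2 powr (fst I / 2) * D) * cmod (f x))"
    using D_nonneg by (auto simp: norm_mult)
qed

lemma coef_add: "integrable lebesgue f \<Longrightarrow> integrable lebesgue g \<Longrightarrow>
    coef (\<lambda>x. f x + g x) I = coef f I + coef g I"
  using coef_integrable [of f I] coef_integrable [of g I] by (simp add: L2_inner_def distrib_right)

lemma coef_sum: "(\<And>i. i \<in> A \<Longrightarrow> integrable lebesgue (f i)) \<Longrightarrow>
    coef (\<lambda>x. \<Sum>i\<in>A. f i x) I = (\<Sum>i\<in>A. coef (f i) I)"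
  using coef_integrable [of _ I] by (simp add: L2_inner_def sum_distrib_right)

lemma coef_cmult: "coef (\<lambda>x. a * f x) I = a * coef f I"
  by (simp add: L2_inner_def mult.assoc)

lemma coef_le:
  assumes [measurable]: "f \<in> borel_measurable lebesgue"
  shows "ennreal (cmod (coef f I)) \<le> (\<integral>\<^sup>+ x. ennreal (cmod (f x)) * apsi I x \<partial>lebesgue)"
proof (cases "integrable lebesgue (\<lambda>x. f x * cnj (psi I x))")
  case True
  then show ?thesis
    using integral_norm_bound_ennreal [OF True] by (simp add: L2_inner_def norm_mult ennreal_mult)
next
  case False
  \<comment> \<open>By the same convention the coefficient is \<open>0\<close> when the product is
    not integrable, so the bound is trivial.\<close>
  then show ?thesis by (simp add: L2_inner_def not_integrable_integral_eq)
qed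

text \<open>Expanding the squared distance from \<open>f\<close> to its partial sum
  \<open>s\<close>, which is nonnegative, leaves the squared norm of \<open>f\<close> minus the sum
  of the squared coefficients.\<close>

lemma bessel:
  assumes [measurable]: "f \<in> borel_measurable lebesgue" and f: "integrable lebesgue (\<lambda>x. (cmod (f x))\<^sup>2)"
    and F: "finite F"
  shows "(\<Sum>I\<in>F. (cmod (coef f I))\<^sup>2) \<le> (\<integral>x. (cmod (f x))\<^sup>2 \<partial>lebesgue)"
proof -
  define s where "s x = (\<Sum>I\<in>F. coef f I * psi I x)" for x
  have ff: "integrable lebesgue (\<lambda>x. f x * cnj (f x))" by (intro integrable_mult_cnj_L2 f) auto
  have fp: "integrable lebesgue (\<lambda>x. f x * cnj (psi I x))" for I by (intro integrable_mult_cnj_L2 f psi_L2) auto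
  have pf: "integrable lebesgue (\<lambda>x. psi I x * cnj (f x))" for I by (intro integrable_mult_cnj_L2 f psi_L2) auto
  have pp: "integrable lebesgue (\<lambda>x. psi I x * cnj (psi J x))" for I J by (intro integrable_mult_cnj_L2 psi_L2) auto
  have sw: "(\<integral>x. psi I x * cnj (f x) \<partial>lebesgue) = cnj (coef f I)" for I
  proof -
    have "cnj (coef f I) = (\<integral>x. cnj (f x * cnj (psi I x)) \<partial>lebesgue)"
      unfolding L2_inner_def by (rule Bochner_Integration.integral_cnj [symmetric])
    then show ?thesis by (simp add: mult.commute)
  qed
  have pw: "(f x - s x) * cnj (f x - s x) = f x * cnj (f x) - (\<Sum>I\<in>F. cnj (coef f I) * (f x * cnj (psi I x)))
     - (\<Sum>I\<in>F. coef f I * (psi I x * cnj (f x))) + (\<Sum>I\<in>F. \<Sum>J\<in>F. coef f I * cnj (coef f J) * (psi I x * cnj (psi J x)))" for x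
  proof -
    have "s x * cnj (s x) = (\<Sum>I\<in>F. \<Sum>J\<in>F. coef f I * cnj (coef f J) * (psi I x * cnj (psi J x)))"
      unfolding s_def cnj_sum sum_product by (simp add: mult_ac)
    moreover have "f x * cnj (s x) = (\<Sum>I\<in>F. cnj (coef f I) * (f x * cnj (psi I x)))"
      unfolding s_def cnj_sum sum_distrib_left by (simp add: mult_ac)
    moreover have "s x * cnj (f x) = (\<Sum>I\<in>F. coef f I * (psi I x * cnj (f x)))"
      unfolding s_def sum_distrib_right by (simp add: mult_ac)
    moreover have "(f x - s x) * cnj (f x - s x) = f x * cnj (f x) - f x * cnj (s x) - s x * cnj (f x) + s x * cnj (s x)"
      by (simp add: algebra_simps)
    ultimately show ?thesis by simp
  qed
  have i1: "integrable lebesgue (\<lambda>x. \<Sum>I\<in>F. cnj (coef f I) * (f x * cnj (psi I x)))"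
    by (intro Bochner_Integration.integrable_sum Bochner_Integration.integrable_mult_right fp)
  have i2: "integrable lebesgue (\<lambda>x. \<Sum>I\<in>F. coef f I * (psi I x * cnj (f x)))"
    by (intro Bochner_Integration.integrable_sum Bochner_Integration.integrable_mult_right pf)
  have i3: "integrable lebesgue (\<lambda>x. \<Sum>I\<in>F. \<Sum>J\<in>F. coef f I * cnj (coef f J) * (psi I x * cnj (psi J x)))"
    by (intro Bochner_Integration.integrable_sum Bochner_Integration.integrable_mult_right pp)
  have o: "(\<integral>x. psi I x * cnj (psi J x) \<partial>lebesgue) = (if I = J then 1 else 0)" for I J
    using orth [of "fst I" "snd I" "fst J" "snd J"] by (simp add: L2_inner_def prod_eq_iff)
  have e1: "(\<integral>x. (\<Sum>I\<in>F. cnj (coef f I) * (f x * cnj (psi I x))) \<partial>lebesgue) = (\<Sum>I\<in>F. cnj (coef f I) * coef f I)"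
  proof (subst Bochner_Integration.integral_sum)
    show "(\<Sum>I\<in>F. \<integral>x. cnj (coef f I) * (f x * cnj (psi I x)) \<partial>lebesgue) = (\<Sum>I\<in>F. cnj (coef f I) * coef f I)"
      unfolding L2_inner_def by (intro sum.cong refl Bochner_Integration.integral_mult_right fp)
  qed (intro Bochner_Integration.integrable_mult_right fp)
  have e2: "(\<integral>x. (\<Sum>I\<in>F. coef f I * (psi I x * cnj (f x))) \<partial>lebesgue) = (\<Sum>I\<in>F. coef f I * cnj (coef f I))"
  proof (subst Bochner_Integration.integral_sum)
    show "(\<Sum>I\<in>F. \<integral>x. coef f I * (psi I x * cnj (f x)) \<partial>lebesgue) = (\<Sum>I\<in>F. coef f I * cnj (coef f I))"
      unfolding sw [symmetric] by (intro sum.cong refl Bochner_Integration.integral_mult_right pf)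
  qed (intro Bochner_Integration.integrable_mult_right pf)
  have e3: "(\<integral>x. (\<Sum>I\<in>F. \<Sum>J\<in>F. coef f I * cnj (coef f J) * (psi I x * cnj (psi J x))) \<partial>lebesgue)
      = (\<Sum>I\<in>F. cnj (coef f I) * coef f I)"
  proof -
    have "(\<integral>x. (\<Sum>I\<in>F. \<Sum>J\<in>F. coef f I * cnj (coef f J) * (psi I x * cnj (psi J x))) \<partial>lebesgue)
      = (\<Sum>I\<in>F. \<Sum>J\<in>F. coef f I * cnj (coef f J) * (\<integral>x. psi I x * cnj (psi J x) \<partial>lebesgue))"
      by (subst Bochner_Integration.integral_sum, intro Bochner_Integration.integrable_sum Bochner_Integration.integrable_mult_right pp,
          intro sum.cong refl, subst Bochner_Integration.integral_sum, intro Bochner_Integration.integrable_mult_right pp,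
          intro sum.cong refl Bochner_Integration.integral_mult_right pp)
    also have "\<dots> = (\<Sum>I\<in>F. \<Sum>J\<in>F. if I = J then coef f I * cnj (coef f J) else 0)"
      unfolding o by (intro sum.cong refl) auto
    also have "\<dots> = (\<Sum>I\<in>F. cnj (coef f I) * coef f I)"
      using F by (intro sum.cong refl) (simp add: mult.commute)
    finally show ?thesis .
  qed
  have "(\<integral>x. (f x - s x) * cnj (f x - s x) \<partial>lebesgue) =
      (\<integral>x. f x * cnj (f x) \<partial>lebesgue) - (\<Sum>I\<in>F. cnj (coef f I) * coef f I)"
    unfolding pw using ff i1 i2 i3
    by (simp only: Bochner_Integration.integral_add Bochner_Integration.integral_diff
        Bochner_Integration.integrable_diff e1 e2 e3) (simp add: mult.commute)
  moreover have "u * cnj u = complex_of_real ((cmod u)\<^sup>2)" "cnj u * u = complex_of_real ((cmod u)\<^sup>2)" for u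
    using complex_norm_square [of u] by (simp_all add: mult.commute)
  ultimately have "complex_of_real (\<integral>x. (cmod (f x - s x))\<^sup>2 \<partial>lebesgue) =
      complex_of_real ((\<integral>x. (cmod (f x))\<^sup>2 \<partial>lebesgue) - (\<Sum>I\<in>F. (cmod (coef f I))\<^sup>2))"
    by (simp only: integral_complex_of_real of_real_diff of_real_sum)
  then have "(\<integral>x. (cmod (f x - s x))\<^sup>2 \<partial>lebesgue) =
      (\<integral>x. (cmod (f x))\<^sup>2 \<partial>lebesgue) - (\<Sum>I\<in>F. (cmod (coef f I))\<^sup>2)"
    by (simp only: of_real_eq_iff)
  moreover have "0 \<le> (\<integral>x. (cmod (f x - s x))\<^sup>2 \<partial>lebesgue)" by simp
  ultimately show ?thesis by linarith
qed

lemma sqV_square: "(sqV F f x)\<^sup>2 = (\<Sum>I\<in>F. (cmod (coef f I))\<^sup>2 * (cmod (psi I x))\<^sup>2)"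
  unfolding sqV_def L2_set_def by (simp add: sum_nonneg power_mult_distrib)

text \<open>Each \<open>psi I\<close> has norm one, so the integral of the square is the sum of the
  squared coefficients, and Bessel's inequality applies. It is through this bound alone that
  orthogonality of different wavelets acts on the estimates.\<close>

lemma sqV_L2_bound:
  assumes "f \<in> borel_measurable lebesgue" "integrable lebesgue (\<lambda>x. (cmod (f x))\<^sup>2)" "finite F"
  shows "(\<integral>\<^sup>+ x. ennreal ((sqV F f x)\<^sup>2) \<partial>lebesgue) \<le> (\<integral>\<^sup>+ x. ennreal ((cmod (f x))\<^sup>2) \<partial>lebesgue)"
proof -
  have "(\<integral>\<^sup>+ x. ennreal ((sqV F f x)\<^sup>2) \<partial>lebesgue) =
    (\<integral>\<^sup>+ x. (\<Sum>I\<in>F. ennreal ((cmod (coef f I))\<^sup>2) * ennreal ((cmod (psi I x))\<^sup>2)) \<partial>lebesgue)"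
    unfolding sqV_square by (intro nn_integral_cong) (simp add: ennreal_mult [symmetric] sum_ennreal)
  also have "\<dots> = (\<Sum>I\<in>F. ennreal ((cmod (coef f I))\<^sup>2) * (\<integral>\<^sup>+ x. ennreal ((cmod (psi I x))\<^sup>2) \<partial>lebesgue))"
    by (subst nn_integral_sum) (auto simp: nn_integral_cmult)
  also have "\<dots> = ennreal (\<Sum>I\<in>F. (cmod (coef f I))\<^sup>2)" by (simp add: integral_psi_sq sum_ennreal)
  also have "\<dots> \<le> ennreal (\<integral>x. (cmod (f x))\<^sup>2 \<partial>lebesgue)" by (intro ennreal_leI bessel assms)
  also have "\<dots> = (\<integral>\<^sup>+ x. ennreal ((cmod (f x))\<^sup>2) \<partial>lebesgue)"
    using assms(2) by (intro nn_integral_eq_integral [symmetric]) auto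
  finally show ?thesis .
qed

lemma sqV_le_sum: "sqV F f x \<le> (\<Sum>I\<in>F. cmod (coef f I) * cmod (psi I x))"
  unfolding sqV_def by (intro L2_set_le_sum) auto

text \<open>Minkowski's inequality for the Euclidean norm. The premise compares moduli of
  coefficients, so that questions of integrability are settled where the decomposition of the
  function is made.\<close>

lemma sqV_triangle:
  assumes "\<And>I. I \<in> F \<Longrightarrow> cmod (coef f I) \<le> cmod (coef g I) + cmod (coef h I)"
  shows "sqV F f x \<le> sqV F g x + sqV F h x"
proof -
  have "sqV F f x \<le> L2_set (\<lambda>I. cmod (coef g I) * cmod (psi I x) + cmod (coef h I) * cmod (psi I x)) F"
    unfolding sqV_def by (intro L2_set_mono) (auto simp flip: distrib_right intro!: mult_right_mono assms)
  also have "\<dots> \<le> sqV F g x + sqV F h x" unfolding sqV_def by (rule L2_set_triangle_ineq)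
  finally show ?thesis .
qed

lemma sqV_mono: "finite F \<Longrightarrow> G \<subseteq> F \<Longrightarrow> sqV G f x \<le> sqV F f x"
  unfolding sqV_def L2_set_def by (intro real_sqrt_le_mono sum_mono2) auto

lemma sqV_Un:
  assumes "finite F" "finite G"
  shows "sqV (F \<union> G) f x \<le> sqV F f x + sqV G f x"
proof -
  have "(sqV (F \<union> G) f x)\<^sup>2 \<le> (sqV F f x)\<^sup>2 + (sqV G f x)\<^sup>2"
    unfolding sqV_square using sum.union_inter [OF assms, of "\<lambda>I. (cmod (coef f I))\<^sup>2 * (cmod (psi I x))\<^sup>2"]
    by (smt (verit) sum_nonneg mult_nonneg_nonneg zero_le_power2)
  also have "\<dots> \<le> (sqV F f x + sqV G f x)\<^sup>2"
    by (simp add: power2_sum)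
  finally show ?thesis by (rule power2_le_imp_le) simp
qed

text \<open>Replacing a Euclidean sum of pieces by a plain sum is affordable where it is used: the
  pieces belong to disjoint maximal intervals, whose lengths add up, or to different levels, which
  are summed geometrically.\<close>

lemma sqV_UN:
  assumes "finite A" "\<And>a. a \<in> A \<Longrightarrow> finite (G a)"
  shows "sqV (\<Union>a\<in>A. G a) f x \<le> (\<Sum>a\<in>A. sqV (G a) f x)"
  using assms
proof (induction A rule: finite_induct)
  case empty
  then show ?case by (simp add: sqV_def)
next
  case (insert a A)
  have "sqV (\<Union>b\<in>insert a A. G b) f x \<le> sqV (G a) f x + sqV (\<Union>b\<in>A. G b) f x"
    using insert by (simp, intro sqV_Un) auto
  then show ?case using insert by force
qed

text \<open>The Euclidean norm is given up for the sum of the absolute values. This loss is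
  tolerable where the terms are absolutely summable, as for the tails and the mean-zero
  parts.\<close>

lemma nn_integral_sqV_le:
  assumes [measurable]: "g \<in> borel_measurable lebesgue"
  shows "(\<integral>\<^sup>+ x. ennreal (sqV F f x) * g x \<partial>lebesgue) \<le>
    (\<Sum>I\<in>F. ennreal (cmod (coef f I)) * (\<integral>\<^sup>+ x. g x * apsi I x \<partial>lebesgue))"
proof -
  have "(\<integral>\<^sup>+ x. ennreal (sqV F f x) * g x \<partial>lebesgue) \<le>
    (\<integral>\<^sup>+ x. (\<Sum>I\<in>F. ennreal (cmod (coef f I)) * (g x * apsi I x)) \<partial>lebesgue)"
  proof (rule nn_integral_mono)
    fix x
    have "ennreal (sqV F f x) * g x \<le> ennreal (\<Sum>I\<in>F. cmod (coef f I) * cmod (psi I x)) * g x"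
      by (intro mult_right_mono ennreal_leI sqV_le_sum) auto
    also have "\<dots> = (\<Sum>I\<in>F. ennreal (cmod (coef f I)) * (g x * apsi I x))"
      by (subst sum_ennreal [symmetric]) (auto simp: sum_distrib_left ennreal_mult mult_ac)
    finally show "ennreal (sqV F f x) * g x \<le> (\<Sum>I\<in>F. ennreal (cmod (coef f I)) * (g x * apsi I x))" .
  qed
  also have "\<dots> = (\<Sum>I\<in>F. ennreal (cmod (coef f I)) * (\<integral>\<^sup>+ x. g x * apsi I x \<partial>lebesgue))"
    by (subst nn_integral_sum) (auto simp: nn_integral_cmult)
  finally show ?thesis .
qed

end

section \<open>Mean-zero parts of the Calderon-Zygmund decomposition\<close>

definition dmean :: "(real \<Rightarrow> complex) \<Rightarrow> int \<times> int \<Rightarrow> complex" where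
  "dmean f I = (\<integral>x. indicator (dyadic (fst I) (snd I)) x *\<^sub>R f x \<partial>lebesgue) /\<^sub>R dlen (fst I)"

definition dbad :: "(real \<Rightarrow> complex) \<Rightarrow> int \<times> int \<Rightarrow> real \<Rightarrow> complex" where
  "dbad f I x = indicator (dyadic (fst I) (snd I)) x *\<^sub>R (f x - dmean f I)"

lemma measure_dyadic [simp]: "measure lebesgue (dyadic j k) = dlen j"
  by (simp add: measure_def)

lemma integrable_indicator_dyadic [simp]: "integrable lebesgue (\<lambda>x. indicator (dyadic j k) x *\<^sub>R (m :: complex))"
  by (intro integrable_scaleR_left integrable_real_indicator) auto

lemma integrable_restrict:
  "integrable lebesgue f \<Longrightarrow> S \<in> sets lebesgue \<Longrightarrow> integrable lebesgue (\<lambda>x. indicator S x *\<^sub>R (f x :: complex))"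
  by (rule integrable_mult_indicator)

lemma integrable_dbad: "integrable lebesgue f \<Longrightarrow> integrable lebesgue (dbad f I)"
  unfolding dbad_def scaleR_diff_right
  by (intro Bochner_Integration.integrable_diff integrable_restrict integrable_indicator_dyadic) auto

lemma integral_dbad:
  assumes "integrable lebesgue f" shows "(\<integral>x. dbad f I x \<partial>lebesgue) = 0"
proof -
  have "(\<integral>x. dbad f I x \<partial>lebesgue) = (\<integral>x. indicator (dyadic (fst I) (snd I)) x *\<^sub>R f x \<partial>lebesgue) -
     (\<integral>x. indicator (dyadic (fst I) (snd I)) x *\<^sub>R dmean f I \<partial>lebesgue)"
    unfolding dbad_def scaleR_diff_right
    by (intro Bochner_Integration.integral_diff integrable_restrict assms integrable_indicator_dyadic) auto
  also have "(\<integral>x. indicator (dyadic (fst I) (snd I)) x *\<^sub>R dmean f I \<partial>lebesgue) = dlen (fst I) *\<^sub>R dmean f I"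
    by (subst integral_scaleR_left) auto
  also have "\<dots> = (\<integral>x. indicator (dyadic (fst I) (snd I)) x *\<^sub>R f x \<partial>lebesgue)"
    using dlen_pos [of "fst I"] by (simp add: dmean_def del: dlen_pos)
  finally show ?thesis by simp
qed

lemma cmod_dmean_le:
  assumes "integrable lebesgue f"
    "(\<integral>\<^sup>+ x\<in>dyadic (fst I) (snd I). ennreal (cmod (f x)) \<partial>lebesgue) \<le> ennreal (a * dlen (fst I))" "a \<ge> 0"
  shows "cmod (dmean f I) \<le> a"
proof -
  let ?S = "\<integral>x. indicator (dyadic (fst I) (snd I)) x *\<^sub>R f x \<partial>lebesgue"
  have "ennreal (cmod ?S) \<le> (\<integral>\<^sup>+ x. ennreal (norm (indicator (dyadic (fst I) (snd I)) x *\<^sub>R f x)) \<partial>lebesgue)"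
    by (intro integral_norm_bound_ennreal integrable_restrict assms) auto
  also have "\<dots> = (\<integral>\<^sup>+ x\<in>dyadic (fst I) (snd I). ennreal (cmod (f x)) \<partial>lebesgue)"
    by (intro nn_integral_cong) (auto split: split_indicator)
  also have "\<dots> \<le> ennreal (a * dlen (fst I))" by (rule assms)
  finally have "cmod ?S \<le> a * dlen (fst I)" using assms(3) by (simp add: ennreal_le_iff)
  then show ?thesis by (simp add: dmean_def field_simps)
qed

lemma cmod_dbad_le:
  "ennreal (cmod (dbad f I x)) \<le> (ennreal (cmod (f x)) + ennreal (cmod (dmean f I))) * indicator (dyadic (fst I) (snd I)) x"
  by (auto simp: dbad_def ennreal_plus [symmetric] simp del: ennreal_plus split: split_indicator intro: ennreal_leI norm_triangle_ineq4)

context wavelet_system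
begin

text \<open>Size alone suffices against intervals that are not coarser and are disjoint from that of
  \<open>P\<close>: there \<open>dbad f P\<close> is bounded by \<open>cmod (f x) + 2\<close>. Both
  summands have controlled averages at a point of each interval of \<open>F\<close>, by
  \<open>1\<close> and by \<open>2\<close>, which gives \<open>16 + 32 = 48\<close>.\<close>

lemma coef_dbad_near:
  assumes f: "integrable lebesgue f" and F: "finite F"
    and mean: "(\<integral>\<^sup>+ x\<in>dyadic (fst P) (snd P). ennreal (cmod (f x)) \<partial>lebesgue) \<le> ennreal (2 * dlen (fst P))"
    and avg: "\<And>j k. (j, k) \<in> F \<Longrightarrow> \<exists>x\<in>dyadic j k. avg_bound (\<lambda>x. ennreal (cmod (f x))) 1 x"
    and sc: "\<And>j k. (j, k) \<in> F \<Longrightarrow> fst P \<le> j"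
    and dis: "\<And>j k. (j, k) \<in> F \<Longrightarrow> dyadic j k \<inter> dyadic (fst P) (snd P) = {}"
  shows "(\<Sum>I\<in>F. scale I * ennreal (cmod (coef (dbad f P) I)))
    \<le> ennreal (48 * D * dlen (fst P))"
proof -
  have [measurable]: "f \<in> borel_measurable lebesgue" "dbad f P \<in> borel_measurable lebesgue"
    using f integrable_dbad [OF f] by (auto simp: integrable_iff_bounded)
  let ?S = "dyadic (fst P) (snd P)"
  have *: "ennreal (cmod (coef (dbad f P) I)) \<le> (\<integral>\<^sup>+ x\<in>?S. (ennreal (cmod (f x)) * apsi I x) \<partial>lebesgue) +
     (\<integral>\<^sup>+ x\<in>?S. (ennreal 2 * apsi I x) \<partial>lebesgue)" for I
  proof -
    have "ennreal (cmod (coef (dbad f P) I)) \<le> (\<integral>\<^sup>+ x. ennreal (cmod (dbad f P x)) * apsi I x \<partial>lebesgue)"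
      by (rule coef_le) auto
    also have "\<dots> \<le> (\<integral>\<^sup>+ x. (ennreal (cmod (f x)) * apsi I x * indicator ?S x) +
       (ennreal 2 * apsi I x * indicator ?S x) \<partial>lebesgue)"
    proof (rule nn_integral_mono)
      fix x
      have "ennreal (cmod (dbad f P x)) \<le> (ennreal (cmod (f x)) + ennreal (cmod (dmean f P))) * indicator ?S x"
        by (rule cmod_dbad_le)
      also have "\<dots> \<le> (ennreal (cmod (f x)) + ennreal 2) * indicator ?S x"
        using cmod_dmean_le [OF f mean] by (intro mult_right_mono add_left_mono ennreal_leI) auto
      finally have "ennreal (cmod (dbad f P x)) * apsi I x \<le>
          (ennreal (cmod (f x)) + ennreal 2) * indicator ?S x * apsi I x"
        by (rule mult_right_mono) simp
      then show "ennreal (cmod (dbad f P x)) * apsi I x \<le>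
         (ennreal (cmod (f x)) * apsi I x * indicator ?S x) +
         (ennreal 2 * apsi I x * indicator ?S x)"
        by (simp add: distrib_left distrib_right mult_ac)
    qed
    also have "\<dots> = (\<integral>\<^sup>+ x\<in>?S. (ennreal (cmod (f x)) * apsi I x) \<partial>lebesgue) +
     (\<integral>\<^sup>+ x\<in>?S. (ennreal 2 * apsi I x) \<partial>lebesgue)"
      by (rule nn_integral_add) measurable
    finally show ?thesis .
  qed
  have "(\<Sum>I\<in>F. scale I * ennreal (cmod (coef (dbad f P) I))) \<le>
    (\<Sum>I\<in>F. scale I * (\<integral>\<^sup>+ x\<in>?S. (ennreal (cmod (f x)) * apsi I x) \<partial>lebesgue)) +
    (\<Sum>I\<in>F. scale I * (\<integral>\<^sup>+ x\<in>?S. (ennreal 2 * apsi I x) \<partial>lebesgue))"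
    unfolding sum.distrib [symmetric] distrib_left [symmetric] by (intro sum_mono mult_left_mono *) auto
  also have "\<dots> \<le> ennreal (16 * 1 * D * dlen (fst P)) + ennreal (16 * 2 * D * dlen (fst P))"
  proof (rule add_mono)
    show "(\<Sum>I\<in>F. scale I * (\<integral>\<^sup>+ x\<in>?S. (ennreal (cmod (f x)) * apsi I x) \<partial>lebesgue))
      \<le> ennreal (16 * 1 * D * dlen (fst P))"
      using avg sc dis by (intro tail_sum_near [where h = "\<lambda>x. ennreal (cmod (f x))"] F) auto
    show "(\<Sum>I\<in>F. scale I * (\<integral>\<^sup>+ x\<in>?S. (ennreal 2 * apsi I x) \<partial>lebesgue))
      \<le> ennreal (16 * 2 * D * dlen (fst P))"
      using sc dis dyadic_nonempty by (intro tail_sum_near [where h = "\<lambda>x. ennreal 2"] F bexI avg_bound_const) auto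
  qed
  also have "\<dots> = ennreal (48 * D * dlen (fst P))"
    using D_nonneg by (subst ennreal_plus [symmetric]) (auto simp: algebra_simps)
  finally show ?thesis .
qed

lemma nn_integral_dbad_le:
  assumes f: "integrable lebesgue f"
    and mean: "(\<integral>\<^sup>+ x\<in>dyadic (fst P) (snd P). ennreal (cmod (f x)) \<partial>lebesgue) \<le> ennreal (2 * dlen (fst P))"
  shows "(\<integral>\<^sup>+ x. ennreal (cmod (dbad f P x)) \<partial>lebesgue) \<le> ennreal (4 * dlen (fst P))"
proof -
  have [measurable]: "f \<in> borel_measurable lebesgue" using f by simp
  let ?S = "dyadic (fst P) (snd P)"
  have "(\<integral>\<^sup>+ x. ennreal (cmod (dbad f P x)) \<partial>lebesgue) \<le>
    (\<integral>\<^sup>+ x. ennreal (cmod (f x)) * indicator ?S x + ennreal (cmod (dmean f P)) * indicator ?S x \<partial>lebesgue)"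
    using cmod_dbad_le [of f P] by (intro nn_integral_mono) (simp add: distrib_right)
  also have "\<dots> = (\<integral>\<^sup>+ x\<in>?S. ennreal (cmod (f x)) \<partial>lebesgue) + ennreal (cmod (dmean f P)) * ennreal (dlen (fst P))"
    by (subst nn_integral_add) (auto simp: nn_integral_cmult_indicator)
  also have "\<dots> \<le> ennreal (2 * dlen (fst P)) + ennreal 2 * ennreal (dlen (fst P))"
    using cmod_dmean_le [OF f mean] by (intro add_mono mean mult_right_mono ennreal_leI) auto
  also have "\<dots> = ennreal (4 * dlen (fst P))"
    by (subst ennreal_mult [symmetric], simp, simp, subst ennreal_plus [symmetric]) auto
  finally show ?thesis .
qed

text \<open>The vanishing integral of \<open>dbad f P\<close> allows \<open>psi I\<close> to be
  replaced by its increment from a fixed point \<open>y\<close> of the interval. The oscillation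
  bound \<open>3 * D\<close> times the integral of the modulus, at most
  \<open>4 * dlen (fst P)\<close>, gives the constant \<open>12\<close>.\<close>

lemma coef_dbad_far:
  assumes f: "integrable lebesgue f" and F: "finite F"
    and mean: "(\<integral>\<^sup>+ x\<in>dyadic (fst P) (snd P). ennreal (cmod (f x)) \<partial>lebesgue) \<le> ennreal (2 * dlen (fst P))"
    and sc: "\<And>j k. (j, k) \<in> F \<Longrightarrow> j < fst P"
  shows "(\<Sum>I\<in>F. scale I * ennreal (cmod (coef (dbad f P) I)))
    \<le> ennreal (12 * D * dlen (fst P))"
proof -
  define b where "b = dbad f P"
  have b: "integrable lebesgue b" unfolding b_def by (rule integrable_dbad [OF f])
  then have [measurable]: "b \<in> borel_measurable lebesgue" by simp
  obtain y where y: "y \<in> dyadic (fst P) (snd P)" using dyadic_nonempty by blast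
  have *: "ennreal (cmod (coef b I)) \<le> (\<integral>\<^sup>+ x. ennreal (cmod (b x)) * ennreal (cmod (psi I x - psi I y)) \<partial>lebesgue)" for I
  proof -
    have i: "integrable lebesgue (\<lambda>x. b x * cnj (psi I x))" by (rule coef_integrable [OF b])
    have "(\<integral>x. b x * cnj (psi I x - psi I y) \<partial>lebesgue) = (\<integral>x. b x * cnj (psi I x) - b x * cnj (psi I y) \<partial>lebesgue)"
      by (simp add: right_diff_distrib)
    also have "\<dots> = coef b I - (\<integral>x. b x * cnj (psi I y) \<partial>lebesgue)"
      using i b unfolding L2_inner_def by (intro Bochner_Integration.integral_diff) auto
    also have "(\<integral>x. b x * cnj (psi I y) \<partial>lebesgue) = 0"
      using integral_dbad [OF f, of P] by (simp add: b_def)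
    finally have e: "coef b I = (\<integral>x. b x * cnj (psi I x - psi I y) \<partial>lebesgue)" by simp
    have "integrable lebesgue (\<lambda>x. b x * cnj (psi I x) - b x * cnj (psi I y))"
      using i b by (intro Bochner_Integration.integrable_diff) auto
    then have "integrable lebesgue (\<lambda>x. b x * cnj (psi I x - psi I y))" by (simp add: right_diff_distrib)
    from integral_norm_bound_ennreal [OF this] show ?thesis
      unfolding e norm_mult complex_mod_cnj by (simp only: ennreal_mult norm_ge_zero)
  qed
  have "(\<Sum>I\<in>F. scale I * ennreal (cmod (coef b I))) \<le>
    (\<Sum>I\<in>F. scale I * (\<integral>\<^sup>+ x. ennreal (cmod (b x)) * ennreal (cmod (psi I x - psi I y)) \<partial>lebesgue))"
    by (intro sum_mono mult_left_mono *) auto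
  also have "\<dots> = (\<Sum>I\<in>F. \<integral>\<^sup>+ x. scale I * (ennreal (cmod (b x)) * ennreal (cmod (psi I x - psi I y))) \<partial>lebesgue)"
    by (intro sum.cong refl nn_integral_cmult [symmetric]) measurable
  also have "\<dots> = (\<integral>\<^sup>+ x. (\<Sum>I\<in>F. scale I * (ennreal (cmod (b x)) * ennreal (cmod (psi I x - psi I y)))) \<partial>lebesgue)"
    by (intro nn_integral_sum [symmetric]) measurable
  also have "\<dots> \<le> (\<integral>\<^sup>+ x. ennreal (3 * D) * ennreal (cmod (b x)) \<partial>lebesgue)"
  proof (rule nn_integral_mono)
    fix x
    show "(\<Sum>I\<in>F. scale I * (ennreal (cmod (b x)) * ennreal (cmod (psi I x - psi I y)))) \<le>
       ennreal (3 * D) * ennreal (cmod (b x))"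
    proof (cases "x \<in> dyadic (fst P) (snd P)")
      case True
      have "(\<Sum>I\<in>F. scale I * (ennreal (cmod (b x)) * ennreal (cmod (psi I x - psi I y)))) =
        ennreal (cmod (b x)) * (\<Sum>I\<in>F. scale I * ennreal (cmod (psi I x - psi I y)))"
        by (simp add: sum_distrib_left mult.left_commute)
      also have "\<dots> \<le> ennreal (cmod (b x)) * ennreal (3 * D)"
        by (intro mult_left_mono oscillation_sum [OF F sc True y]) auto
      finally show ?thesis by (simp add: mult.commute)
    next
      case False
      then show ?thesis by (simp add: b_def dbad_def)
    qed
  qed
  also have "\<dots> = ennreal (3 * D) * (\<integral>\<^sup>+ x. ennreal (cmod (b x)) \<partial>lebesgue)"
    by (rule nn_integral_cmult) measurable
  also have "\<dots> \<le> ennreal (3 * D) * ennreal (4 * dlen (fst P))"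
    unfolding b_def by (intro mult_left_mono nn_integral_dbad_le f mean) auto
  also have "\<dots> = ennreal (12 * D * dlen (fst P))"
    using D_nonneg by (simp add: ennreal_mult [symmetric] mult_ac)
  finally show ?thesis unfolding b_def .
qed

text \<open>Coarser intervals are treated by cancellation and the others by separation. Disjointness
  is demanded only of the latter, since a coarser interval may well contain that of
  \<open>P\<close>. The constant is \<open>12 + 48\<close>.\<close>

lemma coef_dbad:
  assumes f: "integrable lebesgue f" and F: "finite F"
    and mean: "(\<integral>\<^sup>+ x\<in>dyadic (fst P) (snd P). ennreal (cmod (f x)) \<partial>lebesgue) \<le> ennreal (2 * dlen (fst P))"
    and avg: "\<And>j k. (j, k) \<in> F \<Longrightarrow> \<exists>x\<in>dyadic j k. avg_bound (\<lambda>x. ennreal (cmod (f x))) 1 x"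
    and dis: "\<And>j k. (j, k) \<in> F \<Longrightarrow> fst P \<le> j \<Longrightarrow> dyadic j k \<inter> dyadic (fst P) (snd P) = {}"
  shows "(\<Sum>I\<in>F. scale I * ennreal (cmod (coef (dbad f P) I)))
    \<le> ennreal (60 * D * dlen (fst P))"
proof -
  let ?s = "\<lambda>I. scale I * ennreal (cmod (coef (dbad f P) I))"
  define F1 F2 where "F1 = {I\<in>F. fst I < fst P}" and "F2 = {I\<in>F. fst P \<le> fst I}"
  have "(\<Sum>I\<in>F. ?s I) = (\<Sum>I\<in>F1. ?s I) + (\<Sum>I\<in>F2. ?s I)"
    using F by (subst sum.union_disjoint [symmetric]) (auto simp: F1_def F2_def intro!: sum.cong)
  also have "\<dots> \<le> ennreal (12 * D * dlen (fst P)) + ennreal (48 * D * dlen (fst P))"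
    using F avg dis by (intro add_mono coef_dbad_far coef_dbad_near f mean) (auto simp: F1_def F2_def)
  also have "\<dots> = ennreal (60 * D * dlen (fst P))"
    using D_nonneg by (subst ennreal_plus [symmetric]) (auto simp: algebra_simps)
  finally show ?thesis .
qed

end

section \<open>The local estimate\<close>

context wavelet_system
begin

text \<open>The constant function \<open>2\<close> has averages \<open>2\<close> around every point,
  so the bound for a single wavelet applies on any interval; \<open>16\<close> is
  \<open>8 * 2\<close>.\<close>

lemma coef_bounded_le:
  assumes [measurable]: "f \<in> borel_measurable lebesgue" and "\<And>x. cmod (f x) \<le> 2"
  shows "cmod (coef f I) \<le> 16 * D * 2 powr - (real_of_int (fst I) / 2)"
proof -
  have "ennreal (cmod (coef f I)) \<le> (\<integral>\<^sup>+ x. ennreal (cmod (f x)) * apsi I x \<partial>lebesgue)"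
    by (rule coef_le) auto
  also have "\<dots> \<le> (\<integral>\<^sup>+ x. ennreal 2 * apsi I x \<partial>lebesgue)"
    using assms(2) by (intro nn_integral_mono mult_right_mono ennreal_leI) auto
  also have "\<dots> \<le> ennreal (8 * 2 * D * 2 powr - (real_of_int (fst I) / 2))"
    by (rule nn_integral_psi_le [OF _ _ dyadic_nonempty avg_bound_const]) auto
  finally show ?thesis using D_nonneg by (simp add: ennreal_le_iff)
qed

text \<open>As \<open>g\<close> has averages at most \<open>1\<close> around some point of each
  interval, its pairing with \<open>apsi I\<close> costs at most \<open>8 * D\<close> times the
  scale. This leaves the normalised coefficient sums for which the tail and mean-zero estimates are
  stated.\<close>

lemma nn_integral_sqV_le_scaled:
  assumes [measurable]: "g \<in> borel_measurable lebesgue"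
    and "\<And>j k. (j, k) \<in> F \<Longrightarrow> \<exists>x\<in>dyadic j k. avg_bound g 1 x"
  shows "(\<integral>\<^sup>+ x. ennreal (sqV F f x) * g x \<partial>lebesgue) \<le> ennreal (8 * D) *
    (\<Sum>I\<in>F. scale I * ennreal (cmod (coef f I)))"
proof -
  have "(\<integral>\<^sup>+ x. ennreal (sqV F f x) * g x \<partial>lebesgue) \<le>
    (\<Sum>I\<in>F. ennreal (cmod (coef f I)) * (\<integral>\<^sup>+ x. g x * apsi I x \<partial>lebesgue))"
    by (rule nn_integral_sqV_le) fact
  also have "\<dots> \<le> (\<Sum>I\<in>F. ennreal (cmod (coef f I)) * ennreal (8 * 1 * D * 2 powr - (real_of_int (fst I) / 2)))"
  proof (intro sum_mono mult_left_mono)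
    fix I assume "I \<in> F"
    then obtain x where "x \<in> dyadic (fst I) (snd I)" "avg_bound g 1 x" using assms(2) [of "fst I" "snd I"] by auto
    then show "(\<integral>\<^sup>+ x. g x * apsi I x \<partial>lebesgue) \<le> ennreal (8 * 1 * D * 2 powr - (real_of_int (fst I) / 2))"
      by (intro nn_integral_psi_le) auto
  qed auto
  also have "\<dots> = (\<Sum>I\<in>F. ennreal (8 * D) * (scale I * ennreal (cmod (coef f I))))"
    using D_nonneg by (intro sum.cong refl) (simp add: ennreal_mult [symmetric] mult_ac)
  finally show ?thesis by (simp only: sum_distrib_left)
qed

text \<open>For a function of height \<open>2\<close> every coefficient is at most
  \<open>16 * D\<close> times the scale, so that \<open>f\<close> disappears and the tail of
  \<open>g\<close> on \<open>S\<close> decides.\<close>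

lemma nn_integral_sqV_bounded_le:
  assumes [measurable]: "g \<in> borel_measurable lebesgue" "f \<in> borel_measurable lebesgue" "S \<in> sets lebesgue"
    and f: "\<And>x. cmod (f x) \<le> 2" and "A \<ge> 0"
    and g: "(\<Sum>I\<in>F. scale I * (\<integral>\<^sup>+ x\<in>S. (g x * apsi I x) \<partial>lebesgue)) \<le> ennreal A"
  shows "(\<integral>\<^sup>+ x\<in>S. (ennreal (sqV F f x) * g x) \<partial>lebesgue) \<le> ennreal (16 * D * A)"
proof -
  have "(\<integral>\<^sup>+ x\<in>S. (ennreal (sqV F f x) * g x) \<partial>lebesgue) = (\<integral>\<^sup>+ x. ennreal (sqV F f x) * (g x * indicator S x) \<partial>lebesgue)"
    by (simp add: mult.assoc)
  also have "\<dots> \<le> (\<Sum>I\<in>F. ennreal (cmod (coef f I)) * (\<integral>\<^sup>+ x. g x * indicator S x * apsi I x \<partial>lebesgue))"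
    by (rule nn_integral_sqV_le) measurable
  also have "\<dots> \<le> (\<Sum>I\<in>F. ennreal (16 * D * 2 powr - (real_of_int (fst I) / 2)) * (\<integral>\<^sup>+ x. g x * indicator S x * apsi I x \<partial>lebesgue))"
    using f by (intro sum_mono mult_right_mono ennreal_leI coef_bounded_le) auto
  also have "\<dots> = (\<Sum>I\<in>F. ennreal (16 * D) * (scale I * (\<integral>\<^sup>+ x\<in>S. (g x * apsi I x) \<partial>lebesgue)))"
    using D_nonneg by (intro sum.cong refl) (simp add: ennreal_mult mult_ac)
  also have "\<dots> \<le> ennreal (16 * D) * ennreal A"
    unfolding sum_distrib_left [symmetric] by (intro mult_left_mono g) auto
  also have "\<dots> = ennreal (16 * D * A)"
    using D_nonneg assms(5) by (simp add: ennreal_mult)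
  finally show ?thesis .
qed

text \<open>On scales coarser than \<open>dyadic p q\<close> the square function is constant there up to a bounded error,
  so \<open>g\<close> may be replaced by its average.\<close>

lemma nn_integral_sqV_bounded_far:
  assumes [measurable]: "g \<in> borel_measurable lebesgue" "f \<in> borel_measurable lebesgue"
    and f: "\<And>x. cmod (f x) \<le> 2" and F: "finite F"
    and g: "(\<integral>\<^sup>+ x\<in>dyadic p q. g x \<partial>lebesgue) \<le> ennreal (2 * dlen p)"
    and sc: "\<And>j k. (j, k) \<in> F \<Longrightarrow> j < p"
  shows "(\<integral>\<^sup>+ x\<in>dyadic p q. (ennreal (sqV F f x) * g x) \<partial>lebesgue) \<le>
    2 * (\<integral>\<^sup>+ x\<in>dyadic p q. ennreal (sqV F f x) \<partial>lebesgue) + ennreal (96 * D\<^sup>2 * dlen p)"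
proof -
  define A where "A = (\<integral>\<^sup>+ x\<in>dyadic p q. ennreal (sqV F f x) \<partial>lebesgue) + ennreal (48 * D\<^sup>2 * dlen p)"
  \<comment> \<open>The error \<open>48\<close> is \<open>16 * 3\<close>: the coefficient bound for
    a function of height \<open>2\<close> times the oscillation bound for the wavelets.\<close>
  have osc: "ennreal (sqV F f x) \<le> ennreal (sqV F f y) + ennreal (48 * D\<^sup>2)"
    if "x \<in> dyadic p q" "y \<in> dyadic p q" for x y
  proof -
    have "sqV F f x \<le> L2_set (\<lambda>I. cmod (coef f I) * cmod (psi I y) + cmod (coef f I) * cmod (psi I x - psi I y)) F"
      unfolding sqV_def distrib_left [symmetric]
      by (intro L2_set_mono mult_left_mono norm_triangle_sub) auto
    also have "\<dots> \<le> sqV F f y + L2_set (\<lambda>I. cmod (coef f I) * cmod (psi I x - psi I y)) F"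
      unfolding sqV_def by (rule L2_set_triangle_ineq)
    also have "L2_set (\<lambda>I. cmod (coef f I) * cmod (psi I x - psi I y)) F \<le> (\<Sum>I\<in>F. cmod (coef f I) * cmod (psi I x - psi I y))"
      by (intro L2_set_le_sum) auto
    finally have "ennreal (sqV F f x) \<le> ennreal (sqV F f y + (\<Sum>I\<in>F. cmod (coef f I) * cmod (psi I x - psi I y)))"
      by (simp add: ennreal_leI)
    also have "\<dots> = ennreal (sqV F f y) + (\<Sum>I\<in>F. ennreal (cmod (coef f I)) * ennreal (cmod (psi I x - psi I y)))"
      by (subst ennreal_plus) (auto simp: sum_nonneg sum_ennreal ennreal_mult [symmetric])
    also have "(\<Sum>I\<in>F. ennreal (cmod (coef f I)) * ennreal (cmod (psi I x - psi I y))) \<le>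
      (\<Sum>I\<in>F. ennreal (16 * D * 2 powr - (real_of_int (fst I) / 2)) * ennreal (cmod (psi I x - psi I y)))"
      using f by (intro sum_mono mult_right_mono ennreal_leI coef_bounded_le) auto
    also have "\<dots> = ennreal (16 * D) * (\<Sum>I\<in>F. scale I * ennreal (cmod (psi I x - psi I y)))"
      using D_nonneg by (subst sum_distrib_left, intro sum.cong refl) (simp add: ennreal_mult mult_ac)
    also have "\<dots> \<le> ennreal (16 * D) * ennreal (3 * D)"
      by (intro mult_left_mono oscillation_sum [OF F sc that]) auto
    also have "\<dots> = ennreal (48 * D\<^sup>2)"
      using D_nonneg by (simp add: ennreal_mult [symmetric] power2_eq_square mult_ac)
    finally show ?thesis by (simp add: add_left_mono)
  qed
  \<comment> \<open>Averaging the oscillation bound over the second point bounds the value at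
    \<open>x\<close> by the mean over the interval plus the error. Integration against
    \<open>g\<close>, whose mean is at most \<open>2\<close>, then doubles both terms.\<close>
  have le: "ennreal (sqV F f x) \<le> ennreal (1 / dlen p) * A" if x: "x \<in> dyadic p q" for x
  proof -
    have "ennreal (dlen p) * ennreal (sqV F f x) = (\<integral>\<^sup>+ y\<in>dyadic p q. ennreal (sqV F f x) \<partial>lebesgue)"
      by (subst nn_integral_cmult_indicator) (auto simp: mult.commute)
    also have "\<dots> \<le> (\<integral>\<^sup>+ y. ennreal (sqV F f y) * indicator (dyadic p q) y + ennreal (48 * D\<^sup>2) * indicator (dyadic p q) y \<partial>lebesgue)"
      using osc [OF x] by (intro nn_integral_mono) (auto split: split_indicator)
    also have "\<dots> = A"
      unfolding A_def by (subst nn_integral_add) (auto simp: nn_integral_cmult_indicator ennreal_mult [symmetric])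
    finally have "ennreal (1 / dlen p) * (ennreal (dlen p) * ennreal (sqV F f x)) \<le> ennreal (1 / dlen p) * A"
      by (rule mult_left_mono) simp
    moreover have "ennreal (1 / dlen p) * (ennreal (dlen p) * ennreal (sqV F f x)) = ennreal (sqV F f x)"
      using dlen_pos [of p] by (simp add: ennreal_mult [symmetric] del: dlen_pos)
    ultimately show ?thesis by simp
  qed
  have "(\<integral>\<^sup>+ x\<in>dyadic p q. (ennreal (sqV F f x) * g x) \<partial>lebesgue) \<le>
    (\<integral>\<^sup>+ x. (ennreal (1 / dlen p) * A) * (g x * indicator (dyadic p q) x) \<partial>lebesgue)"
    using le by (intro nn_integral_mono) (auto split: split_indicator intro: mult_right_mono)
  also have "\<dots> = (ennreal (1 / dlen p) * A) * (\<integral>\<^sup>+ x\<in>dyadic p q. g x \<partial>lebesgue)"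
    by (rule nn_integral_cmult) measurable
  also have "\<dots> \<le> (ennreal (1 / dlen p) * A) * ennreal (2 * dlen p)"
    by (intro mult_left_mono g) auto
  also have "\<dots> = ennreal (1 / dlen p * (2 * dlen p)) * A"
    by (simp only: ennreal_mult dlen_nonneg mult_ac divide_nonneg_nonneg zero_le_one mult_nonneg_nonneg zero_le_numeral)
  also have "1 / dlen p * (2 * dlen p) = 2" using dlen_pos [of p] by (simp del: dlen_pos)
  also have "ennreal 2 * A = 2 * (\<integral>\<^sup>+ x\<in>dyadic p q. ennreal (sqV F f x) \<partial>lebesgue) + ennreal 2 * ennreal (48 * D\<^sup>2 * dlen p)"
    unfolding A_def by (simp add: distrib_left)
  also have "ennreal 2 * ennreal (48 * D\<^sup>2 * dlen p) = ennreal (96 * D\<^sup>2 * dlen p)"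
    by (subst ennreal_mult [symmetric]) auto
  finally show ?thesis .
qed

text \<open>The intervals that are not coarser than the stopped one are disjoint from it and
  contribute a tail, with constant \<open>16 * 16 = 256\<close>. The coarser ones allow
  \<open>g\<close> to be averaged at the cost \<open>96\<close>, and the sum is
  \<open>352\<close>.\<close>

lemma nn_integral_sqV_bounded_stopped:
  assumes g[measurable]: "g \<in> borel_measurable lebesgue" and f[measurable]: "f \<in> borel_measurable lebesgue"
    and f2: "\<And>x. cmod (f x) \<le> 2" and F: "finite F"
    and mean: "(\<integral>\<^sup>+ x\<in>dyadic p q. g x \<partial>lebesgue) \<le> ennreal (2 * dlen p)"
    and avg: "\<And>j k. (j, k) \<in> F \<Longrightarrow> \<exists>x\<in>dyadic j k. avg_bound g 1 x"
    and dis: "\<And>j k. (j, k) \<in> F \<Longrightarrow> p \<le> j \<Longrightarrow> dyadic j k \<inter> dyadic p q = {}"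
  shows "(\<integral>\<^sup>+ x\<in>dyadic p q. (ennreal (sqV F f x) * g x) \<partial>lebesgue) \<le>
    2 * (\<integral>\<^sup>+ x\<in>dyadic p q. ennreal (sqV F f x) \<partial>lebesgue) + ennreal (352 * D\<^sup>2 * dlen p)"
proof -
  define F1 F2 where "F1 = {I\<in>F. fst I < p}" and "F2 = {I\<in>F. p \<le> fst I}"
  have fin: "finite F1" "finite F2" using F by (auto simp: F1_def F2_def)
  have "F = F1 \<union> F2" by (auto simp: F1_def F2_def)
  then have split: "sqV F f x \<le> sqV F1 f x + sqV F2 f x" for x using sqV_Un [OF fin] by simp
  have "(\<integral>\<^sup>+ x\<in>dyadic p q. (ennreal (sqV F f x) * g x) \<partial>lebesgue) \<le>
    (\<integral>\<^sup>+ x. ennreal (sqV F1 f x) * g x * indicator (dyadic p q) x + ennreal (sqV F2 f x) * g x * indicator (dyadic p q) x \<partial>lebesgue)"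
  proof (rule nn_integral_mono)
    fix x
    have "ennreal (sqV F f x) \<le> ennreal (sqV F1 f x) + ennreal (sqV F2 f x)"
      using ennreal_leI [OF split [of x]] by simp
    then have "ennreal (sqV F f x) * (g x * indicator (dyadic p q) x) \<le> (ennreal (sqV F1 f x) + ennreal (sqV F2 f x)) * (g x * indicator (dyadic p q) x)"
      by (rule mult_right_mono) simp
    then show "ennreal (sqV F f x) * g x * indicator (dyadic p q) x \<le>
      ennreal (sqV F1 f x) * g x * indicator (dyadic p q) x + ennreal (sqV F2 f x) * g x * indicator (dyadic p q) x"
      by (simp add: distrib_right mult.assoc)
  qed
  also have "\<dots> = (\<integral>\<^sup>+ x\<in>dyadic p q. (ennreal (sqV F1 f x) * g x) \<partial>lebesgue) + (\<integral>\<^sup>+ x\<in>dyadic p q. (ennreal (sqV F2 f x) * g x) \<partial>lebesgue)"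
    by (rule nn_integral_add) measurable
  also have "\<dots> \<le> (2 * (\<integral>\<^sup>+ x\<in>dyadic p q. ennreal (sqV F1 f x) \<partial>lebesgue) + ennreal (96 * D\<^sup>2 * dlen p)) + ennreal (16 * D * (16 * 1 * D * dlen p))"
  proof (rule add_mono)
    show "(\<integral>\<^sup>+ x\<in>dyadic p q. (ennreal (sqV F1 f x) * g x) \<partial>lebesgue) \<le>
      2 * (\<integral>\<^sup>+ x\<in>dyadic p q. ennreal (sqV F1 f x) \<partial>lebesgue) + ennreal (96 * D\<^sup>2 * dlen p)"
      by (rule nn_integral_sqV_bounded_far [OF g f f2 fin(1) mean]) (auto simp: F1_def)
    show "(\<integral>\<^sup>+ x\<in>dyadic p q. (ennreal (sqV F2 f x) * g x) \<partial>lebesgue) \<le> ennreal (16 * D * (16 * 1 * D * dlen p))"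
      using avg dis D_nonneg
      by (intro nn_integral_sqV_bounded_le f2 tail_sum_near fin g f) (auto simp: F2_def)
  qed
  also have "\<dots> \<le> (2 * (\<integral>\<^sup>+ x\<in>dyadic p q. ennreal (sqV F f x) \<partial>lebesgue) + ennreal (96 * D\<^sup>2 * dlen p)) + ennreal (16 * D * (16 * 1 * D * dlen p))"
    by (intro add_right_mono mult_left_mono nn_integral_mono mult_right_mono ennreal_leI sqV_mono F) (auto simp: F1_def)
  also have "\<dots> = 2 * (\<integral>\<^sup>+ x\<in>dyadic p q. ennreal (sqV F f x) \<partial>lebesgue) + ennreal (352 * D\<^sup>2 * dlen p)"
  proof -
    have "ennreal (96 * D\<^sup>2 * dlen p) + ennreal (16 * D * (16 * 1 * D * dlen p)) = ennreal (352 * D\<^sup>2 * dlen p)"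
      using D_nonneg by (subst ennreal_plus [symmetric]) (auto simp: power2_eq_square algebra_simps)
    then show ?thesis by (simp only: add.assoc)
  qed
  finally show ?thesis .
qed

text \<open>Stopping \<open>g\<close> inside the top interval replaces it by a weight of height
  \<open>2\<close> up to admissible errors, and the remaining integral of the square function falls
  to the \<open>L2\<close> bound. The main term gives \<open>10 = 2 * 5\<close>; the errors are
  \<open>352\<close> on the stopped intervals and \<open>256\<close> outside the top interval,
  together \<open>608\<close>.\<close>

lemma local_estimate_bounded:
  assumes g[measurable]: "g \<in> borel_measurable lebesgue" and f[measurable]: "f \<in> borel_measurable lebesgue"
    and f2: "\<And>x. cmod (f x) \<le> 2 * indicator (dyadic j0 k0) x" and F: "finite F"
    and mean: "(\<integral>\<^sup>+ x\<in>dyadic j0 k0. g x \<partial>lebesgue) \<le> ennreal (2 * dlen j0)"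
    and avg: "\<And>j k. (j, k) \<in> F \<Longrightarrow> \<exists>x\<in>dyadic j k. avg_bound g 1 x"
    and sub: "\<And>j k. (j, k) \<in> F \<Longrightarrow> dyadic j k \<subseteq> dyadic j0 k0"
  shows "(\<integral>\<^sup>+ x. ennreal (sqV F f x) * g x \<partial>lebesgue) \<le> ennreal ((608 * D\<^sup>2 + 10) * dlen j0)"
proof -
  let ?J = "dyadic j0 k0"
  \<comment> \<open>One scale finer than everything in \<open>F\<close>: a member that was stopped
    merely because it has scale \<open>M\<close> is then strictly finer than every interval of
    \<open>F\<close>.\<close>
  define M where "M = Max (insert j0 (fst ` F)) + 1"
  have M: "j < M" if "(j, k) \<in> F" for j k
  proof -
    have "j \<le> Max (insert j0 (fst ` F))" using F that by (intro Max_ge) force+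
    then show ?thesis by (simp add: M_def)
  qed
  have "j0 \<le> Max (insert j0 (fst ` F))" using F by (intro Max_ge) auto
  then have "j0 \<le> M" by (simp add: M_def)
  then obtain P where P: "stopping_family g M j0 k0 P" using stopping_family_exists mean by blast
  have f2': "cmod (f x) \<le> 2" for x using f2 [of x] by (auto split: split_indicator_asm)
  have Q: "(\<integral>\<^sup>+ x\<in>dyadic (fst Q) (snd Q). (ennreal (sqV F f x) * g x) \<partial>lebesgue) \<le>
    2 * (\<integral>\<^sup>+ x\<in>dyadic (fst Q) (snd Q). ennreal (sqV F f x) \<partial>lebesgue) + ennreal (352 * D\<^sup>2 * dlen (fst Q))"
    if "Q \<in> P" for Q
  proof (rule nn_integral_sqV_bounded_stopped [OF g f f2' F _ avg])
    show "(\<integral>\<^sup>+ x\<in>dyadic (fst Q) (snd Q). g x \<partial>lebesgue) \<le> ennreal (2 * dlen (fst Q))"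
      using P that by (auto simp: stopping_family_def)
    fix j k assume jk: "(j, k) \<in> F" "fst Q \<le> j"
    then obtain x where "x \<in> dyadic j k" "avg_bound g 1 x" using avg by blast
    then show "dyadic j k \<inter> dyadic (fst Q) (snd Q) = {}"
      using jk M [OF jk(1)] that by (intro stopping_family_disjoint [OF P, of "fst Q" "snd Q" x]) auto
  qed
  have "(\<integral>\<^sup>+ x\<in>?J. (ennreal (sqV F f x) * g x) \<partial>lebesgue) = (\<Sum>Q\<in>P. \<integral>\<^sup>+ x\<in>dyadic (fst Q) (snd Q). (ennreal (sqV F f x) * g x) \<partial>lebesgue)"
    by (rule stopping_family_nn_integral [OF P, symmetric]) measurable
  also have "\<dots> \<le> (\<Sum>Q\<in>P. 2 * (\<integral>\<^sup>+ x\<in>dyadic (fst Q) (snd Q). ennreal (sqV F f x) \<partial>lebesgue) + ennreal (352 * D\<^sup>2) * ennreal (dlen (fst Q)))"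
    using Q by (intro sum_mono) (simp add: ennreal_mult)
  also have "\<dots> = 2 * (\<Sum>Q\<in>P. \<integral>\<^sup>+ x\<in>dyadic (fst Q) (snd Q). ennreal (sqV F f x) \<partial>lebesgue) + ennreal (352 * D\<^sup>2) * (\<Sum>Q\<in>P. ennreal (dlen (fst Q)))"
    by (simp only: sum.distrib sum_distrib_left)
  also have "\<dots> = 2 * (\<integral>\<^sup>+ x\<in>?J. ennreal (sqV F f x) \<partial>lebesgue) + ennreal (352 * D\<^sup>2) * ennreal (dlen j0)"
    by (subst stopping_family_nn_integral [OF P]) (auto simp: stopping_family_sum_dlen [OF P])
  also have "(\<integral>\<^sup>+ x\<in>?J. ennreal (sqV F f x) \<partial>lebesgue) \<le> ennreal (5 * dlen j0)"
  proof -
    have sq: "(cmod (f x))\<^sup>2 \<le> 4 * indicator ?J x" for x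
      using f2 [of x] power_mono [of "cmod (f x)" 2 2] by (auto split: split_indicator_asm split_indicator)
    have "(\<integral>\<^sup>+ x\<in>?J. ennreal (sqV F f x) \<partial>lebesgue) \<le> (\<integral>\<^sup>+ x. indicator ?J x + ennreal ((sqV F f x)\<^sup>2) \<partial>lebesgue)"
    proof (rule nn_integral_mono)
      fix x
      \<comment> \<open>This elementary inequality plays the part of Cauchy-Schwarz: the constant
        contributes the length of the top interval once and the square at most four times, since
        \<open>f\<close> has height \<open>2\<close> there.\<close>
      have "sqV F f x \<le> 1 + (sqV F f x)\<^sup>2"
        using sum_squares_bound [of "sqV F f x" 1] sqV_nonneg [of F f x] by (simp del: sqV_nonneg)
      then have "ennreal (sqV F f x) \<le> 1 + ennreal ((sqV F f x)\<^sup>2)"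
        using ennreal_leI by force
      then show "ennreal (sqV F f x) * indicator ?J x \<le> indicator ?J x + ennreal ((sqV F f x)\<^sup>2)"
        by (auto split: split_indicator)
    qed
    also have "\<dots> = ennreal (dlen j0) + (\<integral>\<^sup>+ x. ennreal ((sqV F f x)\<^sup>2) \<partial>lebesgue)"
      by (subst nn_integral_add) auto
    also have "\<dots> \<le> ennreal (dlen j0) + (\<integral>\<^sup>+ x. ennreal ((cmod (f x))\<^sup>2) \<partial>lebesgue)"
    proof (intro add_left_mono sqV_L2_bound f F)
      show "integrable lebesgue (\<lambda>x. (cmod (f x))\<^sup>2)"
      proof (rule Bochner_Integration.integrable_bound)
        show "integrable lebesgue (\<lambda>x. 4 * indicator ?J x :: real)" by (intro integrable_mult_right integrable_real_indicator) auto
        show "AE x in lebesgue. norm ((cmod (f x))\<^sup>2) \<le> norm (4 * indicator ?J x :: real)" using sq by auto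
      qed measurable
    qed
    also have "(\<integral>\<^sup>+ x. ennreal ((cmod (f x))\<^sup>2) \<partial>lebesgue) \<le> (\<integral>\<^sup>+ x. ennreal 4 * indicator ?J x \<partial>lebesgue)"
    proof (rule nn_integral_mono)
      fix x show "ennreal ((cmod (f x))\<^sup>2) \<le> ennreal 4 * indicator ?J x"
        using ennreal_leI [OF sq [of x]] by (simp only: ennreal_mult ennreal_indicator indicator_pos_le zero_le_numeral)
    qed
    also have "\<dots> = ennreal (4 * dlen j0)" by (subst nn_integral_cmult_indicator) (auto simp: ennreal_mult)
    finally have "(\<integral>\<^sup>+ x\<in>?J. ennreal (sqV F f x) \<partial>lebesgue) \<le> ennreal (dlen j0) + ennreal (4 * dlen j0)"
      by (simp add: add_left_mono)
    then show ?thesis by (subst (asm) ennreal_plus [symmetric]) auto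
  qed
  finally have 1: "(\<integral>\<^sup>+ x\<in>?J. (ennreal (sqV F f x) * g x) \<partial>lebesgue) \<le> ennreal 2 * ennreal (5 * dlen j0) + ennreal (352 * D\<^sup>2) * ennreal (dlen j0)"
    by (simp add: add_right_mono mult_left_mono)
  have 2: "(\<integral>\<^sup>+ x\<in>- ?J. (ennreal (sqV F f x) * g x) \<partial>lebesgue) \<le> ennreal (16 * D * (16 * 1 * D * dlen j0))"
    using avg sub D_nonneg by (intro nn_integral_sqV_bounded_le f2' tail_sum_complement F g f) auto
  have "(\<integral>\<^sup>+ x. ennreal (sqV F f x) * g x \<partial>lebesgue) =
     (\<integral>\<^sup>+ x. ennreal (sqV F f x) * g x * indicator ?J x + ennreal (sqV F f x) * g x * indicator (- ?J) x \<partial>lebesgue)"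
    by (intro nn_integral_cong) (auto split: split_indicator)
  also have "\<dots> = (\<integral>\<^sup>+ x\<in>?J. (ennreal (sqV F f x) * g x) \<partial>lebesgue) + (\<integral>\<^sup>+ x\<in>- ?J. (ennreal (sqV F f x) * g x) \<partial>lebesgue)"
    by (rule nn_integral_add) measurable
  also have "\<dots> \<le> (ennreal 2 * ennreal (5 * dlen j0) + ennreal (352 * D\<^sup>2) * ennreal (dlen j0)) + ennreal (16 * D * (16 * 1 * D * dlen j0))"
    by (intro add_mono 1 2)
  also have "\<dots> = ennreal ((608 * D\<^sup>2 + 10) * dlen j0)"
  proof -
    have "ennreal 2 * ennreal (5 * dlen j0) = ennreal (10 * dlen j0)" "ennreal (352 * D\<^sup>2) * ennreal (dlen j0) = ennreal (352 * D\<^sup>2 * dlen j0)"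
      by (subst ennreal_mult [symmetric]; simp)+
    moreover have "ennreal (10 * dlen j0) + ennreal (352 * D\<^sup>2 * dlen j0) = ennreal (10 * dlen j0 + 352 * D\<^sup>2 * dlen j0)"
      by (rule ennreal_plus [symmetric]) auto
    moreover have "ennreal (10 * dlen j0 + 352 * D\<^sup>2 * dlen j0) + ennreal (16 * D * (16 * 1 * D * dlen j0)) = ennreal ((608 * D\<^sup>2 + 10) * dlen j0)"
      using D_nonneg by (subst ennreal_plus [symmetric]) (auto simp: power2_eq_square algebra_simps)
    ultimately show ?thesis by simp
  qed
  finally show ?thesis .
qed

text \<open>The Calderon-Zygmund decomposition: \<open>h\<close> is \<open>f\<close> outside the top
  interval, \<open>b\<close> collects the mean-zero parts, and \<open>w\<close> the stopped means,
  which are at most \<open>2\<close>. The first two are summed absolutely, with constants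
  \<open>8 * 16 = 128\<close> and \<open>8 * 60 = 480\<close>, and \<open>w\<close> costs
  \<open>608\<close>; the total is \<open>1216\<close>. The top interval belongs to
  \<open>F\<close>, which bounds the means of \<open>f\<close> and \<open>g\<close> on it.\<close>

lemma local_estimate:
  assumes f: "integrable lebesgue f" and g[measurable]: "g \<in> borel_measurable lebesgue"
    and F: "finite F" and J: "(j0, k0) \<in> F"
    and avgf: "\<And>j k. (j, k) \<in> F \<Longrightarrow> \<exists>x\<in>dyadic j k. avg_bound (\<lambda>x. ennreal (cmod (f x))) 1 x"
    and avg: "\<And>j k. (j, k) \<in> F \<Longrightarrow> \<exists>x\<in>dyadic j k. avg_bound g 1 x"
    and sub: "\<And>j k. (j, k) \<in> F \<Longrightarrow> dyadic j k \<subseteq> dyadic j0 k0"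
  shows "(\<integral>\<^sup>+ x. ennreal (sqV F f x) * g x \<partial>lebesgue) \<le> ennreal ((1216 * D\<^sup>2 + 10) * dlen j0)"
proof -
  let ?J = "dyadic j0 k0" and ?s = "\<lambda>I. scale I"
  have [measurable]: "f \<in> borel_measurable lebesgue" using f by simp
  have mean: "(\<integral>\<^sup>+ x\<in>?J. h x \<partial>lebesgue) \<le> ennreal (2 * dlen j0)" if h: "\<exists>x\<in>?J. avg_bound h 1 x" for h
  proof -
    have "(\<integral>\<^sup>+ x\<in>?J. h x \<partial>lebesgue) \<le> ennreal (1 * dlen j0)" using h avg_bound_dyadic by blast
    also have "\<dots> \<le> ennreal (2 * dlen j0)" by (intro ennreal_leI) auto
    finally show ?thesis .
  qed
  define M where "M = Max (insert j0 (fst ` F)) + 1"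
  have M: "j < M" if "(j, k) \<in> F" for j k
  proof -
    have "j \<le> Max (insert j0 (fst ` F))" using F that by (intro Max_ge) force+
    then show ?thesis by (simp add: M_def)
  qed
  have "j0 \<le> Max (insert j0 (fst ` F))" using F by (intro Max_ge) auto
  then have M0: "j0 \<le> M" by (simp add: M_def)
  obtain P where P: "stopping_family (\<lambda>x. ennreal (cmod (f x))) M j0 k0 P"
    using stopping_family_exists [OF M0 mean [OF avgf [OF J]]] by blast
  then have finP: "finite P" by (simp add: stopping_family_def)
  have Pmean: "(\<integral>\<^sup>+ x\<in>dyadic (fst Q) (snd Q). ennreal (cmod (f x)) \<partial>lebesgue) \<le> ennreal (2 * dlen (fst Q))" if "Q \<in> P" for Q
    using P that by (auto simp: stopping_family_def)
  define h where "h x = indicator (- ?J) x *\<^sub>R f x" for x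
  define b where "b x = (\<Sum>Q\<in>P. dbad f Q x)" for x
  define w where "w x = (\<Sum>Q\<in>P. indicator (dyadic (fst Q) (snd Q)) x *\<^sub>R dmean f Q)" for x
  have hi: "integrable lebesgue h" unfolding h_def by (rule integrable_restrict [OF f]) auto
  have bi: "integrable lebesgue b" unfolding b_def by (intro Bochner_Integration.integrable_sum integrable_dbad f)
  have wi: "integrable lebesgue w" unfolding w_def by (intro Bochner_Integration.integrable_sum integrable_indicator_dyadic)
  have [measurable]: "h \<in> borel_measurable lebesgue" "b \<in> borel_measurable lebesgue" and wm[measurable]: "w \<in> borel_measurable lebesgue"
    using hi bi wi by auto
  have f_eq: "f x = h x + (b x + w x)" for x
  proof -
    have "b x + w x = (\<Sum>Q\<in>P. indicator (dyadic (fst Q) (snd Q)) x *\<^sub>R f x)"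
      unfolding b_def w_def sum.distrib [symmetric] dbad_def scaleR_diff_right by simp
    also have "\<dots> = indicator ?J x *\<^sub>R f x"
      by (simp only: scaleR_sum_left [symmetric] stopping_family_indicator [OF P, symmetric])
    finally show ?thesis by (auto simp: h_def split: split_indicator)
  qed
  have w2: "cmod (w x) \<le> 2 * indicator ?J x" for x
  proof -
    have "cmod (w x) \<le> (\<Sum>Q\<in>P. indicator (dyadic (fst Q) (snd Q)) x * 2)"
      unfolding w_def
    proof (rule sum_norm_le)
      fix Q assume "Q \<in> P"
      then have "cmod (dmean f Q) \<le> 2" by (intro cmod_dmean_le f Pmean) auto
      then show "cmod (indicator (dyadic (fst Q) (snd Q)) x *\<^sub>R dmean f Q) \<le> indicator (dyadic (fst Q) (snd Q)) x * 2"
        by (auto split: split_indicator)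
    qed
    also have "\<dots> = 2 * indicator ?J x"
      unfolding sum_distrib_right [symmetric] stopping_family_indicator [OF P, symmetric] by (rule mult.commute)
    finally show ?thesis .
  qed
  have "f = (\<lambda>x. h x + (b x + w x))" by (rule ext) (rule f_eq)
  then have cf: "coef f I = coef h I + (coef b I + coef w I)" for I
    using coef_add [OF hi Bochner_Integration.integrable_add [OF bi wi], of I] coef_add [OF bi wi, of I] by simp
  have V: "sqV F f x \<le> sqV F h x + (sqV F b x + sqV F w x)" for x
  proof -
    have "sqV F f x \<le> sqV F h x + sqV F (\<lambda>x. b x + w x) x"
      by (rule sqV_triangle) (simp add: cf coef_add [OF bi wi] norm_triangle_ineq)
    also have "sqV F (\<lambda>x. b x + w x) x \<le> sqV F b x + sqV F w x"
      by (rule sqV_triangle) (simp add: coef_add [OF bi wi] norm_triangle_ineq)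
    finally show ?thesis by simp
  qed
  have "(\<integral>\<^sup>+ x. ennreal (sqV F f x) * g x \<partial>lebesgue) \<le>
    (\<integral>\<^sup>+ x. ennreal (sqV F h x) * g x + (ennreal (sqV F b x) * g x + ennreal (sqV F w x) * g x) \<partial>lebesgue)"
  proof (rule nn_integral_mono)
    fix x
    have "ennreal (sqV F f x) \<le> ennreal (sqV F h x + (sqV F b x + sqV F w x))" by (intro ennreal_leI V)
    also have "\<dots> = ennreal (sqV F h x) + (ennreal (sqV F b x) + ennreal (sqV F w x))" by simp
    finally have "ennreal (sqV F f x) * g x \<le> (ennreal (sqV F h x) + (ennreal (sqV F b x) + ennreal (sqV F w x))) * g x"
      by (rule mult_right_mono) simp
    then show "ennreal (sqV F f x) * g x \<le> ennreal (sqV F h x) * g x + (ennreal (sqV F b x) * g x + ennreal (sqV F w x) * g x)"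
      by (simp only: distrib_right)
  qed
  also have "\<dots> = (\<integral>\<^sup>+ x. ennreal (sqV F h x) * g x \<partial>lebesgue) +
    ((\<integral>\<^sup>+ x. ennreal (sqV F b x) * g x \<partial>lebesgue) + (\<integral>\<^sup>+ x. ennreal (sqV F w x) * g x \<partial>lebesgue))"
    by (subst nn_integral_add, measurable, subst nn_integral_add, measurable)
  also have "\<dots> \<le> ennreal (8 * D) * ennreal (16 * 1 * D * dlen j0) +
    (ennreal (8 * D) * (ennreal (60 * D) * ennreal (dlen j0)) + ennreal ((608 * D\<^sup>2 + 10) * dlen j0))"
  proof (intro add_mono)
    have "(\<Sum>I\<in>F. ?s I * ennreal (cmod (coef h I))) \<le>
      (\<Sum>I\<in>F. ?s I * (\<integral>\<^sup>+ x\<in>- ?J. (ennreal (cmod (f x)) * apsi I x) \<partial>lebesgue))"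
    proof (intro sum_mono mult_left_mono)
      fix I
      have "ennreal (cmod (coef h I)) \<le> (\<integral>\<^sup>+ x. ennreal (cmod (h x)) * apsi I x \<partial>lebesgue)"
        by (rule coef_le) measurable
      also have "\<dots> = (\<integral>\<^sup>+ x\<in>- ?J. (ennreal (cmod (f x)) * apsi I x) \<partial>lebesgue)"
        by (intro nn_integral_cong) (auto simp: h_def split: split_indicator)
      finally show "ennreal (cmod (coef h I)) \<le> (\<integral>\<^sup>+ x\<in>- ?J. (ennreal (cmod (f x)) * apsi I x) \<partial>lebesgue)" .
    qed auto
    also have "\<dots> \<le> ennreal (16 * 1 * D * dlen j0)"
      using avgf sub by (intro tail_sum_complement F) auto
    finally show "(\<integral>\<^sup>+ x. ennreal (sqV F h x) * g x \<partial>lebesgue) \<le> ennreal (8 * D) * ennreal (16 * 1 * D * dlen j0)"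
      using nn_integral_sqV_le_scaled [OF g avg, of F h] by (meson order_trans mult_left_mono zero_le)
  next
    have "(\<Sum>I\<in>F. ?s I * ennreal (cmod (coef b I))) \<le> (\<Sum>I\<in>F. \<Sum>Q\<in>P. ?s I * ennreal (cmod (coef (dbad f Q) I)))"
    proof (intro sum_mono)
      fix I
      have "cmod (coef b I) \<le> (\<Sum>Q\<in>P. cmod (coef (dbad f Q) I))"
        unfolding b_def by (subst coef_sum) (auto intro: integrable_dbad f norm_sum)
      then have "ennreal (cmod (coef b I)) \<le> (\<Sum>Q\<in>P. ennreal (cmod (coef (dbad f Q) I)))"
        by (subst sum_ennreal) (auto intro: ennreal_leI)
      then show "?s I * ennreal (cmod (coef b I)) \<le> (\<Sum>Q\<in>P. ?s I * ennreal (cmod (coef (dbad f Q) I)))"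
        unfolding sum_distrib_left [symmetric] by (rule mult_left_mono) simp
    qed
    also have "\<dots> = (\<Sum>Q\<in>P. \<Sum>I\<in>F. ?s I * ennreal (cmod (coef (dbad f Q) I)))" by (rule sum.swap)
    also have "\<dots> \<le> (\<Sum>Q\<in>P. ennreal (60 * D) * ennreal (dlen (fst Q)))"
    proof (rule sum_mono)
      fix Q assume Q: "Q \<in> P"
      have "(\<Sum>I\<in>F. ?s I * ennreal (cmod (coef (dbad f Q) I))) \<le> ennreal (60 * D * dlen (fst Q))"
      proof (rule coef_dbad [OF f F Pmean [OF Q] avgf])
        fix j k assume jk: "(j, k) \<in> F" "fst Q \<le> j"
        then obtain x where "x \<in> dyadic j k" "avg_bound (\<lambda>x. ennreal (cmod (f x))) 1 x" using avgf by blast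
        then show "dyadic j k \<inter> dyadic (fst Q) (snd Q) = {}"
          using jk M [OF jk(1)] Q by (intro stopping_family_disjoint [OF P, of "fst Q" "snd Q" x]) auto
      qed
      then show "(\<Sum>I\<in>F. ?s I * ennreal (cmod (coef (dbad f Q) I))) \<le> ennreal (60 * D) * ennreal (dlen (fst Q))"
        using D_nonneg by (simp add: ennreal_mult)
    qed
    also have "\<dots> = ennreal (60 * D) * ennreal (dlen j0)"
      by (simp only: sum_distrib_left [symmetric] stopping_family_sum_dlen [OF P])
    finally show "(\<integral>\<^sup>+ x. ennreal (sqV F b x) * g x \<partial>lebesgue) \<le> ennreal (8 * D) * (ennreal (60 * D) * ennreal (dlen j0))"
      using nn_integral_sqV_le_scaled [OF g avg, of F b] by (meson order_trans mult_left_mono zero_le)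
  next
    show "(\<integral>\<^sup>+ x. ennreal (sqV F w x) * g x \<partial>lebesgue) \<le> ennreal ((608 * D\<^sup>2 + 10) * dlen j0)"
      by (rule local_estimate_bounded [OF g wm w2 F mean [OF avg [OF J]] avg sub])
  qed
  also have "\<dots> = ennreal ((1216 * D\<^sup>2 + 10) * dlen j0)"
  proof -
    have "ennreal (8 * D) * ennreal (16 * 1 * D * dlen j0) = ennreal (128 * D\<^sup>2 * dlen j0)"
      using D_nonneg by (subst ennreal_mult [symmetric]) (auto simp: power2_eq_square mult_ac)
    moreover have "ennreal (8 * D) * (ennreal (60 * D) * ennreal (dlen j0)) = ennreal (480 * D\<^sup>2 * dlen j0)"
      using D_nonneg by (subst ennreal_mult [symmetric], simp, simp, subst ennreal_mult [symmetric]) (auto simp: power2_eq_square mult_ac)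
    moreover have "ennreal (128 * D\<^sup>2 * dlen j0) + (ennreal (480 * D\<^sup>2 * dlen j0) + ennreal ((608 * D\<^sup>2 + 10) * dlen j0)) = ennreal ((1216 * D\<^sup>2 + 10) * dlen j0)"
      by (subst ennreal_plus [symmetric], simp, simp, subst ennreal_plus [symmetric]) (auto simp: algebra_simps)
    ultimately show ?thesis by simp
  qed
  finally show ?thesis .
qed

end

section \<open>Maximal functions and the bilinear estimate\<close>

lemma maximal_op_avg_bound:
  assumes "maximal_op f x \<le> ennreal a" "a \<ge> 0"
  shows "avg_bound (\<lambda>y. ennreal (cmod (f y))) a x"
  unfolding avg_bound_def
proof (intro allI impI)
  fix l r assume lr: "l \<le> x" "x \<le> r" "l < r"
  let ?S = "\<integral>\<^sup>+ y\<in>{l..r}. ennreal (cmod (f y)) \<partial>lebesgue"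
  have "ennreal (1 / (r - l)) * ?S \<le> maximal_op f x"
    unfolding maximal_op_def using lr by (intro SUP_upper2 [of "(l, r)"]) auto
  then have "ennreal (1 / (r - l)) * ?S \<le> ennreal a" using assms(1) by order
  then have "ennreal (r - l) * (ennreal (1 / (r - l)) * ?S) \<le> ennreal (r - l) * ennreal a"
    by (rule mult_left_mono) simp
  moreover have "ennreal (r - l) * (ennreal (1 / (r - l)) * ?S) = ?S"
    using lr by (simp add: ennreal_mult [symmetric] mult.assoc [symmetric])
  ultimately show "?S \<le> ennreal (a * (r - l))"
    using lr assms(2) by (simp add: ennreal_mult mult.commute)
qed

lemma maximal_op_bounded:
  assumes "\<And>x. cmod (f x) \<le> B"
  shows "maximal_op f x \<le> ennreal B"
  unfolding maximal_op_def
proof (rule SUP_least, clarsimp)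
  fix l r :: real assume lr: "l < r"
  have B: "B \<ge> 0" using assms [of 0] norm_ge_zero order_trans by blast
  have "(\<integral>\<^sup>+ y\<in>{l..r}. ennreal (cmod (f y)) \<partial>lebesgue) \<le> (\<integral>\<^sup>+ y. ennreal B * indicator {l..r} y \<partial>lebesgue)"
    using assms by (intro nn_integral_mono mult_right_mono ennreal_leI) auto
  also have "\<dots> = ennreal B * ennreal (r - l)" using lr by (subst nn_integral_cmult_indicator) auto
  finally have "ennreal (1 / (r - l)) * (\<integral>\<^sup>+ y\<in>{l..r}. ennreal (cmod (f y)) \<partial>lebesgue) \<le>
    ennreal (1 / (r - l)) * (ennreal B * ennreal (r - l))" by (rule mult_left_mono) simp
  also have "\<dots> = ennreal B" using lr B by (simp add: ennreal_mult [symmetric])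
  finally show "ennreal (1 / (r - l)) * (\<integral>\<^sup>+ y\<in>{l..r}. ennreal (cmod (f y)) \<partial>lebesgue) \<le> ennreal B" .
qed

text \<open>A slight enlargement of an interval with large average keeps the average large, so the
  superlevel sets of the maximal function over closed intervals are open.\<close>

lemma open_maximal_op_superlevel: "open {x. t < maximal_op f x}"
proof (rule openI)
  fix x assume "x \<in> {x. t < maximal_op f x}"
  then obtain l r where lr: "l \<le> x" "x \<le> r" "l < r" and
    t: "t < ennreal (1 / (r - l)) * (\<integral>\<^sup>+ y\<in>{l..r}. ennreal (cmod (f y)) \<partial>lebesgue)"
    by (auto simp: maximal_op_def less_SUP_iff)
  let ?S = "\<integral>\<^sup>+ y\<in>{l..r}. ennreal (cmod (f y)) \<partial>lebesgue"
  have "((\<lambda>e. ennreal (1 / (r - l + 2 * e)) * ?S) \<longlongrightarrow> ennreal (1 / (r - l + 2 * 0)) * ?S) (at_right 0)"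
  proof (rule tendsto_mult_ennreal)
    show "((\<lambda>e. ennreal (1 / (r - l + 2 * e))) \<longlongrightarrow> ennreal (1 / (r - l + 2 * 0))) (at_right 0)"
      using lr by (intro tendsto_intros) auto
    show "((\<lambda>e. ?S) \<longlongrightarrow> ?S) (at_right (0::real))" by simp
  qed (use lr in auto)
  then have "eventually (\<lambda>e. t < ennreal (1 / (r - l + 2 * e)) * ?S) (at_right 0)"
    using t by (intro order_tendstoD(1)) auto
  then have "eventually (\<lambda>e. t < ennreal (1 / (r - l + 2 * e)) * ?S \<and> 0 < e) (at_right 0)"
    using eventually_at_right_less by (rule eventually_conj)
  then obtain e where e: "e > 0" "t < ennreal (1 / (r - l + 2 * e)) * ?S"
    using eventually_happens trivial_limit_at_right_real by blast
  have "t < maximal_op f y" if "y \<in> ball x e" for y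
  proof -
    have y: "l - e \<le> y" "y \<le> r + e" using that lr by (auto simp: dist_real_def abs_less_iff)
    have "ennreal (1 / (r - l + 2 * e)) * ?S \<le> ennreal (1 / ((r + e) - (l - e))) * (\<integral>\<^sup>+ y\<in>{l-e..r+e}. ennreal (cmod (f y)) \<partial>lebesgue)"
    proof (rule mult_mono)
      have "r - l + 2 * e = (r + e) - (l - e)" by simp
      then show "ennreal (1 / (r - l + 2 * e)) \<le> ennreal (1 / ((r + e) - (l - e)))" by (simp only: order_refl)
      show "?S \<le> (\<integral>\<^sup>+ y\<in>{l-e..r+e}. ennreal (cmod (f y)) \<partial>lebesgue)"
        using e(1) by (intro nn_integral_mono) (auto split: split_indicator)
    qed auto
    also have "\<dots> \<le> maximal_op f y"
      unfolding maximal_op_def using y lr e(1) by (intro SUP_upper2 [of "(l - e, r + e)"]) auto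
    finally show ?thesis using e(2) by order
  qed
  then show "\<exists>T>0. ball x T \<subseteq> {x. t < maximal_op f x}" using e(1) by blast
qed

lemma maximal_op_measurable [measurable]: "maximal_op f \<in> borel_measurable lebesgue"
proof -
  have "maximal_op f \<in> borel_measurable borel"
    by (rule borel_measurableI_greater) (simp add: open_maximal_op_superlevel borel_open)
  then show ?thesis by (simp add: measurable_completion)
qed

section \<open>Maximal intervals and dyadic levels\<close>

lemma dyadic_eqD: "dyadic j k \<subseteq> dyadic j l \<Longrightarrow> k = l"
  using dyadic_nonempty [of k j] by (auto simp: dyadic_def)

text \<open>Among the finitely many intervals of \<open>F\<close> that contain \<open>I\<close>, one
  of the coarsest scale is maximal. Two maximal intervals that meet would be nested, hence
  equal.\<close>

lemma maximal_dyadic_exists: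
  assumes "finite F"
  shows "\<exists>G\<subseteq>F. (\<forall>I\<in>F. \<exists>J\<in>G. dyadic (fst I) (snd I) \<subseteq> dyadic (fst J) (snd J)) \<and>
    (\<forall>I\<in>G. \<forall>J\<in>G. I \<noteq> J \<longrightarrow> dyadic (fst I) (snd I) \<inter> dyadic (fst J) (snd J) = {})"
proof -
  let ?d = "\<lambda>I. dyadic (fst I) (snd I)"
  define G where "G = {I\<in>F. \<forall>J\<in>F. ?d I \<subseteq> ?d J \<longrightarrow> J = I}"
  have "\<exists>J\<in>G. ?d I \<subseteq> ?d J" if "I \<in> F" for I
  proof -
    define A where "A = {J\<in>F. ?d I \<subseteq> ?d J}"
    have "finite A" "I \<in> A" using assms that by (auto simp: A_def)
    then have "finite A" "A \<noteq> {}" by blast+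
    then obtain J where J: "J \<in> A" "\<And>K. K \<in> A \<Longrightarrow> fst J \<le> fst K"
      using ex_min_if_finite [of "fst ` A"] by (metis (no_types, lifting) finite_imageI image_iff image_is_empty linorder_not_less)
    have "K = J" if K: "K \<in> F" "?d J \<subseteq> ?d K" for K
    proof -
      have "K \<in> A" using K J(1) by (auto simp: A_def)
      then have "fst J \<le> fst K" by (rule J)
      moreover have "fst K \<le> fst J" by (rule dyadic_subset_imp_le [OF K(2)])
      ultimately have "fst K = fst J" by simp
      then show ?thesis using K(2) dyadic_eqD by (metis prod_eqI)
    qed
    then have "J \<in> G" using J(1) by (auto simp: G_def A_def)
    then show ?thesis using J(1) by (auto simp: A_def)
  qed
  moreover have "?d I \<inter> ?d J = {}" if "I \<in> G" "J \<in> G" "I \<noteq> J" for I J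
  proof (rule ccontr)
    assume *: "?d I \<inter> ?d J \<noteq> {}"
    then have "?d I \<subseteq> ?d J \<or> ?d J \<subseteq> ?d I"
      using dyadic_nested [of "fst J" "fst I" "snd I" "snd J"] dyadic_nested [of "fst I" "fst J" "snd J" "snd I"]
      by (metis Int_commute linear)
    then show False using that by (auto simp: G_def)
  qed
  ultimately show ?thesis by (intro exI [of _ G]) (auto simp: G_def)
qed

text \<open>The integer \<open>n\<close> is the floor of the binary logarithm of the infimum of
  \<open>h\<close> over \<open>S\<close>, which the premises keep positive and finite. The point
  with a small value exists because the infimum lies strictly below
  \<open>2 * 2 powr n\<close>.\<close>

lemma dyadic_level:
  fixes h :: "real \<Rightarrow> ennreal"
  assumes "e > 0" "\<And>x. x \<in> S \<Longrightarrow> ennreal e \<le> h x" "x0 \<in> S" "h x0 \<le> ennreal B"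
  shows "\<exists>n::int. (\<forall>x\<in>S. ennreal (2 powr n) \<le> h x) \<and> (\<exists>x\<in>S. h x \<le> ennreal (2 * 2 powr n))"
proof -
  define \<alpha> where "\<alpha> = (INF x\<in>S. h x)"
  have lower: "ennreal e \<le> \<alpha>" unfolding \<alpha>_def by (intro INF_greatest assms)
  have "\<alpha> \<le> h x0" unfolding \<alpha>_def by (intro INF_lower assms)
  then have "\<alpha> < top" using assms(4) by (meson ennreal_less_top order.strict_trans1 order_trans)
  then obtain a where a: "\<alpha> = ennreal a" "a \<ge> 0" by (cases \<alpha>) auto
  then have "a \<ge> e" using lower assms(1) by simp
  then have a0: "a > 0" using assms(1) by simp
  define n where "n = \<lfloor>log 2 a\<rfloor>"
  have n: "real_of_int n \<le> log 2 a" "log 2 a < real_of_int n + 1" unfolding n_def by linarith+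
  have "2 powr n \<le> a" using n(1) a0 by (simp add: le_log_iff)
  then have "\<forall>x\<in>S. ennreal (2 powr n) \<le> h x"
    using a(1) by (metis INF_lower \<alpha>_def ennreal_leI order_trans)
  moreover have "a < 2 powr (real_of_int n + 1)" using n(2) a0 by (simp add: log_less_iff)
  then have "\<alpha> < ennreal (2 * 2 powr n)" using a by (simp add: powr_add ennreal_lessI mult.commute)
  then have "\<exists>x\<in>S. h x \<le> ennreal (2 * 2 powr n)"
    unfolding \<alpha>_def INF_less_iff by (auto intro: less_imp_le)
  ultimately show ?thesis by blast
qed

text \<open>Powers of two below \<open>t\<close> add up to at most twice the largest of them.
  Finiteness of \<open>A\<close> provides the largest one even if \<open>t\<close> is
  infinite.\<close>

lemma sum_dyadic_levels_le:
  fixes t :: ennreal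
  assumes "finite A"
  shows "(\<Sum>n\<in>A. if ennreal (2 powr real_of_int n) \<le> t then ennreal (2 powr n) else 0) \<le> 2 * t"
proof -
  define B where "B = {n\<in>A. ennreal (2 powr real_of_int n) \<le> t}"
  have B: "finite B" using assms by (simp add: B_def)
  have "(\<Sum>n\<in>A. if ennreal (2 powr real_of_int n) \<le> t then ennreal (2 powr n) else 0) = (\<Sum>n\<in>B. ennreal (2 powr n))"
    unfolding B_def by (rule sum.inter_filter [OF assms, symmetric])
  also have "\<dots> \<le> 2 * t"
  proof (cases "B = {}")
    case False
    define N where "N = Max B"
    have N: "N \<in> B" "\<And>n. n \<in> B \<Longrightarrow> n \<le> N" using B False by (auto simp: N_def)
    have *: "(\<Sum>n\<in>B. 2 powr real_of_int n) * dlen (N + 1) \<le> 1"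
      by (rule sum_powr_le [OF B]) (use N(2) in force)
    have "(\<Sum>n\<in>B. 2 powr real_of_int n) = (\<Sum>n\<in>B. 2 powr real_of_int n) * dlen (N + 1) * 2 powr real_of_int (N + 1)"
      using powr_dlen(2) [of "N + 1"] by (simp only: mult.assoc mult_1_right)
    also have "\<dots> \<le> 1 * 2 powr real_of_int (N + 1)" using * by (rule mult_right_mono) simp
    also have "\<dots> = 2 * 2 powr N" by (simp add: powr_add)
    finally have "ennreal (\<Sum>n\<in>B. 2 powr real_of_int n) \<le> ennreal (2 * 2 powr N)" by (rule ennreal_leI)
    also have "\<dots> = 2 * ennreal (2 powr N)" by (simp add: ennreal_mult)
    also have "\<dots> \<le> 2 * t" using N(1) by (intro mult_left_mono) (auto simp: B_def)
    finally show ?thesis by (simp add: sum_ennreal)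
  qed simp
  finally show ?thesis .
qed

lemma avg_bound_scale:
  assumes "avg_bound h a x" "a > 0" and [measurable]: "h \<in> borel_measurable lebesgue"
  shows "avg_bound (\<lambda>y. ennreal (1 / a) * h y) 1 x"
  unfolding avg_bound_def
proof (intro allI impI)
  fix l r assume lr: "l \<le> x" "x \<le> r" "l < r"
  have "(\<integral>\<^sup>+ y\<in>{l..r}. (ennreal (1 / a) * h y) \<partial>lebesgue) = ennreal (1 / a) * (\<integral>\<^sup>+ y\<in>{l..r}. h y \<partial>lebesgue)"
    unfolding mult.assoc
    by (rule nn_integral_cmult) (intro borel_measurable_times_ennreal assms(3) borel_measurable_indicator, simp)
  also have "\<dots> \<le> ennreal (1 / a) * ennreal (a * (r - l))" by (intro mult_left_mono avg_boundD [OF assms(1)] lr) auto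
  also have "\<dots> = ennreal (1 * (r - l))" using assms(2) lr by (simp add: ennreal_mult [symmetric])
  finally show "(\<integral>\<^sup>+ y\<in>{l..r}. (ennreal (1 / a) * h y) \<partial>lebesgue) \<le> ennreal (1 * (r - l))" .
qed

section \<open>From one level to the sum over all levels\<close>

context wavelet_system
begin

definition K where "K = 1216 * D\<^sup>2 + 10"

lemma K_pos: "K > 0"
  unfolding K_def by (intro add_nonneg_pos) auto

lemma sqV_cmult: "sqV F (\<lambda>x. a * f x) x = cmod a * sqV F f x"
  unfolding sqV_def by (subst L2_set_right_distrib) (auto simp: coef_cmult norm_mult mult.assoc)

text \<open>Both sides are homogeneous of degree one in \<open>f\<close> and in \<open>g\<close>, so
  dividing by \<open>a\<close> and \<open>b\<close> brings the averages to height one.\<close>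

lemma local_estimate_scaled:
  assumes f: "integrable lebesgue f" and g[measurable]: "g \<in> borel_measurable lebesgue"
    and F: "finite F" and J: "(j0, k0) \<in> F" and a: "a > 0" and b: "b > 0"
    and avgf: "\<And>j k. (j, k) \<in> F \<Longrightarrow> \<exists>x\<in>dyadic j k. avg_bound (\<lambda>x. ennreal (cmod (f x))) a x"
    and avg: "\<And>j k. (j, k) \<in> F \<Longrightarrow> \<exists>x\<in>dyadic j k. avg_bound g b x"
    and sub: "\<And>j k. (j, k) \<in> F \<Longrightarrow> dyadic j k \<subseteq> dyadic j0 k0"
  shows "(\<integral>\<^sup>+ x. ennreal (sqV F f x) * g x \<partial>lebesgue) \<le> ennreal (a * b * K) * ennreal (dlen j0)"
proof -
  have [measurable]: "f \<in> borel_measurable lebesgue" using f by simp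
  define f' where "f' x = complex_of_real (1 / a) * f x" for x
  define g' where "g' x = ennreal (1 / b) * g x" for x
  have f'eq: "ennreal (cmod (f' x)) = ennreal (1 / a) * ennreal (cmod (f x))" for x
    using a by (simp add: f'_def norm_mult norm_divide ennreal_mult [symmetric])
  have "(\<integral>\<^sup>+ x. ennreal (sqV F f' x) * g' x \<partial>lebesgue) \<le> ennreal ((1216 * D\<^sup>2 + 10) * dlen j0)"
  proof (rule local_estimate [OF _ _ F J _ _ sub])
    show "integrable lebesgue f'" unfolding f'_def by (intro integrable_mult_right f)
    show "g' \<in> borel_measurable lebesgue" unfolding g'_def by measurable
    fix j k assume "(j, k) \<in> F"
    from avgf [OF this] show "\<exists>x\<in>dyadic j k. avg_bound (\<lambda>x. ennreal (cmod (f' x))) 1 x"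
      unfolding f'eq using avg_bound_scale [OF _ a, of "\<lambda>x. ennreal (cmod (f x))"] by auto
  next
    fix j k assume "(j, k) \<in> F"
    from avg [OF this] show "\<exists>x\<in>dyadic j k. avg_bound g' 1 x"
      unfolding g'_def using avg_bound_scale [OF _ b g] by auto
  qed
  then have "ennreal (a * b) * (\<integral>\<^sup>+ x. ennreal (sqV F f' x) * g' x \<partial>lebesgue) \<le> ennreal (a * b) * ennreal (K * dlen j0)"
    unfolding K_def by (rule mult_left_mono) simp
  moreover have "(\<integral>\<^sup>+ x. ennreal (a * b) * (ennreal (sqV F f' x) * g' x) \<partial>lebesgue) =
      ennreal (a * b) * (\<integral>\<^sup>+ x. ennreal (sqV F f' x) * g' x \<partial>lebesgue)"
    by (rule nn_integral_cmult) (simp add: g'_def)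
  moreover have "ennreal (a * b) * (ennreal (sqV F f' x) * g' x) = ennreal (sqV F f x) * g x" for x
  proof -
    have "ennreal (a * b) * (ennreal (sqV F f' x) * g' x) = (ennreal (a * b) * (ennreal (cmod (complex_of_real (1 / a)) * sqV F f x) * ennreal (1 / b))) * g x"
      unfolding f'_def g'_def sqV_cmult by (simp only: mult_ac)
    also have "ennreal (a * b) * (ennreal (cmod (complex_of_real (1 / a)) * sqV F f x) * ennreal (1 / b)) = ennreal (sqV F f x)"
      using a b by (simp add: ennreal_mult [symmetric] norm_divide)
    finally show ?thesis .
  qed
  moreover have "ennreal (a * b) * ennreal (K * dlen j0) = ennreal (a * b * K) * ennreal (dlen j0)"
    using a b K_pos by (simp add: ennreal_mult [symmetric] mult_ac)
  ultimately show ?thesis by simp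
qed

text \<open>The intervals below one maximal interval cost a multiple of its length. The maximal
  intervals are disjoint, so their lengths add up to the measure of a subset of the union, a set on
  which the maximal functions will be large.\<close>

lemma level_estimate:
  assumes f: "integrable lebesgue f" and g: "g \<in> borel_measurable lebesgue"
    and F: "finite F" and a: "a > 0" and b: "b > 0"
    and avgf: "\<And>j k. (j, k) \<in> F \<Longrightarrow> \<exists>x\<in>dyadic j k. avg_bound (\<lambda>x. ennreal (cmod (f x))) a x"
    and avg: "\<And>j k. (j, k) \<in> F \<Longrightarrow> \<exists>x\<in>dyadic j k. avg_bound g b x"
  shows "(\<integral>\<^sup>+ x. ennreal (sqV F f x) * g x \<partial>lebesgue) \<le> ennreal (a * b * K) *
    (\<integral>\<^sup>+ x. indicator (\<Union>I\<in>F. dyadic (fst I) (snd I)) x \<partial>lebesgue)"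
proof -
  note [measurable] = g
  let ?d = "\<lambda>I. dyadic (fst I) (snd I)"
  obtain G where G: "G \<subseteq> F" "\<forall>I\<in>F. \<exists>J\<in>G. ?d I \<subseteq> ?d J"
    "\<forall>I\<in>G. \<forall>J\<in>G. I \<noteq> J \<longrightarrow> ?d I \<inter> ?d J = {}"
    using maximal_dyadic_exists [OF F] by (elim exE conjE)
  have finG: "finite G" using G(1) F finite_subset by blast
  define H where "H J = {I\<in>F. ?d I \<subseteq> ?d J}" for J
  have finH: "finite (H J)" for J using F by (simp add: H_def)
  have FH: "F = (\<Union>J\<in>G. H J)" using G(2) by (auto simp: H_def)
  have "(\<integral>\<^sup>+ x. ennreal (sqV F f x) * g x \<partial>lebesgue) \<le> (\<integral>\<^sup>+ x. (\<Sum>J\<in>G. ennreal (sqV (H J) f x) * g x) \<partial>lebesgue)"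
  proof (rule nn_integral_mono)
    fix x
    have "sqV F f x \<le> (\<Sum>J\<in>G. sqV (H J) f x)" by (subst FH) (intro sqV_UN finG finH)
    then have "ennreal (sqV F f x) \<le> (\<Sum>J\<in>G. ennreal (sqV (H J) f x))"
      by (subst sum_ennreal) (auto intro: ennreal_leI)
    then show "ennreal (sqV F f x) * g x \<le> (\<Sum>J\<in>G. ennreal (sqV (H J) f x) * g x)"
      unfolding sum_distrib_right [symmetric] by (rule mult_right_mono) simp
  qed
  also have "\<dots> = (\<Sum>J\<in>G. \<integral>\<^sup>+ x. ennreal (sqV (H J) f x) * g x \<partial>lebesgue)"
    by (rule nn_integral_sum) measurable
  also have "\<dots> \<le> (\<Sum>J\<in>G. ennreal (a * b * K) * ennreal (dlen (fst J)))"
  proof (rule sum_mono)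
    fix J assume J: "J \<in> G"
    show "(\<integral>\<^sup>+ x. ennreal (sqV (H J) f x) * g x \<partial>lebesgue) \<le> ennreal (a * b * K) * ennreal (dlen (fst J))"
      using J G(1) avgf avg
      by (intro local_estimate_scaled [OF f g finH _ a b, where ?k0.0 = "snd J"]) (auto simp: H_def)
  qed
  also have "\<dots> = ennreal (a * b * K) * (\<Sum>J\<in>G. \<integral>\<^sup>+ x. indicator (?d J) x \<partial>lebesgue)"
    unfolding sum_distrib_left by simp
  also have "(\<Sum>J\<in>G. \<integral>\<^sup>+ x. indicator (?d J) x \<partial>lebesgue) = (\<integral>\<^sup>+ x. (\<Sum>J\<in>G. indicator (?d J) x) \<partial>lebesgue)"
    by (rule nn_integral_sum [symmetric]) measurable
  also have "\<dots> \<le> (\<integral>\<^sup>+ x. indicator (\<Union>I\<in>F. ?d I) x \<partial>lebesgue)"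
  proof (rule nn_integral_mono)
    fix x
    have "disjoint_family_on ?d G" using G(3) by (auto simp: disjoint_family_on_def)
    then have "(\<Sum>J\<in>G. indicator (?d J) x :: ennreal) = indicator (\<Union>J\<in>G. ?d J) x"
      using finG by (intro indicator_UN_disjoint [symmetric]) auto
    also have "\<dots> \<le> indicator (\<Union>I\<in>F. ?d I) x" using G(1) by (auto split: split_indicator)
    finally show "(\<Sum>J\<in>G. indicator (?d J) x :: ennreal) \<le> indicator (\<Union>I\<in>F. ?d I) x" .
  qed
  finally show ?thesis by (simp add: mult_left_mono)
qed

text \<open>Averages that become arbitrarily small at points of one interval drive the bound for a
  single wavelet to zero. This disposes of the intervals to which no dyadic level can be
  assigned.\<close>

lemma nn_integral_psi_eq_0:
  assumes [measurable]: "h \<in> borel_measurable lebesgue"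
    and "\<And>e. e > 0 \<Longrightarrow> \<exists>x\<in>dyadic (fst I) (snd I). avg_bound h e x"
  shows "(\<integral>\<^sup>+ x. h x * apsi I x \<partial>lebesgue) = 0"
proof -
  let ?c = "8 * D * 2 powr - (real_of_int (fst I) / 2)"
  have le: "(\<integral>\<^sup>+ x. h x * apsi I x \<partial>lebesgue) \<le> ennreal e" if "e > 0" for e :: real
  proof -
    have c: "?c \<ge> 0" using D_nonneg by simp
    \<comment> \<open>The summand \<open>1\<close> keeps the denominator positive, since
      \<open>D\<close> may be \<open>0\<close>.\<close>
    then have "e / (?c + 1) > 0" using that by (intro divide_pos_pos) auto
    then obtain x where "x \<in> dyadic (fst I) (snd I)" "avg_bound h (e / (?c + 1)) x" using assms(2) by blast
    then have "(\<integral>\<^sup>+ x. h x * apsi I x \<partial>lebesgue) \<le> ennreal (8 * (e / (?c + 1)) * D * 2 powr - (real_of_int (fst I) / 2))"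
      using \<open>e / (?c + 1) > 0\<close> by (intro nn_integral_psi_le) auto
    also have "8 * (e / (?c + 1)) * D * 2 powr - (real_of_int (fst I) / 2) = e * (?c / (?c + 1))" by simp
    also have "ennreal (e * (?c / (?c + 1))) \<le> ennreal (e * 1)"
      using c that by (intro ennreal_leI mult_left_mono) auto
    finally show ?thesis by simp
  qed
  have "(\<integral>\<^sup>+ x. h x * apsi I x \<partial>lebesgue) \<le> 0"
    by (rule ennreal_le_epsilon) (simp only: add_0 le)
  then show ?thesis by (simp only: le_zero_eq)
qed

text \<open>On an interval of level \<open>(n, m)\<close> the two maximal functions are at least
  \<open>2 powr n\<close> and \<open>2 powr m\<close>, and each is at most twice as large at some
  point; the two factors \<open>2\<close> turn \<open>K\<close> into \<open>4 * K\<close>. Summing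
  over levels costs a further factor \<open>2\<close> for each maximal function. The bound
  \<open>B\<close> keeps the infima finite, so that levels exist.\<close>

lemma bilinear_estimate:
  assumes f: "integrable lebesgue f" and g[measurable]: "g \<in> borel_measurable lebesgue"
    and fB: "\<And>x. cmod (f x) \<le> B" and gB: "\<And>x. cmod (g x) \<le> B" and F: "finite F"
  shows "(\<integral>\<^sup>+ x. ennreal (sqV F f x) * ennreal (cmod (g x)) \<partial>lebesgue) \<le>
     ennreal (16 * K) * (\<integral>\<^sup>+ x. maximal_op f x * maximal_op g x \<partial>lebesgue)"
proof -
  let ?d = "\<lambda>I. dyadic (fst I) (snd I)"
  have [measurable]: "f \<in> borel_measurable lebesgue" using f by simp
  \<comment> \<open>These are the intervals on which the infimum of the maximal function is zero, so
    that its logarithm is meaningless.\<close>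
  define deg where "deg h I \<longleftrightarrow> (\<forall>e>0. \<exists>x\<in>?d I. maximal_op h x < ennreal e)" for h I
  define F0 F1 where "F0 = {I\<in>F. deg f I \<or> deg g I}" and "F1 = {I\<in>F. \<not> deg f I \<and> \<not> deg g I}"
  have fin: "finite F0" "finite F1" using F by (auto simp: F0_def F1_def)
  have F_eq: "F = F0 \<union> F1" by (auto simp: F0_def F1_def)
  have degD: "(\<integral>\<^sup>+ x. ennreal (cmod (h x)) * apsi I x \<partial>lebesgue) = 0"
    if [measurable]: "h \<in> borel_measurable lebesgue" and deg: "deg h I" for h I
  proof (rule nn_integral_psi_eq_0)
    fix e :: real assume "e > 0"
    then obtain x where "x \<in> ?d I" "maximal_op h x < ennreal e" using deg by (auto simp: deg_def)
    then show "\<exists>x\<in>?d I. avg_bound (\<lambda>x. ennreal (cmod (h x))) e x"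
      using \<open>e > 0\<close> by (intro bexI maximal_op_avg_bound) auto
  qed measurable
  have zero: "(\<integral>\<^sup>+ x. ennreal (sqV F0 f x) * ennreal (cmod (g x)) \<partial>lebesgue) = 0"
  proof -
    have "(\<integral>\<^sup>+ x. ennreal (sqV F0 f x) * ennreal (cmod (g x)) \<partial>lebesgue) \<le>
      (\<Sum>I\<in>F0. ennreal (cmod (coef f I)) * (\<integral>\<^sup>+ x. ennreal (cmod (g x)) * apsi I x \<partial>lebesgue))"
      by (rule nn_integral_sqV_le) measurable
    also have "\<dots> = 0"
    proof (rule sum.neutral, rule ballI)
      fix I assume "I \<in> F0"
      then consider "deg f I" | "deg g I" by (auto simp: F0_def)
      then show "ennreal (cmod (coef f I)) * (\<integral>\<^sup>+ x. ennreal (cmod (g x)) * apsi I x \<partial>lebesgue) = 0"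
      proof cases
        case 1
        have "ennreal (cmod (coef f I)) \<le> 0" using coef_le [of f I] degD [of f, OF _ 1] by simp
        then show ?thesis by simp
      next
        case 2
        then show ?thesis using degD [of g, OF _ 2] by simp
      qed
    qed
    finally show ?thesis by simp
  qed
  have lev: "\<exists>n::int. (\<forall>x\<in>?d I. ennreal (2 powr n) \<le> maximal_op h x) \<and> (\<exists>x\<in>?d I. maximal_op h x \<le> ennreal (2 * 2 powr n))"
    if "\<not> deg h I" "\<And>x. cmod (h x) \<le> B" for h I
  proof -
    have "\<exists>e>0. \<forall>x\<in>?d I. ennreal e \<le> maximal_op h x"
      using that(1) by (auto simp: deg_def not_less)
    then obtain e where e: "e > 0" "\<And>x. x \<in> ?d I \<Longrightarrow> ennreal e \<le> maximal_op h x"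
      by blast
    show ?thesis by (rule dyadic_level [OF e dyadic_nonempty maximal_op_bounded [OF that(2)]])
  qed
  obtain n where n: "\<And>I. I \<in> F1 \<Longrightarrow> (\<forall>x\<in>?d I. ennreal (2 powr real_of_int (n I)) \<le> maximal_op f x) \<and> (\<exists>x\<in>?d I. maximal_op f x \<le> ennreal (2 * 2 powr n I))"
    using lev [of f, OF _ fB] unfolding F1_def by (simp, metis)
  obtain m where m: "\<And>I. I \<in> F1 \<Longrightarrow> (\<forall>x\<in>?d I. ennreal (2 powr real_of_int (m I)) \<le> maximal_op g x) \<and> (\<exists>x\<in>?d I. maximal_op g x \<le> ennreal (2 * 2 powr m I))"
    using lev [of g, OF _ gB] unfolding F1_def by (simp, metis)
  define L where "L = (\<lambda>I. (n I, m I)) ` F1"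
  define H where "H l = {I\<in>F1. (n I, m I) = l}" for l
  have finL: "finite L" using fin by (simp add: L_def)
  have finH: "finite (H l)" for l using fin by (simp add: H_def)
  have F1_eq: "F1 = (\<Union>l\<in>L. H l)" by (auto simp: L_def H_def)
  let ?U = "\<lambda>l. \<Union>I\<in>H l. ?d I"
  have UM[measurable]: "?U l \<in> sets lebesgue" for l
    using finH by (intro sets.finite_UN) auto
  have "sqV F f x \<le> sqV F0 f x + (\<Sum>l\<in>L. sqV (H l) f x)" for x
  proof -
    have "sqV F1 f x \<le> (\<Sum>l\<in>L. sqV (H l) f x)" by (subst F1_eq) (intro sqV_UN finL finH)
    then show ?thesis using sqV_Un [OF fin, of f x] unfolding F_eq by simp
  qed
  then have V: "ennreal (sqV F f x) \<le> ennreal (sqV F0 f x) + (\<Sum>l\<in>L. ennreal (sqV (H l) f x))" for x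
    by (subst sum_ennreal, simp, subst ennreal_plus [symmetric]) (auto intro: ennreal_leI sum_nonneg)
  have "(\<integral>\<^sup>+ x. ennreal (sqV F f x) * ennreal (cmod (g x)) \<partial>lebesgue) \<le>
    (\<integral>\<^sup>+ x. ennreal (sqV F0 f x) * ennreal (cmod (g x)) + (\<Sum>l\<in>L. ennreal (sqV (H l) f x) * ennreal (cmod (g x))) \<partial>lebesgue)"
    unfolding sum_distrib_right [symmetric] distrib_right [symmetric]
    by (intro nn_integral_mono mult_right_mono V) auto
  also have "\<dots> = (\<integral>\<^sup>+ x. ennreal (sqV F0 f x) * ennreal (cmod (g x)) \<partial>lebesgue) +
     (\<Sum>l\<in>L. \<integral>\<^sup>+ x. ennreal (sqV (H l) f x) * ennreal (cmod (g x)) \<partial>lebesgue)"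
    by (subst nn_integral_add, measurable, subst nn_integral_sum, measurable)
  also have "\<dots> = (\<Sum>l\<in>L. \<integral>\<^sup>+ x. ennreal (sqV (H l) f x) * ennreal (cmod (g x)) \<partial>lebesgue)"
    by (simp add: zero)
  also have "\<dots> \<le> (\<Sum>l\<in>L. ennreal (4 * K) * (\<integral>\<^sup>+ x. ennreal (2 powr fst l) * ennreal (2 powr snd l) * indicator (?U l) x \<partial>lebesgue))"
  proof (rule sum_mono)
    fix l :: "int \<times> int"
    have "(\<integral>\<^sup>+ x. ennreal (sqV (H l) f x) * ennreal (cmod (g x)) \<partial>lebesgue) \<le>
      ennreal ((2 * 2 powr real_of_int (fst l)) * (2 * 2 powr real_of_int (snd l)) * K) * (\<integral>\<^sup>+ x. indicator (?U l) x \<partial>lebesgue)"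
    proof (rule level_estimate [OF f _ finH])
      fix j k assume jk: "(j, k) \<in> H l"
      then have "(j, k) \<in> F1" and nm: "n (j, k) = fst l" "m (j, k) = snd l" by (auto simp: H_def)
      show "\<exists>x\<in>dyadic j k. avg_bound (\<lambda>x. ennreal (cmod (f x))) (2 * 2 powr real_of_int (fst l)) x"
        using n [OF \<open>(j, k) \<in> F1\<close>] maximal_op_avg_bound [of f] unfolding nm by fastforce
      show "\<exists>x\<in>dyadic j k. avg_bound (\<lambda>x. ennreal (cmod (g x))) (2 * 2 powr real_of_int (snd l)) x"
        using m [OF \<open>(j, k) \<in> F1\<close>] maximal_op_avg_bound [of g] unfolding nm by fastforce
    qed auto
    also have "ennreal ((2 * 2 powr real_of_int (fst l)) * (2 * 2 powr real_of_int (snd l)) * K) =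
       ennreal (4 * K) * (ennreal (2 powr real_of_int (fst l)) * ennreal (2 powr real_of_int (snd l)))"
      using K_pos by (subst ennreal_mult [symmetric], simp, simp, subst ennreal_mult [symmetric]) (auto simp: mult_ac)
    also have "\<dots> * (\<integral>\<^sup>+ x. indicator (?U l) x \<partial>lebesgue) =
      ennreal (4 * K) * (\<integral>\<^sup>+ x. ennreal (2 powr real_of_int (fst l)) * ennreal (2 powr real_of_int (snd l)) * indicator (?U l) x \<partial>lebesgue)"
      using UM by (subst nn_integral_cmult) (auto simp: mult.assoc)
    finally show "(\<integral>\<^sup>+ x. ennreal (sqV (H l) f x) * ennreal (cmod (g x)) \<partial>lebesgue) \<le>
      ennreal (4 * K) * (\<integral>\<^sup>+ x. ennreal (2 powr real_of_int (fst l)) * ennreal (2 powr real_of_int (snd l)) * indicator (?U l) x \<partial>lebesgue)" .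
  qed
  also have "\<dots> = ennreal (4 * K) * (\<integral>\<^sup>+ x. (\<Sum>l\<in>L. ennreal (2 powr fst l) * ennreal (2 powr snd l) * indicator (?U l) x) \<partial>lebesgue)"
    using UM by (subst nn_integral_sum) (auto simp: sum_distrib_left)
  also have "\<dots> \<le> ennreal (4 * K) * (\<integral>\<^sup>+ x. 4 * (maximal_op f x * maximal_op g x) \<partial>lebesgue)"
  proof (intro mult_left_mono nn_integral_mono)
    fix x
    define tf where "tf i = (if ennreal (2 powr real_of_int i) \<le> maximal_op f x then ennreal (2 powr i) else 0)" for i :: int
    define tg where "tg i = (if ennreal (2 powr real_of_int i) \<le> maximal_op g x then ennreal (2 powr i) else 0)" for i :: int
    have "(\<Sum>l\<in>L. ennreal (2 powr real_of_int (fst l)) * ennreal (2 powr real_of_int (snd l)) * indicator (?U l) x) \<le> (\<Sum>l\<in>L. tf (fst l) * tg (snd l))"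
    proof (rule sum_mono)
      fix l
      show "ennreal (2 powr real_of_int (fst l)) * ennreal (2 powr real_of_int (snd l)) * indicator (?U l) x \<le> tf (fst l) * tg (snd l)"
      proof (cases "x \<in> ?U l")
        case True
        then obtain I where "I \<in> F1" "n I = fst l" "m I = snd l" "x \<in> ?d I" by (auto simp: H_def)
        then have "ennreal (2 powr real_of_int (fst l)) \<le> maximal_op f x" "ennreal (2 powr real_of_int (snd l)) \<le> maximal_op g x"
          using n [of I] m [of I] by auto
        then show ?thesis using True by (simp only: tf_def tg_def if_True indicator_simps mult_1_right order_refl)
      qed simp
    qed
    \<comment> \<open>Enlarging \<open>L\<close> to the product of its projections lets the double
      sum factor into one geometric sum for each maximal function.\<close>
    also have "\<dots> \<le> (\<Sum>l\<in>fst ` L \<times> snd ` L. tf (fst l) * tg (snd l))"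
      using finL by (intro sum_mono2) (force simp: image_iff)+
    also have "\<dots> = (\<Sum>i\<in>fst ` L. tf i) * (\<Sum>i\<in>snd ` L. tg i)"
      by (simp add: sum_product sum.cartesian_product split_beta)
    also have "\<dots> \<le> (2 * maximal_op f x) * (2 * maximal_op g x)"
      unfolding tf_def tg_def using finL by (intro mult_mono sum_dyadic_levels_le) auto
    also have "\<dots> = 4 * (maximal_op f x * maximal_op g x)"
    proof -
      have "(2 * maximal_op f x) * (2 * maximal_op g x) = (2 * 2) * (maximal_op f x * maximal_op g x)" by (simp only: mult_ac)
      then show ?thesis by simp
    qed
    finally show "(\<Sum>l\<in>L. ennreal (2 powr real_of_int (fst l)) * ennreal (2 powr real_of_int (snd l)) * indicator (?U l) x) \<le> 4 * (maximal_op f x * maximal_op g x)" .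
  qed auto
  also have "\<dots> = ennreal (4 * K) * (ennreal 4 * (\<integral>\<^sup>+ x. maximal_op f x * maximal_op g x \<partial>lebesgue))"
    by (subst nn_integral_cmult) auto
  also have "\<dots> = ennreal (16 * K) * (\<integral>\<^sup>+ x. maximal_op f x * maximal_op g x \<partial>lebesgue)"
    using K_pos by (subst mult.assoc [symmetric], subst ennreal_mult [symmetric]) (auto simp: mult.commute)
  finally show ?thesis .
qed

end

section \<open>Banach function norms and duality\<close>

lemma integrable_bounded_support:
  fixes v :: "real \<Rightarrow> real"
  assumes "v \<in> borel_measurable lebesgue" "\<And>x. \<bar>v x\<bar> \<le> B * indicator {-n..n} x"
  shows "integrable lebesgue v"
proof (rule Bochner_Integration.integrable_bound)
  show "integrable lebesgue (\<lambda>x. B * indicator {-n..n} x :: real)"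
    by (intro integrable_mult_right integrable_real_indicator) (auto simp: emeasure_lborel_Icc_eq)
  show "AE x in lebesgue. norm (v x) \<le> norm (B * indicator {-n..n} x :: real)"
    using order_trans [OF assms(2) abs_ge_self] by auto
qed fact

locale bfn =
  fixes \<rho> :: bfnorm
  assumes bfn: "banach_function_norm \<rho>"
begin

lemma rho_eq_0_iff: "f \<in> borel_measurable lebesgue \<Longrightarrow> \<rho> f = 0 \<longleftrightarrow> (AE x in lebesgue. f x = 0)"
  using bfn unfolding banach_function_norm_def by simp

lemma rho_cmult: "f \<in> borel_measurable lebesgue \<Longrightarrow> c \<ge> 0 \<Longrightarrow> \<rho> (\<lambda>x. ennreal c * f x) = ennreal c * \<rho> f"
  using bfn unfolding banach_function_norm_def by simp

lemma rho_add: "f \<in> borel_measurable lebesgue \<Longrightarrow> g \<in> borel_measurable lebesgue \<Longrightarrow>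
    \<rho> (\<lambda>x. f x + g x) \<le> \<rho> f + \<rho> g"
  using bfn unfolding banach_function_norm_def by simp

lemma rho_mono_AE: "f \<in> borel_measurable lebesgue \<Longrightarrow> g \<in> borel_measurable lebesgue \<Longrightarrow>
    AE x in lebesgue. g x \<le> f x \<Longrightarrow> \<rho> g \<le> \<rho> f"
  using bfn unfolding banach_function_norm_def by simp

lemma rho_mono: "f \<in> borel_measurable lebesgue \<Longrightarrow> g \<in> borel_measurable lebesgue \<Longrightarrow>
    (\<And>x. g x \<le> f x) \<Longrightarrow> \<rho> g \<le> \<rho> f"
  by (rule rho_mono_AE) auto

lemma rho_incseq:
  assumes "\<And>n. fs n \<in> borel_measurable lebesgue" "f \<in> borel_measurable lebesgue"
    and "\<And>x. incseq (\<lambda>n. fs n x)" "\<And>x. (\<lambda>n. fs n x) \<longlonglongrightarrow> f x"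
  shows "(\<lambda>n. \<rho> (fs n)) \<longlonglongrightarrow> \<rho> f"
proof -
  have "\<forall>fs f. (\<forall>n. fs n \<in> borel_measurable lebesgue) \<longrightarrow> f \<in> borel_measurable lebesgue \<longrightarrow>
        (AE x in lebesgue. incseq (\<lambda>n. fs n x) \<and> (\<lambda>n. fs n x) \<longlonglongrightarrow> f x) \<longrightarrow>
        (\<lambda>n. \<rho> (fs n)) \<longlonglongrightarrow> \<rho> f"
    using bfn unfolding banach_function_norm_def by (elim conjE)
  then show ?thesis using assms by (elim allE [of _ fs] allE [of _ f]) auto
qed

lemma rho_indicator: "E \<in> sets lebesgue \<Longrightarrow> emeasure lebesgue E < \<infinity> \<Longrightarrow> \<rho> (indicator E) < \<infinity>"
  using bfn unfolding banach_function_norm_def by simp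

text \<open>The infima over tails of the sequence increase to the lower limit and stay below the
  functions themselves, so the monotone property of the norm applies to them.\<close>

lemma rho_Fatou:
  assumes [measurable]: "\<And>n. fs n \<in> borel_measurable lebesgue" and "\<And>n. \<rho> (fs n) \<le> A"
  shows "\<rho> (\<lambda>x. liminf (\<lambda>n. fs n x)) \<le> A"
proof -
  define u where "u n x = (INF m\<in>{n..}. fs m x)" for n x
  have [measurable]: "u n \<in> borel_measurable lebesgue" for n unfolding u_def by measurable
  have "(\<lambda>n. \<rho> (u n)) \<longlonglongrightarrow> \<rho> (\<lambda>x. liminf (\<lambda>n. fs n x))"
  proof (rule rho_incseq)
    show inc: "incseq (\<lambda>n. u n x)" for x
      unfolding u_def by (intro incseq_SucI INF_superset_mono) auto
    show "(\<lambda>n. u n x) \<longlonglongrightarrow> liminf (\<lambda>n. fs n x)" for x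
      using LIMSEQ_SUP [OF inc [of x]] by (simp add: u_def liminf_SUP_INF)
  qed measurable
  moreover have "\<rho> (u n) \<le> A" for n
  proof -
    have "\<rho> (u n) \<le> \<rho> (fs n)" unfolding u_def by (intro rho_mono INF_lower) auto
    then show ?thesis using assms(2) order_trans by blast
  qed
  ultimately show ?thesis by (intro LIMSEQ_le_const2) auto
qed

text \<open>After division by \<open>\<rho> f\<close> the first factor is admissible in the supremum
  that defines the associate norm. If \<open>\<rho> f = 0\<close> the product vanishes almost
  everywhere, in accordance with the right-hand side being \<open>0\<close> even for an infinite
  associate norm.\<close>

lemma Hoelder:
  assumes f[measurable]: "f \<in> borel_measurable lebesgue" and g[measurable]: "g \<in> borel_measurable lebesgue"
    and fin: "\<rho> f < \<infinity>"
  shows "(\<integral>\<^sup>+ x. f x * g x \<partial>lebesgue) \<le> \<rho> f * assoc_norm \<rho> g"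
proof (cases "\<rho> f = 0")
  case True
  then have "AE x in lebesgue. f x * g x = 0" using rho_eq_0_iff [OF f] by auto
  then have "(\<integral>\<^sup>+ x. f x * g x \<partial>lebesgue) = 0" by (subst nn_integral_0_iff_AE) auto
  then show ?thesis by simp
next
  case False
  obtain c where c: "\<rho> f = ennreal c" "c \<ge> 0" using fin by (cases "\<rho> f") auto
  with False have c0: "c > 0" by (cases "c = 0") auto
  define f' where "f' x = ennreal (1 / c) * f x" for x
  have [measurable]: "f' \<in> borel_measurable lebesgue" unfolding f'_def by measurable
  have "\<rho> f' = 1" unfolding f'_def using c c0 by (subst rho_cmult) (auto simp: ennreal_mult [symmetric])
  then have "(\<integral>\<^sup>+ x. f' x * g x \<partial>lebesgue) \<le> assoc_norm \<rho> g"
    unfolding assoc_norm_def by (intro SUP_upper) auto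
  then have "ennreal c * (\<integral>\<^sup>+ x. f' x * g x \<partial>lebesgue) \<le> ennreal c * assoc_norm \<rho> g" by (rule mult_left_mono) simp
  moreover have "ennreal c * (\<integral>\<^sup>+ x. f' x * g x \<partial>lebesgue) = (\<integral>\<^sup>+ x. ennreal c * (f' x * g x) \<partial>lebesgue)"
    by (rule nn_integral_cmult [symmetric]) measurable
  moreover have "ennreal c * (f' x * g x) = f x * g x" for x
    using c0 by (simp add: f'_def mult.assoc [symmetric] ennreal_mult [symmetric])
  ultimately show ?thesis using c by simp
qed

lemma rho_convex:
  assumes [measurable]: "u \<in> borel_measurable lebesgue" "v \<in> borel_measurable lebesgue"
    and "\<And>x. 0 \<le> u x" "\<And>x. 0 \<le> v x" "\<rho> (\<lambda>x. ennreal (u x)) \<le> 1" "\<rho> (\<lambda>x. ennreal (v x)) \<le> 1" "0 \<le> t" "t \<le> 1"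
  shows "\<rho> (\<lambda>x. ennreal ((1 - t) * u x + t * v x)) \<le> 1"
proof -
  have "(\<lambda>x. ennreal ((1 - t) * u x + t * v x)) = (\<lambda>x. ennreal (1 - t) * ennreal (u x) + ennreal t * ennreal (v x))"
    using assms by (auto simp: fun_eq_iff ennreal_mult [symmetric])
  then have "\<rho> (\<lambda>x. ennreal ((1 - t) * u x + t * v x)) \<le>
      \<rho> (\<lambda>x. ennreal (1 - t) * ennreal (u x)) + \<rho> (\<lambda>x. ennreal t * ennreal (v x))"
    by (simp add: rho_add)
  also have "\<dots> = ennreal (1 - t) * \<rho> (\<lambda>x. ennreal (u x)) + ennreal t * \<rho> (\<lambda>x. ennreal (v x))"
    using assms by (simp add: rho_cmult)
  also have "\<dots> \<le> ennreal (1 - t) * 1 + ennreal t * 1" by (intro add_mono mult_left_mono assms) auto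
  also have "\<dots> = 1" using assms by (simp add: ennreal_plus [symmetric] del: ennreal_plus)
  finally show ?thesis .
qed

text \<open>The \<open>L\<^sup>2\<close>-distance from a bounded function to the unit ball is attained: a minimizing
  sequence is Cauchy by the parallelogram law, and the unit ball is closed by the Fatou property.\<close>

lemma nearest_point_exists:
  fixes f :: "real \<Rightarrow> real"
  assumes f[measurable]: "f \<in> borel_measurable lebesgue" and f0: "\<And>x. 0 \<le> f x"
    and fB: "\<And>x. f x \<le> B * indicator {-n..n} x" and B: "B \<ge> 0" "n > 0"
  shows "\<exists>u\<in>borel_measurable lebesgue. (\<forall>x. 0 \<le> u x \<and> u x \<le> f x) \<and> \<rho> (\<lambda>x. ennreal (u x)) \<le> 1 \<and>
    (\<forall>v\<in>borel_measurable lebesgue. (\<forall>x. 0 \<le> v x \<and> v x \<le> f x) \<longrightarrow> \<rho> (\<lambda>x. ennreal (v x)) \<le> 1 \<longrightarrow>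
      (\<integral>x. (f x - u x)\<^sup>2 \<partial>lebesgue) \<le> (\<integral>x. (f x - v x)\<^sup>2 \<partial>lebesgue))"
proof -
  define V where "V = {u \<in> borel_measurable lebesgue. (\<forall>x. 0 \<le> u x \<and> u x \<le> f x) \<and> \<rho> (\<lambda>x. ennreal (u x)) \<le> 1}"
  define q where "q u = (\<integral>x. (f x - u x)\<^sup>2 \<partial>lebesgue)" for u :: "real \<Rightarrow> real"
  define d where "d = Inf (q ` V)"
  have Vm [measurable_dest]: "u \<in> borel_measurable lebesgue" if "u \<in> V" for u using that by (simp add: V_def)
  have Vb: "0 \<le> u x" "u x \<le> f x" if "u \<in> V" for u x using that by (auto simp: V_def)
  have sqint: "integrable lebesgue (\<lambda>x. (a x)\<^sup>2)" if [measurable]: "a \<in> borel_measurable lebesgue" and ab: "\<And>x. \<bar>a x\<bar> \<le> f x" for a :: "real \<Rightarrow> real"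
  proof (rule integrable_bounded_support)
    fix x
    have "\<bar>a x\<bar> \<le> B * indicator {-n..n} x" using ab fB order_trans by blast
    then have "\<bar>a x\<bar>\<^sup>2 \<le> (B * indicator {-n..n} x)\<^sup>2" by (intro power_mono) auto
    also have "\<dots> = B\<^sup>2 * indicator {-n..n} x" by (auto split: split_indicator)
    finally show "\<bar>(a x)\<^sup>2\<bar> \<le> B\<^sup>2 * indicator {-n..n} x" by simp
  qed measurable
  have diff_int: "integrable lebesgue (\<lambda>x. (f x - u x)\<^sup>2)" if "u \<in> V" for u
  proof (rule sqint)
    show "(\<lambda>x. f x - u x) \<in> borel_measurable lebesgue" using Vm [OF that] by measurable
    show "\<bar>f x - u x\<bar> \<le> f x" for x using Vb [OF that, of x] by simp
  qed
  have diff2_int: "integrable lebesgue (\<lambda>x. (u x - v x)\<^sup>2)" if "u \<in> V" "v \<in> V" for u v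
  proof (rule sqint)
    show "(\<lambda>x. u x - v x) \<in> borel_measurable lebesgue" using Vm [OF that(1)] Vm [OF that(2)] by measurable
    show "\<bar>u x - v x\<bar> \<le> f x" for x using Vb [OF that(1), of x] Vb [OF that(2), of x] by linarith
  qed
  have "(\<lambda>x. 0) \<in> V"
  proof -
    have "\<rho> (\<lambda>x. 0) = 0" by (subst rho_eq_0_iff) auto
    then show ?thesis using f0 by (simp add: V_def)
  qed
  then have Vne: "q ` V \<noteq> {}" by blast
  have bdd: "bdd_below (q ` V)" by (rule bdd_belowI [of _ 0]) (auto simp: q_def)
  have dle: "d \<le> q u" if "u \<in> V" for u unfolding d_def using that bdd by (intro cInf_lower) auto
  \<comment> \<open>The rate \<open>1/8\<close> is chosen so fast that successive differences have
    integrals of order \<open>(1/2) ^ k\<close>; the minimizing sequence itself then converges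
    almost everywhere.\<close>
  have "\<exists>u\<in>V. q u < d + (1/8) ^ k" for k
  proof -
    have "Inf (q ` V) < d + (1/8) ^ k" by (simp add: d_def)
    then show ?thesis using cInf_lessD [OF Vne] by blast
  qed
  then obtain u where u: "\<And>k. u k \<in> V" "\<And>k. q (u k) < d + (1/8) ^ k" by metis
  have um [measurable]: "u k \<in> borel_measurable lebesgue" for k using Vm u(1) by blast
  have step: "(\<integral>x. (u k x - u (Suc k) x)\<^sup>2 \<partial>lebesgue) \<le> 4 * (1/8) ^ k" for k
  proof -
    define w where "w x = (1 - 1/2) * u k x + 1/2 * u (Suc k) x" for x
    have wV: "w \<in> V"
    proof -
      have "\<rho> (\<lambda>x. ennreal (w x)) \<le> 1"
        unfolding w_def
      proof (rule rho_convex [OF um um])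
        show "\<rho> (\<lambda>x. ennreal (u k x)) \<le> 1" "\<rho> (\<lambda>x. ennreal (u (Suc k) x)) \<le> 1"
          using u(1) [of k] u(1) [of "Suc k"] by (simp_all add: V_def)
      qed (use Vb [OF u(1)] in simp_all)
      moreover have "0 \<le> w x \<and> w x \<le> f x" for x
        using Vb [OF u(1), of k x] Vb [OF u(1), of "Suc k" x] by (simp add: w_def)
      moreover have "w \<in> borel_measurable lebesgue" unfolding w_def by measurable
      ultimately show ?thesis by (simp add: V_def)
    qed
    have e: "(u k x - u (Suc k) x)\<^sup>2 = 2 * (f x - u k x)\<^sup>2 + 2 * (f x - u (Suc k) x)\<^sup>2 - 4 * (f x - w x)\<^sup>2" for x
      by (simp add: w_def power2_eq_square field_simps)
    have "(\<integral>x. (u k x - u (Suc k) x)\<^sup>2 \<partial>lebesgue) = 2 * q (u k) + 2 * q (u (Suc k)) - 4 * q w"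
      unfolding e q_def using diff_int [OF u(1)] diff_int [OF wV] by simp
    also have "\<dots> \<le> 2 * (d + (1/8) ^ k) + 2 * (d + (1/8) ^ Suc k) - 4 * d"
      by (intro diff_mono add_mono mult_left_mono less_imp_le [OF u(2)] dle [OF wV]) auto
    also have "\<dots> \<le> 4 * (1/8) ^ k" by simp
    finally show ?thesis .
  qed
  have step1: "(\<integral>\<^sup>+ x. ennreal \<bar>u k x - u (Suc k) x\<bar> \<partial>lebesgue) \<le> ennreal ((2 * n + 4) * (1/2) ^ k)" for k
  proof -
    have int: "integrable lebesgue (\<lambda>x. (1/2) ^ k * indicator {-n..n} x + 2 ^ k * (u k x - u (Suc k) x)\<^sup>2 :: real)"
      by (intro Bochner_Integration.integrable_add integrable_mult_right diff2_int u(1) integrable_real_indicator)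
        (auto simp: emeasure_lborel_Icc_eq)
    have "(\<integral>\<^sup>+ x. ennreal \<bar>u k x - u (Suc k) x\<bar> \<partial>lebesgue) \<le>
      (\<integral>\<^sup>+ x. ennreal ((1/2) ^ k * indicator {-n..n} x + 2 ^ k * (u k x - u (Suc k) x)\<^sup>2) \<partial>lebesgue)"
    proof (intro nn_integral_mono ennreal_leI)
      fix x
      define t where "t = \<bar>u k x - u (Suc k) x\<bar>"
      have t2: "(u k x - u (Suc k) x)\<^sup>2 = t\<^sup>2" by (simp add: t_def)
      show "\<bar>u k x - u (Suc k) x\<bar> \<le> (1/2) ^ k * indicator {-n..n} x + 2 ^ k * (u k x - u (Suc k) x)\<^sup>2"
      proof (cases "x \<in> {-n..n}")
        case True
        \<comment> \<open>Passage from square integrals to integrals: either \<open>t\<close> is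
          below the threshold \<open>(1/2) ^ k\<close>, or \<open>2 ^ k * t \<ge> 1\<close> and
          multiplication by \<open>t\<close> gives the quadratic term.\<close>
        have "t \<le> (1/2) ^ k + 2 ^ k * t\<^sup>2"
        proof (cases "t \<le> (1/2) ^ k")
          case False
          then have "1 \<le> 2 ^ k * t" by (simp add: field_simps power_one_over)
          then have "1 * t \<le> 2 ^ k * t * t" by (intro mult_right_mono) (auto simp: t_def)
          moreover have "(0::real) \<le> (1/2) ^ k" by simp
          ultimately show ?thesis unfolding power2_eq_square mult.assoc mult_1_left by (rule add_increasing [rotated])
        qed (simp add: add_increasing2)
        then show ?thesis using True by (simp only: t2 t_def [symmetric] indicator_simps mult_1_right)
      next
        case False
        then have "f x \<le> 0" using fB [of x] by simp
        then have "u k x = 0" "u (Suc k) x = 0" using Vb [OF u(1), of k x] Vb [OF u(1), of "Suc k" x] by linarith+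
        then show ?thesis using False by simp
      qed
    qed
    also have "\<dots> = ennreal (\<integral>x. (1/2) ^ k * indicator {-n..n} x + 2 ^ k * (u k x - u (Suc k) x)\<^sup>2 \<partial>lebesgue)"
      by (rule nn_integral_eq_integral [OF int]) auto
    also have "(\<integral>x. (1/2) ^ k * indicator {-n..n} x + 2 ^ k * (u k x - u (Suc k) x)\<^sup>2 \<partial>lebesgue) =
       (1/2) ^ k * (2 * n) + 2 ^ k * (\<integral>x. (u k x - u (Suc k) x)\<^sup>2 \<partial>lebesgue)"
    proof -
      have "integrable lebesgue (\<lambda>x. (1/2) ^ k * indicator {-n..n} x :: real)"
        by (intro integrable_mult_right integrable_real_indicator) (auto simp: emeasure_lborel_Icc_eq)
      moreover have "integrable lebesgue (\<lambda>x. 2 ^ k * (u k x - u (Suc k) x)\<^sup>2)"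
        by (intro integrable_mult_right diff2_int u(1))
      moreover have "measure lebesgue {-n..n} = 2 * n" using B(2) by simp
      ultimately show ?thesis by simp
    qed
    also have "ennreal ((1/2) ^ k * (2 * n) + 2 ^ k * (\<integral>x. (u k x - u (Suc k) x)\<^sup>2 \<partial>lebesgue)) \<le>
        ennreal ((1/2) ^ k * (2 * n) + 2 ^ k * (4 * (1/8) ^ k))"
      by (intro ennreal_leI add_left_mono mult_left_mono step) auto
    also have "\<dots> \<le> ennreal ((2 * n + 4) * (1/2) ^ k)"
    proof (rule ennreal_leI)
      have "(2::real) ^ k * (1/8) ^ k = (1/4) ^ k" by (simp flip: power_mult_distrib)
      also have "\<dots> \<le> (1/2) ^ k" by (intro power_mono) auto
      finally show "(1/2) ^ k * (2 * n) + 2 ^ k * (4 * (1/8) ^ k) \<le> (2 * n + 4) * (1/2) ^ k"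
        by (simp add: algebra_simps)
    qed
    finally show ?thesis .
  qed
  have conv: "AE x in lebesgue. convergent (\<lambda>k. u k x)"
  proof -
    have "(\<integral>\<^sup>+ x. (\<Sum>k. ennreal \<bar>u k x - u (Suc k) x\<bar>) \<partial>lebesgue) = (\<Sum>k. \<integral>\<^sup>+ x. ennreal \<bar>u k x - u (Suc k) x\<bar> \<partial>lebesgue)"
      by (rule nn_integral_suminf) measurable
    also have "\<dots> \<le> (\<Sum>k. ennreal ((2 * n + 4) * (1/2) ^ k))" by (intro suminf_le step1) auto
    also have "\<dots> = ennreal (\<Sum>k. (2 * n + 4) * (1/2) ^ k)"
      using B(2) by (intro suminf_ennreal2 summable_mult summable_geometric) auto
    also have "\<dots> < \<infinity>" by simp
    finally have "(\<integral>\<^sup>+ x. (\<Sum>k. ennreal \<bar>u k x - u (Suc k) x\<bar>) \<partial>lebesgue) \<noteq> \<infinity>" by simp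
    then have "AE x in lebesgue. (\<Sum>k. ennreal \<bar>u k x - u (Suc k) x\<bar>) \<noteq> \<infinity>"
      by (intro nn_integral_noteq_infinite) measurable
    then show ?thesis
    proof (rule AE_mp, intro AE_I2 impI)
      fix x assume "(\<Sum>k. ennreal \<bar>u k x - u (Suc k) x\<bar>) \<noteq> \<infinity>"
      then have "summable (\<lambda>k. \<bar>u k x - u (Suc k) x\<bar>)" by (intro summable_suminf_not_top) auto
      then have "summable (\<lambda>k. u k x - u (Suc k) x)" by (rule summable_rabs_cancel)
      then have "convergent (\<lambda>k. \<Sum>i<k. u i x - u (Suc i) x)" by (simp add: summable_iff_convergent)
      then have "convergent (\<lambda>k. u 0 x - u k x)"
        unfolding sum_lessThan_telescope' [of "\<lambda>i. u i x"] .
      then have "convergent (\<lambda>k. u 0 x - (u 0 x - u k x))" by (rule convergent_diff [OF convergent_const])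
      moreover have "u 0 x - (u 0 x - u k x) = u k x" for k by simp
      ultimately show "convergent (\<lambda>k. u k x)" by (simp only:)
    qed
  qed
  \<comment> \<open>Clamping the limit between \<open>0\<close> and \<open>f x\<close> makes
    \<open>s\<close> admissible at every point, also on the null set where the sequence diverges and
    \<open>lim\<close> has an arbitrary value.\<close>
  define s where "s x = max 0 (min (f x) (lim (\<lambda>k. u k x)))" for x
  have [measurable]: "s \<in> borel_measurable lebesgue" unfolding s_def by measurable
  have s_lim: "AE x in lebesgue. (\<lambda>k. u k x) \<longlonglongrightarrow> s x"
  proof (rule AE_mp [OF conv], intro AE_I2 impI)
    fix x assume "convergent (\<lambda>k. u k x)"
    then have l: "(\<lambda>k. u k x) \<longlonglongrightarrow> lim (\<lambda>k. u k x)" by (simp add: convergent_LIMSEQ_iff)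
    have "0 \<le> lim (\<lambda>k. u k x)" by (rule LIMSEQ_le_const [OF l]) (use Vb u(1) in blast)
    moreover have "lim (\<lambda>k. u k x) \<le> f x" by (rule LIMSEQ_le_const2 [OF l]) (use Vb u(1) in blast)
    ultimately have "s x = lim (\<lambda>k. u k x)" by (simp add: s_def)
    then show "(\<lambda>k. u k x) \<longlonglongrightarrow> s x" using l by simp
  qed
  have sV: "s \<in> V"
  proof -
    have "\<rho> (\<lambda>x. ennreal (s x)) \<le> \<rho> (\<lambda>x. liminf (\<lambda>k. ennreal (u k x)))"
    proof (rule rho_mono_AE)
      show "AE x in lebesgue. ennreal (s x) \<le> liminf (\<lambda>k. ennreal (u k x))"
      proof (rule AE_mp [OF s_lim], intro AE_I2 impI)
        fix x assume "(\<lambda>k. u k x) \<longlonglongrightarrow> s x"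
        then have "(\<lambda>k. ennreal (u k x)) \<longlonglongrightarrow> ennreal (s x)" by (rule tendsto_ennrealI)
        then show "ennreal (s x) \<le> liminf (\<lambda>k. ennreal (u k x))" by (simp add: lim_imp_Liminf)
      qed
    qed measurable
    also have "\<dots> \<le> 1" using u(1) by (intro rho_Fatou) (auto simp: V_def)
    finally show ?thesis using f0 by (simp add: V_def s_def)
  qed
  have "(\<lambda>k. q (u k)) \<longlonglongrightarrow> q s"
    unfolding q_def
  proof (rule integral_dominated_convergence)
    show "integrable lebesgue (\<lambda>x. (f x)\<^sup>2)" using f0 by (intro sqint f) auto
    show "AE x in lebesgue. (\<lambda>k. (f x - u k x)\<^sup>2) \<longlonglongrightarrow> (f x - s x)\<^sup>2"
      using s_lim by (auto intro!: tendsto_intros)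
    show "AE x in lebesgue. norm ((f x - u k x)\<^sup>2) \<le> (f x)\<^sup>2" for k
      using Vb [OF u(1), of k] by (auto intro!: AE_I2 power_mono)
  qed measurable
  moreover have "(\<lambda>k. d + (1/8) ^ k) \<longlonglongrightarrow> d + 0"
    by (intro tendsto_intros LIMSEQ_power_zero) auto
  ultimately have "q s \<le> d + 0"
    using u(2) by (intro LIMSEQ_le) (auto intro: less_imp_le)
  then have "q s \<le> q v" if "v \<in> V" for v using dle [OF that] by simp
  then show ?thesis using sV unfolding V_def q_def by (intro bexI [of _ s]) auto
qed

end

lemma ident_borel_measurable_lebesgue [measurable]: "(\<lambda>x::real. x) \<in> borel_measurable lebesgue"
  by (rule measurable_completion) simp

section \<open>Separation of a function from the unit ball\<close>

context bfn
begin

text \<open>If \<open>u\<close> is the point of the ball nearest to \<open>f\<close>, then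
  \<open>g = f - u\<close> is an outer normal at \<open>u\<close>: no bounded, compactly supported
  member of the ball has a larger pairing with \<open>g\<close> than \<open>u\<close> itself, namely
  \<open>s\<close>. Dividing by \<open>s\<close> normalises the dual norm, and the pairing of
  \<open>g\<close> with \<open>f\<close> exceeds \<open>s\<close> by the integral of the square of
  \<open>g\<close>.\<close>

lemma separating_functional:
  fixes f :: "real \<Rightarrow> real"
  assumes f[measurable]: "f \<in> borel_measurable lebesgue" and f0: "\<And>x. 0 \<le> f x"
    and fB: "\<And>x. f x \<le> B * indicator {-n..n} x" and B: "B \<ge> 0" "n > 0"
    and rho: "\<rho> (\<lambda>x. ennreal (f x)) > 1"
  shows "\<exists>g\<in>borel_measurable lebesgue. \<exists>B'\<ge>0. (\<forall>x. 0 \<le> g x \<and> g x \<le> B' * indicator {-n..n} x) \<and>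
    assoc_norm \<rho> (\<lambda>x. ennreal (g x)) \<le> 1 \<and> (\<integral>\<^sup>+ x. ennreal (f x) * ennreal (g x) \<partial>lebesgue) > 1"
proof -
  have "\<exists>u\<in>borel_measurable lebesgue. (\<forall>x. 0 \<le> u x \<and> u x \<le> f x) \<and> \<rho> (\<lambda>x. ennreal (u x)) \<le> 1 \<and>
    (\<forall>v\<in>borel_measurable lebesgue. (\<forall>x. 0 \<le> v x \<and> v x \<le> f x) \<longrightarrow> \<rho> (\<lambda>x. ennreal (v x)) \<le> 1 \<longrightarrow>
      (\<integral>x. (f x - u x)\<^sup>2 \<partial>lebesgue) \<le> (\<integral>x. (f x - v x)\<^sup>2 \<partial>lebesgue))"
    by (rule nearest_point_exists [OF f f0 fB B])
  then obtain u where um[measurable]: "u \<in> borel_measurable lebesgue" and u': "\<forall>x. 0 \<le> u x \<and> u x \<le> f x"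
    and u3: "\<rho> (\<lambda>x. ennreal (u x)) \<le> 1"
    and min': "\<forall>v\<in>borel_measurable lebesgue. (\<forall>x. 0 \<le> v x \<and> v x \<le> f x) \<longrightarrow> \<rho> (\<lambda>x. ennreal (v x)) \<le> 1 \<longrightarrow>
      (\<integral>x. (f x - u x)\<^sup>2 \<partial>lebesgue) \<le> (\<integral>x. (f x - v x)\<^sup>2 \<partial>lebesgue)"
    by (elim bexE conjE)
  have u: "0 \<le> u x" "u x \<le> f x" "\<rho> (\<lambda>x. ennreal (u x)) \<le> 1" for x using u' u3 by auto
  have min: "(\<integral>x. (f x - u x)\<^sup>2 \<partial>lebesgue) \<le> (\<integral>x. (f x - v x)\<^sup>2 \<partial>lebesgue)"
    if "v \<in> borel_measurable lebesgue" "\<And>x. 0 \<le> v x" "\<And>x. v x \<le> f x" "\<rho> (\<lambda>x. ennreal (v x)) \<le> 1" for v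
    using min' that by blast
  define g where "g x = f x - u x" for x
  have gm[measurable]: "g \<in> borel_measurable lebesgue" unfolding g_def by measurable
  have g0: "0 \<le> g x" for x using u(2) [of x] by (simp add: g_def)
  have gB: "g x \<le> B * indicator {-n..n} x" for x using u(1) [of x] fB [of x] by (simp add: g_def)
  have uB: "u x \<le> B * indicator {-n..n} x" for x using u(2) [of x] fB [of x] by linarith
  have int2: "integrable lebesgue (\<lambda>x. a x * b x)"
    if [measurable]: "a \<in> borel_measurable lebesgue" "b \<in> borel_measurable lebesgue"
      and ab: "\<And>x. \<bar>a x\<bar> \<le> A * indicator {-n..n} x" "\<And>x. \<bar>b x\<bar> \<le> A' * indicator {-n..n} x" for a b :: "real \<Rightarrow> real" and A A'
  proof (rule integrable_bounded_support)
    show "\<bar>a x * b x\<bar> \<le> (A * A') * indicator {-n..n} x" for x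
      using mult_mono [OF ab(1) [of x] ab(2) [of x]] ab(1) [of x]
      by (auto simp: abs_mult split: split_indicator_asm split_indicator)
  qed measurable
  have abs_g: "\<bar>g x\<bar> \<le> B * indicator {-n..n} x" and abs_u: "\<bar>u x\<bar> \<le> B * indicator {-n..n} x" for x
    using gB [of x] uB [of x] g0 [of x] u(1) [of x] by auto
  have gg: "integrable lebesgue (\<lambda>x. (g x)\<^sup>2)"
    unfolding power2_eq_square by (rule int2 [OF gm gm abs_g abs_g])
  define s where "s = (\<integral>x. g x * u x \<partial>lebesgue)"
  have s0: "s \<ge> 0" unfolding s_def using g0 u(1) by (intro Bochner_Integration.integral_nonneg) auto
  have gu: "integrable lebesgue (\<lambda>x. g x * u x)" by (rule int2 [OF gm um abs_g abs_u])
  have var: "(\<integral>x. g x * w x \<partial>lebesgue) \<le> s"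
    if wm[measurable]: "w \<in> borel_measurable lebesgue" and w0: "\<And>x. 0 \<le> w x"
      and wB: "\<And>x. w x \<le> A * indicator {-n..n} x" and w1: "\<rho> (\<lambda>x. ennreal (w x)) \<le> 1" for w A
  proof -
    have abs_w: "\<bar>w x\<bar> \<le> A * indicator {-n..n} x" for x using w0 [of x] wB [of x] by simp
    have gw: "integrable lebesgue (\<lambda>x. g x * w x)" by (rule int2 [OF gm wm abs_g abs_w])
    have abs_wu: "\<bar>w x - u x\<bar> \<le> (A + B) * indicator {-n..n} x" for x
      using abs_w [of x] abs_u [of x] unfolding distrib_right by linarith
    have wu: "integrable lebesgue (\<lambda>x. (w x - u x)\<^sup>2)"
      unfolding power2_eq_square by (rule int2 [OF _ _ abs_wu abs_wu]) measurable
    define P Q where "P = (\<integral>x. g x * w x \<partial>lebesgue) - s" and "Q = (\<integral>x. (w x - u x)\<^sup>2 \<partial>lebesgue)"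
    have PQ: "2 * P \<le> t * Q" if t: "0 < t" "t \<le> 1" for t
    proof -
      define z where "z x = (1 - t) * u x + t * w x" for x
      \<comment> \<open>The nearest point was sought among functions below \<open>f\<close>. Cutting
        the convex combination \<open>z\<close> at \<open>f\<close> makes it a competitor and can
        only bring it closer to \<open>f\<close>.\<close>
      define v where "v x = min (z x) (f x)" for x
      have [measurable]: "z \<in> borel_measurable lebesgue" unfolding z_def by measurable
      have [measurable]: "v \<in> borel_measurable lebesgue" unfolding v_def by measurable
      have z0: "0 \<le> z x" for x unfolding z_def using t u(1) w0 by (intro add_nonneg_nonneg mult_nonneg_nonneg) auto
      have "\<rho> (\<lambda>x. ennreal (v x)) \<le> \<rho> (\<lambda>x. ennreal (z x))"
        by (intro rho_mono) (auto simp: v_def intro: ennreal_leI)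
      also have "\<dots> \<le> 1" unfolding z_def using t by (intro rho_convex um wm u w0 w1) auto
      finally have "(\<integral>x. (f x - u x)\<^sup>2 \<partial>lebesgue) \<le> (\<integral>x. (f x - v x)\<^sup>2 \<partial>lebesgue)"
        using z0 f0 by (intro min) (auto simp: v_def)
      moreover have fz: "(f x - z x)\<^sup>2 = (g x)\<^sup>2 - (2 * t) * (g x * w x - g x * u x) + t\<^sup>2 * (w x - u x)\<^sup>2" for x
        by (simp add: z_def g_def power2_eq_square algebra_simps)
      have fzi: "integrable lebesgue (\<lambda>x. (f x - z x)\<^sup>2)"
        unfolding fz by (intro Bochner_Integration.integrable_add Bochner_Integration.integrable_diff integrable_mult_right gg gw gu wu)
      have "(\<integral>x. (f x - v x)\<^sup>2 \<partial>lebesgue) \<le> (\<integral>x. (f x - z x)\<^sup>2 \<partial>lebesgue)"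
      proof (rule integral_mono_AE [OF _ fzi])
        have le: "(f x - v x)\<^sup>2 \<le> (f x - z x)\<^sup>2" for x by (auto simp: v_def min_def)
        show "integrable lebesgue (\<lambda>x. (f x - v x)\<^sup>2)"
          by (rule Bochner_Integration.integrable_bound [OF fzi]) (use le in auto)
        show "AE x in lebesgue. (f x - v x)\<^sup>2 \<le> (f x - z x)\<^sup>2" using le by auto
      qed
      moreover have "(\<integral>x. (f x - z x)\<^sup>2 \<partial>lebesgue) = (\<integral>x. (g x)\<^sup>2 \<partial>lebesgue) - (2 * t) * P + t\<^sup>2 * Q"
        unfolding fz P_def Q_def s_def using gg gw gu wu by simp
      ultimately have "(2 * t) * P \<le> t\<^sup>2 * Q" unfolding g_def by linarith
      then have "t * (2 * P) \<le> t * (t * Q)" by (simp add: power2_eq_square mult_ac)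
      then show ?thesis using t(1) by simp
    qed
    have "P \<le> 0"
    proof (rule ccontr)
      assume "\<not> P \<le> 0"
      then have P: "P > 0" by simp
      have Q: "Q \<ge> 0" by (simp add: Q_def)
      \<comment> \<open>Chosen so small that \<open>t * Q\<close> is at most \<open>P\<close>, which
        contradicts \<open>2 * P \<le> t * Q\<close>; the summand \<open>1\<close> allows for
        \<open>Q = 0\<close>.\<close>
      define t where "t = min 1 (P / (Q + 1))"
      have "t > 0" "t \<le> 1" using P Q by (auto simp: t_def)
      then have "2 * P \<le> t * Q" by (rule PQ)
      also have "\<dots> \<le> P / (Q + 1) * Q" using Q by (intro mult_right_mono) (auto simp: t_def)
      also have "\<dots> \<le> P * 1" using P Q by (simp add: field_simps)
      finally show False using P by simp
    qed
    then show ?thesis by (simp add: P_def)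
  qed
  define \<gamma> where "\<gamma> = (\<integral>x. (g x)\<^sup>2 \<partial>lebesgue)"
  have g_nz: "\<not> (AE x in lebesgue. g x = 0)"
  proof
    assume "AE x in lebesgue. g x = 0"
    then have "AE x in lebesgue. ennreal (f x) \<le> ennreal (u x)" by eventually_elim (auto simp: g_def)
    then have "\<rho> (\<lambda>x. ennreal (f x)) \<le> \<rho> (\<lambda>x. ennreal (u x))" by (intro rho_mono_AE) measurable
    then show False using rho u(3) by simp
  qed
  have \<gamma>0: "\<gamma> > 0"
  proof -
    have "\<gamma> \<ge> 0" unfolding \<gamma>_def by simp
    moreover have "\<gamma> \<noteq> 0"
    proof
      assume "\<gamma> = 0"
      then have "AE x in lebesgue. (g x)\<^sup>2 = 0"
        unfolding \<gamma>_def using integral_nonneg_eq_0_iff_AE [OF gg] by auto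
      then show False using g_nz by simp
    qed
    ultimately show ?thesis by simp
  qed
  have gf: "(\<integral>x. g x * f x \<partial>lebesgue) = s + \<gamma>"
  proof -
    have "g x * f x = g x * u x + (g x)\<^sup>2" for x by (simp add: g_def power2_eq_square algebra_simps)
    then show ?thesis unfolding s_def \<gamma>_def using gu gg by simp
  qed
  \<comment> \<open>A small multiple of the indicator of \<open>{-n..n}\<close> lies in the unit
    ball and has a positive pairing with the nonzero function \<open>g\<close>; by
    \<open>var\<close> this pairing is at most \<open>s\<close>.\<close>
  have "s > 0"
  proof -
    define E where "E = (indicator {-n..n} :: real \<Rightarrow> ennreal)"
    have "\<rho> E < \<infinity>" unfolding E_def by (intro rho_indicator) (auto simp: emeasure_lborel_Icc_eq)
    then obtain r where r: "\<rho> E = ennreal r" "r \<ge> 0" by (cases "\<rho> E") auto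
    define w where "w x = 1 / (1 + r) * indicator {-n..n} x" for x :: real
    have [measurable]: "w \<in> borel_measurable lebesgue" unfolding w_def by measurable
    have "(\<lambda>x. ennreal (w x)) = (\<lambda>x. ennreal (1 / (1 + r)) * E x)"
      unfolding w_def E_def using r(2) by (auto simp: fun_eq_iff split: split_indicator)
    moreover have "E \<in> borel_measurable lebesgue" unfolding E_def by measurable
    ultimately have "\<rho> (\<lambda>x. ennreal (w x)) = ennreal (1 / (1 + r)) * ennreal r"
      using r by (simp add: rho_cmult)
    also have "\<dots> = ennreal (1 / (1 + r) * r)"
      using r(2) by (intro ennreal_mult [symmetric]) auto
    also have "\<dots> \<le> ennreal 1" using r(2) by (intro ennreal_leI) (simp add: field_simps)
    finally have "(\<integral>x. g x * w x \<partial>lebesgue) \<le> s"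
      using r(2) by (intro var [of w "1 / (1 + r)"]) (auto simp: w_def)
    moreover have "(\<integral>x. g x * w x \<partial>lebesgue) > 0"
    proof -
      have "g x * w x = 1 / (1 + r) * g x" for x
        using gB [of x] g0 [of x] by (auto simp: w_def split: split_indicator_asm split_indicator)
      then have e: "(\<integral>x. g x * w x \<partial>lebesgue) = 1 / (1 + r) * (\<integral>x. g x \<partial>lebesgue)" by simp
      have gi: "integrable lebesgue g" by (rule integrable_bounded_support [OF gm abs_g])
      have "(\<integral>x. g x \<partial>lebesgue) \<noteq> 0" using integral_nonneg_eq_0_iff_AE [OF gi] g0 g_nz by auto
      moreover have "(\<integral>x. g x \<partial>lebesgue) \<ge> 0" using g0 by simp
      ultimately show ?thesis using r(2) by (simp add: e)
    qed
    ultimately show ?thesis by simp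
  qed
  define h where "h x = g x / s" for x
  have [measurable]: "h \<in> borel_measurable lebesgue" unfolding h_def by measurable
  have h0: "0 \<le> h x" for x using g0 s0 by (simp add: h_def)
  have hB: "h x \<le> B / s * indicator {-n..n} x" for x
    using divide_right_mono [OF gB [of x] s0] by (simp add: h_def)
  have "assoc_norm \<rho> (\<lambda>x. ennreal (h x)) \<le> 1"
    unfolding assoc_norm_def
  proof (rule SUP_least)
    fix p assume "p \<in> {f \<in> borel_measurable lebesgue. \<rho> f \<le> 1}"
    then have p[measurable]: "p \<in> borel_measurable lebesgue" and p1: "\<rho> p \<le> 1" by auto
    \<comment> \<open>The inequality \<open>var\<close> concerns bounded functions supported in
      \<open>{-n..n}\<close>. A general member \<open>p\<close> of the unit ball is reached from
      these truncations by monotone convergence, as \<open>h\<close> vanishes outside the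
      interval.\<close>
    define w where "w m x = enn2real (min (p x) (of_nat m)) * indicator {-n..n} x" for m :: nat and x
    have wm[measurable]: "w m \<in> borel_measurable lebesgue" for m unfolding w_def by measurable
    have fin: "min (p x) (of_nat m) < top" for m x by (simp add: min_less_iff_disj of_nat_less_top)
    have ew: "ennreal (w m x) = min (p x) (of_nat m) * indicator {-n..n} x" for m x
      using fin [of x m] by (auto simp: w_def ennreal_enn2real split: split_indicator)
    have wb: "(\<integral>\<^sup>+ x. ennreal (w m x) * ennreal (h x) \<partial>lebesgue) \<le> 1" for m
    proof -
      have "\<rho> (\<lambda>x. ennreal (w m x)) \<le> \<rho> p" unfolding ew by (intro rho_mono) (auto split: split_indicator)
      then have r1: "\<rho> (\<lambda>x. ennreal (w m x)) \<le> 1" using p1 by order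
      have w0: "0 \<le> w m x" for x by (simp add: w_def)
      have wB: "w m x \<le> real m * indicator {-n..n} x" for x
      proof -
        have "ennreal (enn2real (min (p x) (of_nat m))) \<le> ennreal (real m)"
          using fin [of x m] by (simp add: ennreal_enn2real ennreal_of_nat_eq_real_of_nat)
        then have "enn2real (min (p x) (of_nat m)) \<le> real m" by simp
        then show ?thesis by (auto simp: w_def split: split_indicator)
      qed
      have "(\<integral>x. g x * w m x \<partial>lebesgue) \<le> s" by (rule var [OF wm w0 wB r1])
      then have "(\<integral>x. w m x * h x \<partial>lebesgue) \<le> 1"
        using \<open>s > 0\<close> by (simp add: h_def mult.commute)
      moreover have "integrable lebesgue (\<lambda>x. w m x * h x)"
      proof (rule int2)
        show "\<bar>w m x\<bar> \<le> real m * indicator {-n..n} x" for x using w0 [of x] wB [of x] by simp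
        show "\<bar>h x\<bar> \<le> B / s * indicator {-n..n} x" for x using h0 [of x] hB [of x] by simp
      qed measurable
      then have "(\<integral>\<^sup>+ x. ennreal (w m x * h x) \<partial>lebesgue) = ennreal (\<integral>x. w m x * h x \<partial>lebesgue)"
        using w0 h0 by (intro nn_integral_eq_integral) auto
      ultimately show ?thesis using w0 h0 by (simp add: ennreal_mult [symmetric])
    qed
    have "(\<integral>\<^sup>+ x. p x * ennreal (h x) \<partial>lebesgue) = (\<integral>\<^sup>+ x. (SUP m. ennreal (w m x) * ennreal (h x)) \<partial>lebesgue)"
    proof (intro nn_integral_cong)
      fix x
      show "p x * ennreal (h x) = (SUP m. ennreal (w m x) * ennreal (h x))"
      proof (cases "x \<in> {-n..n}")
        case True
        have "(SUP m. min (p x) (of_nat m)) = p x"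
          by (simp add: inf_min [symmetric] inf_SUP [symmetric] ennreal_SUP_of_nat_eq_top)
        then show ?thesis using True by (simp add: ew SUP_mult_right_ennreal [symmetric])
      next
        case False
        then have "h x = 0" using hB [of x] h0 [of x] by simp
        then show ?thesis by simp
      qed
    qed
    also have "\<dots> = (SUP m. \<integral>\<^sup>+ x. ennreal (w m x) * ennreal (h x) \<partial>lebesgue)"
    proof (rule nn_integral_monotone_convergence_SUP)
      show "incseq (\<lambda>m x. ennreal (w m x) * ennreal (h x))"
        unfolding ew by (intro incseq_SucI le_funI mult_right_mono) (auto simp: min_le_iff_disj split: split_indicator intro: order_trans)
    qed measurable
    also have "\<dots> \<le> 1" by (intro SUP_least wb)
    finally show "(\<integral>\<^sup>+ x. p x * ennreal (h x) \<partial>lebesgue) \<le> 1" .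
  qed
  moreover have "(\<integral>\<^sup>+ x. ennreal (f x) * ennreal (h x) \<partial>lebesgue) > 1"
  proof -
    have "integrable lebesgue (\<lambda>x. f x * h x)"
    proof (rule int2)
      show "\<bar>f x\<bar> \<le> B * indicator {-n..n} x" for x using f0 [of x] fB [of x] by simp
      show "\<bar>h x\<bar> \<le> B / s * indicator {-n..n} x" for x using h0 [of x] hB [of x] by simp
    qed measurable
    then have "(\<integral>\<^sup>+ x. ennreal (f x * h x) \<partial>lebesgue) = ennreal (\<integral>x. f x * h x \<partial>lebesgue)"
      using f0 h0 by (intro nn_integral_eq_integral) auto
    also have "(\<integral>x. f x * h x \<partial>lebesgue) = (s + \<gamma>) / s"
      unfolding gf [symmetric] h_def by (simp add: mult.commute)
    also have "ennreal ((s + \<gamma>) / s) > ennreal 1" using \<open>s > 0\<close> \<gamma>0 by (intro ennreal_lessI) auto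
    finally show ?thesis using f0 h0 by (simp add: ennreal_mult)
  qed
  ultimately show ?thesis using h0 hB s0 B by (intro bexI [of _ h] exI [of _ "B / s"]) auto
qed

text \<open>The Lorentz--Luxemburg theorem in the form \<open>\<rho> \<le> \<rho>''\<close>, tested on bounded compactly supported functions.\<close>

lemma rho_le_dual:
  assumes h[measurable]: "h \<in> borel_measurable lebesgue" and A: "A > 0"
    and dual: "\<And>g B n. g \<in> borel_measurable lebesgue \<Longrightarrow> (\<And>x. 0 \<le> g x) \<Longrightarrow>
       (\<And>x. g x \<le> B * indicator {-n..n} x) \<Longrightarrow> assoc_norm \<rho> (\<lambda>x. ennreal (g x)) \<le> 1 \<Longrightarrow>
       (\<integral>\<^sup>+ x. h x * ennreal (g x) \<partial>lebesgue) \<le> ennreal A"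
  shows "\<rho> h \<le> ennreal A"
proof (rule ccontr)
  assume "\<not> \<rho> h \<le> ennreal A"
  then have gt: "\<rho> h > ennreal A" by simp
  \<comment> \<open>Truncations in height and support increase to \<open>h\<close>, so by the Fatou
    property one of them already has norm above \<open>A\<close>.\<close>
  define H where "H k x = min (h x) (of_nat k) * indicator {-real k..real k} x" for k :: nat and x
  have [measurable]: "H k \<in> borel_measurable lebesgue" for k unfolding H_def by measurable
  have incH: "incseq (\<lambda>k. H k x)" for x
    unfolding H_def by (intro incseq_SucI mult_mono) (auto simp: min_le_iff_disj split: split_indicator intro: order_trans)
  have "(\<lambda>k. \<rho> (H k)) \<longlonglongrightarrow> \<rho> h"
  proof (rule rho_incseq [OF _ h incH])
    fix x
    obtain N :: nat where N: "\<bar>x\<bar> \<le> real N" using real_arch_simple by blast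
    have "(\<lambda>k. min (h x) (of_nat k)) \<longlonglongrightarrow> (SUP k. min (h x) (of_nat k))"
      by (intro LIMSEQ_SUP incseq_SucI) (auto simp: min_le_iff_disj intro: order_trans)
    moreover have "(SUP k. min (h x) (of_nat k)) = h x"
      by (simp add: inf_min [symmetric] inf_SUP [symmetric] ennreal_SUP_of_nat_eq_top)
    moreover have "eventually (\<lambda>k. H k x = min (h x) (of_nat k)) sequentially"
      using eventually_ge_at_top [of N]
    proof eventually_elim
      case (elim k)
      then have "real N \<le> real k" by simp
      then have "x \<in> {-real k..real k}" using N by auto
      then show ?case by (simp add: H_def)
    qed
    ultimately show "(\<lambda>k. H k x) \<longlonglongrightarrow> h x" using tendsto_cong by fastforce
  qed measurable
  then have "eventually (\<lambda>k. \<rho> (H k) > ennreal A) sequentially" using gt by (rule order_tendstoD)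
  then have "eventually (\<lambda>k. \<rho> (H k) > ennreal A \<and> k \<ge> 1) sequentially"
    using eventually_ge_at_top by (rule eventually_conj)
  then obtain k where k: "\<rho> (H k) > ennreal A" "k \<ge> 1"
    using eventually_happens' [OF sequentially_bot] by blast
  \<comment> \<open>Division by \<open>A\<close> moves the gap in the norm to the threshold
    \<open>1\<close> of the separation lemma.\<close>
  define f where "f x = enn2real (H k x) / A" for x
  have fin: "H k x < top" for x unfolding H_def by (auto simp: min_less_iff_disj of_nat_less_top split: split_indicator)
  have [measurable]: "f \<in> borel_measurable lebesgue" unfolding f_def by measurable
  have ef: "ennreal (f x) = ennreal (1 / A) * H k x" for x
  proof -
    have "ennreal (f x) = ennreal (1 / A) * ennreal (enn2real (H k x))"
      using A unfolding f_def by (subst ennreal_mult [symmetric]) auto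
    then show ?thesis using fin by simp
  qed
  have "\<exists>g\<in>borel_measurable lebesgue. \<exists>B'\<ge>0. (\<forall>x. 0 \<le> g x \<and> g x \<le> B' * indicator {-real k..real k} x) \<and>
    assoc_norm \<rho> (\<lambda>x. ennreal (g x)) \<le> 1 \<and> (\<integral>\<^sup>+ x. ennreal (f x) * ennreal (g x) \<partial>lebesgue) > 1"
  proof (rule separating_functional)
    show "0 \<le> f x" for x using A by (simp add: f_def)
    show "f x \<le> real k / A * indicator {-real k..real k} x" for x
    proof -
      have "H k x \<le> ennreal (real k * indicator {-real k..real k} x)"
        unfolding H_def by (auto simp: ennreal_of_nat_eq_real_of_nat split: split_indicator)
      then have "enn2real (H k x) \<le> real k * indicator {-real k..real k} x"
        by (intro enn2real_leI) auto
      then show ?thesis using A by (simp add: f_def divide_right_mono)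
    qed
    show "real k / A \<ge> 0" "real k > 0" using A k(2) by auto
    have "ennreal (1 / A) * \<rho> (H k) > ennreal (1 / A) * ennreal A"
      using k(1) A by (intro ennreal_mult_strict_left_mono) auto
    moreover have "ennreal (1 / A) * ennreal A = 1" using A by (simp add: ennreal_mult [symmetric])
    ultimately show "1 < \<rho> (\<lambda>x. ennreal (f x))" unfolding ef using A by (subst rho_cmult) auto
  qed measurable
  then obtain g B' where g: "g \<in> borel_measurable lebesgue" "\<And>x. 0 \<le> g x" "\<And>x. g x \<le> B' * indicator {-real k..real k} x"
    "assoc_norm \<rho> (\<lambda>x. ennreal (g x)) \<le> 1" "(\<integral>\<^sup>+ x. ennreal (f x) * ennreal (g x) \<partial>lebesgue) > 1"
    by (elim bexE exE conjE) auto
  note [measurable] = g(1)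
  have "(\<integral>\<^sup>+ x. ennreal (f x) * ennreal (g x) \<partial>lebesgue) \<le> (\<integral>\<^sup>+ x. ennreal (1 / A) * (h x * ennreal (g x)) \<partial>lebesgue)"
  proof (rule nn_integral_mono)
    fix x
    have "H k x \<le> h x" by (auto simp: H_def split: split_indicator)
    then show "ennreal (f x) * ennreal (g x) \<le> ennreal (1 / A) * (h x * ennreal (g x))"
      unfolding ef mult.assoc by (intro mult_left_mono mult_right_mono) auto
  qed
  also have "\<dots> = ennreal (1 / A) * (\<integral>\<^sup>+ x. h x * ennreal (g x) \<partial>lebesgue)" by (rule nn_integral_cmult) measurable
  also have "\<dots> \<le> ennreal (1 / A) * ennreal A" by (intro mult_left_mono dual [OF g(1-4)]) auto
  also have "\<dots> = 1" using A by (simp add: ennreal_mult [symmetric])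
  finally show False using g(5) by simp
qed

end

section \<open>Majorants and the main theorem\<close>

lemma continuous_le_of_AE_le:
  fixes \<psi> :: "real \<Rightarrow> complex"
  assumes cont: "continuous_on UNIV \<psi>" and S: "open S" "u \<in> S"
    and ae: "AE x in lebesgue. x \<in> S \<longrightarrow> cmod (\<psi> x) \<le> B"
  shows "cmod (\<psi> u) \<le> B"
proof (rule ccontr)
  assume "\<not> cmod (\<psi> u) \<le> B"
  \<comment> \<open>By continuity a violation at \<open>u\<close> persists on an open set
    \<open>T\<close> around \<open>u\<close>, which cannot be a null set.\<close>
  define T where "T = S \<inter> {x. B < cmod (\<psi> x)}"
  have "open {x. B < cmod (\<psi> x)}"
    by (intro open_Collect_less continuous_intros continuous_on_norm cont)
  then have T: "open T" unfolding T_def using S(1) by (rule open_Int [rotated])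
  have "u \<in> T" using S \<open>\<not> cmod (\<psi> u) \<le> B\<close> by (simp add: T_def)
  moreover have "T \<in> sets lebesgue" using T by (intro borel_open sets_completionI_sets) simp
  have "AE x in lebesgue. x \<notin> T" using ae by eventually_elim (auto simp: T_def)
  then have "T \<in> null_sets lebesgue" using \<open>T \<in> sets lebesgue\<close> by (simp add: AE_iff_null_sets)
  then have "negligible T" by (simp add: negligible_iff_null_sets)
  ultimately show False using open_not_negligible [OF T] by blast
qed

text \<open>The derivative exists everywhere but may be discontinuous. The fundamental theorem is
  therefore used for the Henstock-Kurzweil integral, for which every derivative is integrable;
  resetting the derivative to zero on the exceptional null set leaves the integral unchanged and
  makes the bound hold everywhere.\<close>

lemma lipschitz_of_AE_deriv_le:
  fixes \<psi> :: "real \<Rightarrow> complex"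
  assumes diff: "\<And>x. \<psi> differentiable (at x)" and B: "B \<ge> 0" and ab: "a \<le> b"
    and ae: "AE x in lebesgue. x \<in> {a..b} \<longrightarrow> cmod (vector_derivative \<psi> (at x)) \<le> B"
  shows "cmod (\<psi> b - \<psi> a) \<le> B * (b - a)"
proof -
  let ?d = "\<lambda>x. vector_derivative \<psi> (at x)"
  have int: "(?d has_integral (\<psi> b - \<psi> a)) {a..b}"
    using diff ab by (intro fundamental_theorem_of_calculus)
      (auto simp: vector_derivative_works intro: has_vector_derivative_at_within)
  obtain N where N: "N \<in> null_sets lebesgue" "{x. \<not> (x \<in> {a..b} \<longrightarrow> cmod (?d x) \<le> B)} \<subseteq> N"
    using ae unfolding eventually_ae_filter by auto
  then have neg: "negligible N" by (simp add: negligible_iff_null_sets)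
  have "((\<lambda>x. if x \<in> N then 0 else ?d x) has_integral (\<psi> b - \<psi> a)) {a..b}"
    by (rule has_integral_spike [OF neg _ int]) simp
  then have "cmod (\<psi> b - \<psi> a) \<le> B * measure lborel {a..b}"
    by (rule has_integral_bound_real [OF B finite.emptyI]) (use N(2) B in auto)
  then show ?thesis using ab by simp
qed

text \<open>Summation by parts, where \<open>2 * i + 1\<close> is the difference of consecutive
  squares. The boundary term is kept explicit because its sign allows it to be dropped.\<close>

lemma sum_weighted_differences:
  fixes w :: "nat \<Rightarrow> real"
  shows "(\<Sum>i<m. (w i - w (Suc i)) * (real i + 1)\<^sup>2) + w m * (real m)\<^sup>2 = (\<Sum>i<m. w i * (2 * real i + 1))"
  by (induction m) (auto simp: power2_eq_square algebra_simps)

text \<open>Comparison with an integral over unit intervals: shifted by three, the term is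
  \<open>W (i + 1) * (2 * i + 7)\<close>, and for \<open>s\<close> between \<open>i\<close> and
  \<open>i + 1\<close> it is at most \<open>(2 * s + 7) * W s\<close>. This is where the first
  moment of \<open>W\<close> is spent.\<close>

lemma decreasing_majorant_summable:
  fixes W :: "real \<Rightarrow> real"
  assumes pos: "\<And>s. 0 \<le> s \<Longrightarrow> W s > 0" and dec: "\<And>s t. 0 \<le> s \<Longrightarrow> s \<le> t \<Longrightarrow> W t \<le> W s"
    and int: "set_integrable lborel {0..} W" and int1: "set_integrable lborel {0..} (\<lambda>s. s * W s)"
  shows "summable (\<lambda>i. W (real (i - 2)) * (2 * real i + 1))"
proof -
  let ?a = "\<lambda>i. W (real (i - 2)) * (2 * real i + 1)"
  define G where "G s = indicator {0..} s *\<^sub>R ((2 * s + 7) * W s)" for s :: real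
  have Gi: "integrable lborel G"
  proof -
    have "set_integrable lborel {0..} (\<lambda>s. 2 * (s * W s) + 7 * W s)"
      by (intro set_integral_add set_integrable_mult_right int int1)
    then show ?thesis unfolding set_integrable_def G_def by (simp add: algebra_simps)
  qed
  have G0: "G s \<ge> 0" for s using pos [of s] by (auto simp: G_def indicator_def intro!: mult_nonneg_nonneg less_imp_le)
  define T where "T = (\<integral>s. G s \<partial>lborel)"
  have "(\<Sum>i<m. ?a (i + 3)) \<le> T" for m
  proof -
    have iG: "integrable lborel (\<lambda>s. indicator {real i..<real i + 1} s *\<^sub>R G s)" for i
      by (intro integrable_mult_indicator Gi) simp
    have "?a (i + 3) \<le> (\<integral>s. indicator {real i..<real i + 1} s *\<^sub>R G s \<partial>lborel)" for i
    proof -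
      have "?a (i + 3) = (\<integral>s. indicator {real i..<real i + 1} s *\<^sub>R ?a (i + 3) \<partial>lborel)"
        by (subst integral_scaleR_left) auto
      also have "\<dots> \<le> (\<integral>s. indicator {real i..<real i + 1} s *\<^sub>R G s \<partial>lborel)"
      proof (rule integral_mono [OF _ iG])
        show "integrable lborel (\<lambda>s. indicator {real i..<real i + 1} s *\<^sub>R ?a (i + 3))"
          by (intro integrable_scaleR_left integrable_real_indicator) auto
        fix s
        show "indicator {real i..<real i + 1} s *\<^sub>R ?a (i + 3) \<le> indicator {real i..<real i + 1} s *\<^sub>R G s"
        proof (cases "s \<in> {real i..<real i + 1}")
          case True
          then have s: "0 \<le> s" "real i \<le> s" "s \<le> real i + 1" by auto
          have "W (real i + 1) * (2 * real i + 7) \<le> W s * (2 * s + 7)"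
            using s pos [of s] dec [of s "real i + 1"] by (intro mult_mono) auto
          then show ?thesis using True s by (simp add: G_def algebra_simps)
        qed simp
      qed
      finally show ?thesis .
    qed
    then have "(\<Sum>i<m. ?a (i + 3)) \<le> (\<Sum>i<m. \<integral>s. indicator {real i..<real i + 1} s *\<^sub>R G s \<partial>lborel)"
      by (intro sum_mono)
    also have "\<dots> = (\<integral>s. (\<Sum>i<m. indicator {real i..<real i + 1} s *\<^sub>R G s) \<partial>lborel)"
      by (rule Bochner_Integration.integral_sum [symmetric]) (rule iG)
    also have "\<dots> \<le> T"
      unfolding T_def
    proof (rule integral_mono [OF _ Gi])
      show "integrable lborel (\<lambda>s. \<Sum>i<m. indicator {real i..<real i + 1} s *\<^sub>R G s)"
        by (intro Bochner_Integration.integrable_sum iG)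
      fix s
      have "(\<Sum>i<m. indicator {real i..<real i + 1} s :: real) \<le> 1"
      proof -
        have "disjoint_family_on (\<lambda>i. {real i..<real i + 1}) {..<m}"
          unfolding disjoint_family_on_def
        proof (intro ballI impI)
          fix i j :: nat assume "i \<noteq> j"
          then have "real i + 1 \<le> real j \<or> real j + 1 \<le> real i" by linarith
          then show "{real i..<real i + 1} \<inter> {real j..<real j + 1} = {}" by auto
        qed
        then have "(\<Sum>i<m. indicator {real i..<real i + 1} s :: real) = indicator (\<Union>i<m. {real i..<real i + 1}) s"
          by (intro indicator_UN_disjoint [symmetric]) auto
        then show ?thesis by (simp add: indicator_def)
      qed
      then have "(\<Sum>i<m. indicator {real i..<real i + 1} s) * G s \<le> 1 * G s" using G0 by (rule mult_right_mono)
      then show "(\<Sum>i<m. indicator {real i..<real i + 1} s *\<^sub>R G s) \<le> G s" by (simp add: sum_distrib_right)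
    qed
    finally show ?thesis .
  qed
  moreover have "?a i \<ge> 0" for i using pos [of "real (i - 2)"] by (auto intro!: mult_nonneg_nonneg less_imp_le)
  ultimately have "summable (\<lambda>i. ?a (i + 3))" by (intro summableI_nonneg_bounded [of "\<lambda>i. ?a (i + 3)" T])
  then show ?thesis by (rule iffD1 [OF summable_iff_shift])
qed

text \<open>The layers \<open>c i = w i - w (Suc i)\<close> telescope, since \<open>w\<close> tends
  to zero, and reproduce at least \<open>w n\<close> up to distance \<open>n + 1\<close>. Their
  second moments reduce to the first moments of \<open>w\<close> by summation by parts.\<close>

lemma wavelet_kernel_exists:
  fixes \<psi> :: "real \<Rightarrow> complex"
  assumes diff: "\<forall>x. \<psi> differentiable (at x)"
    and W: "radial_decr_L1_majorant W \<psi>"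
    and W': "radial_decr_L1_majorant W (\<lambda>x. vector_derivative \<psi> (at x))"
    and int1: "set_integrable lborel {0..} (\<lambda>s. s * W s)"
  shows "\<exists>c. wavelet_kernel \<psi> c"
proof -
  have pos: "W s > 0" if "0 \<le> s" for s using W that by (auto simp: radial_decr_L1_majorant_def)
  have dec: "W t \<le> W s" if "0 \<le> s" "s \<le> t" for s t using W that by (auto simp: radial_decr_L1_majorant_def)
  have int: "set_integrable lborel {0..} W" using W by (simp add: radial_decr_L1_majorant_def)
  have ae: "AE x in lebesgue. cmod (\<psi> x) \<le> W \<bar>x\<bar>" "AE x in lebesgue. cmod (vector_derivative \<psi> (at x)) \<le> W \<bar>x\<bar>"
    using W W' by (auto simp: radial_decr_L1_majorant_def)
  have cont: "continuous_on UNIV \<psi>"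
    using diff by (auto intro!: continuous_at_imp_continuous_on differentiable_imp_continuous_within)
  \<comment> \<open>The shift by two leaves room for passing from
    \<open>real n \<le> \<bar>u\<bar>\<close> to an open condition and for moving from
    \<open>u\<close> to a point at distance at most \<open>1\<close>. Truncated subtraction makes
    \<open>w\<close> equal to \<open>W 0\<close> for the first three indices.\<close>
  define w where "w n = W (real (n - 2))" for n :: nat
  have w0: "w n \<ge> 0" for n using pos by (simp add: w_def less_imp_le)
  have wdec: "w (Suc n) \<le> w n" for n unfolding w_def by (intro dec) auto
  have psi_w: "cmod (\<psi> u) \<le> w n" if u: "real n \<le> \<bar>u\<bar>" for u n
  proof (cases "n \<le> 2")
    case True
    have "AE x in lebesgue. x \<in> UNIV \<longrightarrow> cmod (\<psi> x) \<le> W 0"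
      using ae(1) by eventually_elim (metis abs_ge_zero dec order_refl order_trans)
    then have "cmod (\<psi> u) \<le> W 0" by (intro continuous_le_of_AE_le [OF cont open_UNIV]) auto
    then show ?thesis using True by (simp add: w_def)
  next
    case False
    have "AE x in lebesgue. x \<in> {x. real (n - 2) < \<bar>x\<bar>} \<longrightarrow> cmod (\<psi> x) \<le> w n"
      using ae(1) unfolding w_def
    proof eventually_elim
      case (elim x)
      then show ?case using dec [of "real (n - 2)" "\<bar>x\<bar>"] by auto
    qed
    moreover have "open {x::real. real (n - 2) < \<bar>x\<bar>}" by (intro open_Collect_less continuous_intros)
    moreover have "real (n - 2) < \<bar>u\<bar>" using u False by (simp add: of_nat_diff)
    ultimately show ?thesis by (intro continuous_le_of_AE_le [OF cont, of "{x. real (n - 2) < \<bar>x\<bar>}"]) auto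
  qed
  have lip: "cmod (\<psi> b - \<psi> a) \<le> w n * (b - a)" if ab: "a \<le> b" "\<And>t. t \<in> {a..b} \<Longrightarrow> real (n - 2) \<le> \<bar>t\<bar>" for a b n
  proof (rule lipschitz_of_AE_deriv_le [OF _ w0 ab(1)])
    show "AE x in lebesgue. x \<in> {a..b} \<longrightarrow> cmod (vector_derivative \<psi> (at x)) \<le> w n"
      using ae(2) unfolding w_def
    proof eventually_elim
      case (elim x)
      then show ?case using dec [of "real (n - 2)" "\<bar>x\<bar>"] ab(2) [of x] by auto
    qed
  qed (use diff in blast)
  have diff_w: "cmod (\<psi> u - \<psi> v) \<le> \<bar>u - v\<bar> * w n" if uv: "\<bar>u - v\<bar> \<le> 1" "real n \<le> \<bar>u\<bar>" for u v n
  proof -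
    have seg: "real (n - 2) \<le> \<bar>t\<bar>" if "t \<in> {min u v..max u v}" for t
    proof -
      have "\<bar>u - t\<bar> \<le> 1" using that uv(1) by auto
      then have "real n - 1 \<le> \<bar>t\<bar>" using uv(2) by linarith
      then show ?thesis by (cases "n \<le> 2") (auto simp: of_nat_diff)
    qed
    show ?thesis
    proof (cases "u \<le> v")
      case True
      then show ?thesis using lip [of u v n] seg by (simp add: norm_minus_commute mult.commute)
    next
      case False
      then show ?thesis using lip [of v u n] seg by (simp add: mult.commute)
    qed
  qed
  define c where "c i = w i - w (Suc i)" for i
  have c0: "c i \<ge> 0" for i using wdec by (simp add: c_def)
  have sw: "summable (\<lambda>i. w i * (2 * real i + 1))"
    unfolding w_def by (rule decreasing_majorant_summable [OF pos dec int int1])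
  have sc: "summable (\<lambda>i. c i * (real i + 1)\<^sup>2)"
  proof (rule summableI_nonneg_bounded)
    fix m
    have "(\<Sum>i<m. c i * (real i + 1)\<^sup>2) \<le> (\<Sum>i<m. w i * (2 * real i + 1))"
      unfolding c_def sum_weighted_differences [of w m, symmetric] using w0 [of m] by simp
    also have "\<dots> \<le> (\<Sum>i. w i * (2 * real i + 1))" using sw w0 by (intro sum_le_suminf) auto
    finally show "(\<Sum>i<m. c i * (real i + 1)\<^sup>2) \<le> (\<Sum>i. w i * (2 * real i + 1))" .
  qed (simp add: c0)
  have w_lim: "w \<longlonglongrightarrow> 0"
  proof (rule tendsto_sandwich [OF _ _ tendsto_const summable_LIMSEQ_zero [OF sw]])
    show "eventually (\<lambda>n. 0 \<le> w n) sequentially" using w0 by simp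
    show "eventually (\<lambda>n. w n \<le> w n * (2 * real n + 1)) sequentially"
      using w0 by (intro always_eventually allI) (simp add: algebra_simps)
  qed
  have maj: "ennreal (w n) \<le> majorant c u" if u: "\<bar>u\<bar> \<le> real n + 1" for n u
  proof (rule LIMSEQ_le_const2)
    show "(\<lambda>m. ennreal (w n - w m)) \<longlonglongrightarrow> ennreal (w n)"
      using tendsto_ennrealI [OF tendsto_diff [OF tendsto_const [of "w n"] w_lim]] by simp
    show "\<exists>N. \<forall>m\<ge>N. ennreal (w n - w m) \<le> majorant c u"
    proof (intro exI [of _ n] allI impI)
      fix m assume "n \<le> m"
      have "w n - w m = (\<Sum>i=n..<m. c i)"
        unfolding c_def using sum_Suc_diff' [OF \<open>n \<le> m\<close>, of "\<lambda>i. - w i"] by simp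
      then have "ennreal (w n - w m) = ennreal (\<Sum>i=n..<m. c i)" by simp
      also have "\<dots> = (\<Sum>i=n..<m. ennreal (c i))" using c0 by (simp add: sum_ennreal)
      also have "\<dots> = (\<Sum>i=n..<m. ennreal (c i) * indicator {- (real i + 1)..real i + 1} u)"
      proof (intro sum.cong refl)
        fix i assume "i \<in> {n..<m}"
        then have "real n \<le> real i" by simp
        then have "u \<in> {- (real i + 1)..real i + 1}" using u by (auto simp: abs_le_iff)
        then show "ennreal (c i) = ennreal (c i) * indicator {- (real i + 1)..real i + 1} u" by simp
      qed
      also have "\<dots> \<le> majorant c u" unfolding majorant_def by (intro sum_le_suminf) auto
      finally show "ennreal (w n - w m) \<le> majorant c u" .
    qed
  qed
  \<comment> \<open>The integer part of \<open>\<bar>u\<bar>\<close> meets both demands at once: the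
    bounds on the wavelet ask for an index below \<open>\<bar>u\<bar>\<close>, the majorant for
    \<open>\<bar>u\<bar>\<close> to be at most one more than the index.\<close>
  have fl: "real (nat \<lfloor>\<bar>u\<bar>\<rfloor>) \<le> \<bar>u\<bar>" "\<bar>u\<bar> \<le> real (nat \<lfloor>\<bar>u\<bar>\<rfloor>) + 1" for u :: real by linarith+
  have "wavelet_kernel \<psi> c"
  proof
    show "\<psi> \<in> borel_measurable borel" using cont by (rule borel_measurable_continuous_onI)
    show "ennreal (cmod (\<psi> u)) \<le> majorant c u" for u
      using ennreal_leI [OF psi_w [OF fl(1)]] maj [OF fl(2)] by (rule order_trans)
    show "ennreal (cmod (\<psi> u - \<psi> v)) \<le> ennreal \<bar>u - v\<bar> * majorant c u" if "\<bar>u - v\<bar> \<le> 1" for u v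
    proof -
      have "ennreal (cmod (\<psi> u - \<psi> v)) \<le> ennreal (\<bar>u - v\<bar> * w (nat \<lfloor>\<bar>u\<bar>\<rfloor>))"
        using that by (intro ennreal_leI diff_w fl)
      also have "\<dots> = ennreal \<bar>u - v\<bar> * ennreal (w (nat \<lfloor>\<bar>u\<bar>\<rfloor>))" using w0 by (intro ennreal_mult) auto
      also have "\<dots> \<le> ennreal \<bar>u - v\<bar> * majorant c u" by (intro mult_left_mono maj fl) auto
      finally show ?thesis .
    qed
  qed (use c0 sc in auto)
  then show ?thesis by (intro exI [of _ c])
qed

section \<open>Exhaustion of the square function by finite index sets\<close>

lemma ennreal_sqrt_tendsto:
  fixes s :: "nat \<Rightarrow> real"
  assumes s: "\<And>n. s n \<ge> 0" and lim: "(\<lambda>n. ennreal (s n)) \<longlonglongrightarrow> S"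
  shows "(\<lambda>n. ennreal (sqrt (s n))) \<longlonglongrightarrow> ennreal_sqrt S"
proof (cases "S = \<infinity>")
  case True
  then have "filterlim s at_top sequentially" using lim by (simp add: ennreal_tendsto_top_eq_at_top)
  then have "filterlim (\<lambda>n. sqrt (s n)) at_top sequentially" by (rule filterlim_compose [OF sqrt_at_top])
  then show ?thesis using True by (simp add: ennreal_sqrt_def ennreal_tendsto_top_eq_at_top)
next
  case False
  then obtain r where r: "S = ennreal r" "r \<ge> 0" by (cases S) auto
  then have "s \<longlonglongrightarrow> r" using lim s by (intro tendsto_ennrealD) auto
  then have "(\<lambda>n. ennreal (sqrt (s n))) \<longlonglongrightarrow> ennreal (sqrt r)" by (intro tendsto_ennrealI tendsto_real_sqrt)
  then show ?thesis using r by (simp add: ennreal_sqrt_def)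
qed

definition index_box :: "nat \<Rightarrow> (int \<times> int) set" where
  "index_box n = {- int n..int n} \<times> {- int n..int n}"

lemma finite_index_box [simp]: "finite (index_box n)"
  by (simp add: index_box_def)

lemma index_box_mono: "m \<le> n \<Longrightarrow> index_box m \<subseteq> index_box n"
  by (auto simp: index_box_def)

lemma index_box_cover: "\<exists>N. \<forall>n\<ge>N. I \<in> index_box n"
proof (intro exI allI impI)
  fix n assume "n \<ge> nat \<bar>fst I\<bar> + nat \<bar>snd I\<bar>"
  then show "I \<in> index_box n" by (cases I) (auto simp: index_box_def)
qed

lemma sum_index_box_tendsto:
  fixes t :: "int \<times> int \<Rightarrow> ennreal"
  shows "(\<lambda>n. \<Sum>I\<in>index_box n. t I) \<longlonglongrightarrow> (\<integral>\<^sup>+ I. t I \<partial>count_space UNIV)"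
proof -
  have inc: "incseq (\<lambda>n I. t I * indicator (index_box n) I)"
    using index_box_mono [of n "Suc n" for n]
    by (intro incseq_SucI le_funI mult_left_mono) (auto split: split_indicator)
  have sup: "(SUP n. t I * indicator (index_box n) I) = t I" for I
  proof (rule antisym)
    show "(SUP n. t I * indicator (index_box n) I) \<le> t I" by (rule SUP_least) (auto split: split_indicator)
    obtain N where "I \<in> index_box N" using index_box_cover by blast
    then show "t I \<le> (SUP n. t I * indicator (index_box n) I)" by (intro SUP_upper2 [of N]) auto
  qed
  have "(\<Sum>I\<in>index_box n. t I) = (\<integral>\<^sup>+ I. t I * indicator (index_box n) I \<partial>count_space UNIV)" for n
    by (subst nn_integral_count_space' [of "index_box n"]) auto
  moreover have "(\<lambda>n. \<integral>\<^sup>+ I. t I * indicator (index_box n) I \<partial>count_space UNIV) \<longlonglongrightarrow>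
      (SUP n. \<integral>\<^sup>+ I. t I * indicator (index_box n) I \<partial>count_space UNIV)"
    using inc by (intro LIMSEQ_SUP) (auto simp: incseq_def le_fun_def intro!: nn_integral_mono)
  moreover have "(SUP n. \<integral>\<^sup>+ I. t I * indicator (index_box n) I \<partial>count_space UNIV) = (\<integral>\<^sup>+ I. t I \<partial>count_space UNIV)"
    using nn_integral_monotone_convergence_SUP [OF inc, of "count_space UNIV"] by (simp add: sup)
  ultimately show ?thesis by simp
qed

section \<open>The norm inequality: bounded functions, general functions, all indices\<close>

locale wavelet_bfn = bfn + wavelet_system +
  fixes C1 C2 :: real
  assumes maximal: "C1 > 0" "f \<in> bfs \<rho> \<Longrightarrow> \<rho> (maximal_op f) \<le> ennreal C1 * \<rho> (\<lambda>x. ennreal (cmod (f x)))"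
    and maximal': "C2 > 0" "g \<in> bfs (assoc_norm \<rho>) \<Longrightarrow>
      assoc_norm \<rho> (maximal_op g) \<le> ennreal C2 * assoc_norm \<rho> (\<lambda>x. ennreal (cmod (g x)))"
    and psi_assoc: "wavelet_dil \<psi> j k \<in> bfs (assoc_norm \<rho>)"
begin

definition C where "C = 16 * K * C1 * C2"

lemma C_pos: "C > 0"
  unfolding C_def using maximal(1) maximal'(1) K_pos by simp

text \<open>By duality it suffices to pair with a bounded, compactly supported \<open>g\<close> of
  dual norm at most \<open>1\<close>. The bilinear estimate and Hoelder's inequality then bring in
  one operator norm for each maximal function, whence \<open>C = 16 * K * C1 * C2\<close>.\<close>

lemma rho_sqV_bounded:
  assumes f: "integrable lebesgue f" and fB: "\<And>x. cmod (f x) \<le> B" and fX: "f \<in> bfs \<rho>" and F: "finite F"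
  shows "\<rho> (\<lambda>x. ennreal (sqV F f x)) \<le> ennreal C * \<rho> (\<lambda>x. ennreal (cmod (f x)))"
proof -
  let ?r = "\<rho> (\<lambda>x. ennreal (cmod (f x)))"
  have fin: "?r < \<infinity>" using fX by (simp add: bfs_def)
  then obtain r where r: "?r = ennreal r" "r \<ge> 0" by (cases ?r) auto
  have Mf: "\<rho> (maximal_op f) \<le> ennreal C1 * ?r" by (rule maximal(2) [OF fX])
  \<comment> \<open>The duality lemma asks for a positive bound, while \<open>r\<close> may be
    \<open>0\<close>; the slack \<open>e\<close> is removed at the end.\<close>
  have "\<rho> (\<lambda>x. ennreal (sqV F f x)) \<le> ennreal (C * r) + ennreal e" if e: "e > 0" for e :: real
  proof -
    have "\<rho> (\<lambda>x. ennreal (sqV F f x)) \<le> ennreal (C * r + e)"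
    proof (rule rho_le_dual)
      show "C * r + e > 0" using C_pos r(2) e by (simp add: add_nonneg_pos)
      fix g :: "real \<Rightarrow> real" and B' n
      assume g[measurable]: "g \<in> borel_measurable lebesgue" and g0: "\<And>x. 0 \<le> g x"
        and gB: "\<And>x. g x \<le> B' * indicator {-n..n} x" and g1: "assoc_norm \<rho> (\<lambda>x. ennreal (g x)) \<le> 1"
      define G where "G x = complex_of_real (g x)" for x
      have [measurable]: "G \<in> borel_measurable lebesgue" unfolding G_def by measurable
      have cG: "cmod (G x) = g x" for x using g0 by (simp add: G_def)
      have "assoc_norm \<rho> (\<lambda>x. ennreal (g x)) < \<infinity>" using g1 by (simp add: order.strict_trans1)
      then have GX: "G \<in> bfs (assoc_norm \<rho>)" by (simp add: bfs_def cG)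
      define B0 where "B0 = Max {B, B', 0}"
      have fB0: "cmod (f x) \<le> B0" for x using fB [of x] by (simp add: B0_def)
      have GB0: "cmod (G x) \<le> B0" for x using gB [of x] by (auto simp: B0_def cG split: split_indicator_asm)
      have "(\<integral>\<^sup>+ x. ennreal (sqV F f x) * ennreal (g x) \<partial>lebesgue) \<le> ennreal (16 * K) * (\<integral>\<^sup>+ x. maximal_op f x * maximal_op G x \<partial>lebesgue)"
        using bilinear_estimate [OF f _ fB0 GB0 F] by (simp add: cG)
      also have "\<dots> \<le> ennreal (16 * K) * (\<rho> (maximal_op f) * assoc_norm \<rho> (maximal_op G))"
      proof (intro mult_left_mono Hoelder)
        have "ennreal C1 * ?r < \<infinity>" using r by (simp add: ennreal_mult_less_top)
        then show "\<rho> (maximal_op f) < \<infinity>" using Mf by (rule order.strict_trans1 [rotated])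
      qed auto
      also have "\<dots> \<le> ennreal (16 * K) * ((ennreal C1 * ?r) * (ennreal C2 * 1))"
      proof (intro mult_left_mono mult_mono Mf)
        have "assoc_norm \<rho> (maximal_op G) \<le> ennreal C2 * assoc_norm \<rho> (\<lambda>x. ennreal (g x))"
          using maximal'(2) [OF GX] by (simp add: cG)
        also have "\<dots> \<le> ennreal C2 * 1" by (intro mult_left_mono g1) simp
        finally show "assoc_norm \<rho> (maximal_op G) \<le> ennreal C2 * 1" .
      qed auto
      also have "\<dots> = ennreal (C * r)"
        using r maximal(1) maximal'(1) K_pos by (simp add: C_def ennreal_mult mult_ac)
      also have "\<dots> \<le> ennreal (C * r + e)" using e by (intro ennreal_leI) simp
      finally show "(\<integral>\<^sup>+ x. ennreal (sqV F f x) * ennreal (g x) \<partial>lebesgue) \<le> ennreal (C * r + e)" .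
    qed measurable
    then show ?thesis using C_pos r(2) e by simp
  qed
  then have "\<rho> (\<lambda>x. ennreal (sqV F f x)) \<le> ennreal (C * r)" by (rule ennreal_le_epsilon)
  then show ?thesis using C_pos r by (simp add: ennreal_mult)
qed

text \<open>Truncations of \<open>f\<close> in height and support are bounded and integrable. Their
  coefficients converge by dominated convergence: the product of \<open>f\<close> with
  \<open>psi I\<close> is integrable by Hoelder's inequality, as the wavelets lie in the associate
  space. With finitely many indices this gives pointwise convergence of the square functions, and
  the Fatou property transfers the bound.\<close>

lemma rho_sqV:
  assumes fX: "f \<in> bfs \<rho>" and F: "finite F"
  shows "\<rho> (\<lambda>x. ennreal (sqV F f x)) \<le> ennreal C * \<rho> (\<lambda>x. ennreal (cmod (f x)))"
proof -
  have fm[measurable]: "f \<in> borel_measurable lebesgue" and fin: "\<rho> (\<lambda>x. ennreal (cmod (f x))) < \<infinity>"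
    using fX by (auto simp: bfs_def)
  define S where "S n = {x. cmod (f x) \<le> real n} \<inter> {-real n..real n}" for n
  have [measurable]: "S n \<in> sets lebesgue" for n
  proof -
    have "{x \<in> space lebesgue. cmod (f x) \<le> real n} \<in> sets lebesgue" by measurable
    then show ?thesis unfolding S_def by auto
  qed
  define h where "h n x = indicator (S n) x *\<^sub>R f x" for n x
  have hm[measurable]: "h n \<in> borel_measurable lebesgue" for n unfolding h_def by measurable
  have h_le: "cmod (h n x) \<le> cmod (f x)" for n x by (auto simp: h_def split: split_indicator)
  have h_ev: "eventually (\<lambda>n. h n x = f x) sequentially" for x
  proof -
    obtain N where N: "cmod (f x) + \<bar>x\<bar> \<le> real N" using real_arch_simple by blast
    show ?thesis using eventually_ge_at_top [of N]
    proof eventually_elim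
      case (elim n)
      then have "real N \<le> real n" by simp
      then have "cmod (f x) \<le> real n" "\<bar>x\<bar> \<le> real n" using N norm_ge_zero [of "f x"] by linarith+
      then have "x \<in> S n" by (auto simp: S_def abs_le_iff)
      then show ?case by (simp add: h_def)
    qed
  qed
  have rho_h: "\<rho> (\<lambda>x. ennreal (cmod (h n x))) \<le> \<rho> (\<lambda>x. ennreal (cmod (f x)))" for n
    by (intro rho_mono) (auto intro: ennreal_leI h_le)
  have bound: "\<rho> (\<lambda>x. ennreal (sqV F (h n) x)) \<le> ennreal C * \<rho> (\<lambda>x. ennreal (cmod (f x)))" for n
  proof -
    have hB: "cmod (h n x) \<le> real n" for x by (auto simp: h_def S_def split: split_indicator)
    have "integrable lebesgue (h n)"
    proof (rule Bochner_Integration.integrable_bound)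
      show "integrable lebesgue (\<lambda>x. real n * indicator {-real n..real n} x :: real)"
        by (intro integrable_mult_right integrable_real_indicator) (auto simp: emeasure_lborel_Icc_eq)
      show "AE x in lebesgue. norm (h n x) \<le> norm (real n * indicator {-real n..real n} x :: real)"
        using hB by (intro AE_I2) (auto simp: h_def S_def split: split_indicator)
    qed measurable
    moreover have "h n \<in> bfs \<rho>" using rho_h [of n] fin by (auto simp: bfs_def intro: order.strict_trans1)
    ultimately have "\<rho> (\<lambda>x. ennreal (sqV F (h n) x)) \<le> ennreal C * \<rho> (\<lambda>x. ennreal (cmod (h n x)))"
      using hB F by (intro rho_sqV_bounded) auto
    also have "\<dots> \<le> ennreal C * \<rho> (\<lambda>x. ennreal (cmod (f x)))" by (intro mult_left_mono rho_h) auto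
    finally show ?thesis .
  qed
  have coef_lim: "(\<lambda>n. coef (h n) I) \<longlonglongrightarrow> coef f I" for I
    unfolding L2_inner_def
  proof (rule integral_dominated_convergence)
    have "(\<integral>\<^sup>+ x. ennreal (cmod (f x)) * apsi I x \<partial>lebesgue) \<le>
        \<rho> (\<lambda>x. ennreal (cmod (f x))) * assoc_norm \<rho> (\<lambda>x. apsi I x)"
      using fin by (intro Hoelder) auto
    also have "\<dots> < \<infinity>" using fin psi_assoc [of "fst I" "snd I"] by (simp add: bfs_def ennreal_mult_less_top)
    finally have "(\<integral>\<^sup>+ x. ennreal (cmod (f x) * cmod (psi I x)) \<partial>lebesgue) < \<infinity>" by (simp add: ennreal_mult)
    then show "integrable lebesgue (\<lambda>x. cmod (f x) * cmod (psi I x))"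
      by (intro integrableI_nonneg) auto
    show "AE x in lebesgue. (\<lambda>n. h n x * cnj (psi I x)) \<longlonglongrightarrow> f x * cnj (psi I x)"
    proof (intro AE_I2 tendsto_mult tendsto_const)
      fix x show "(\<lambda>n. h n x) \<longlonglongrightarrow> f x" using h_ev [of x] by (rule tendsto_eventually)
    qed
    show "AE x in lebesgue. norm (h n x * cnj (psi I x)) \<le> cmod (f x) * cmod (psi I x)" for n
      using h_le by (intro AE_I2) (auto simp: norm_mult intro: mult_right_mono)
  qed measurable
  have "liminf (\<lambda>n. ennreal (sqV F (h n) x)) = ennreal (sqV F f x)" for x
  proof (rule lim_imp_Liminf)
    show "(\<lambda>n. ennreal (sqV F (h n) x)) \<longlonglongrightarrow> ennreal (sqV F f x)"
      unfolding sqV_def L2_set_def by (intro tendsto_intros tendsto_ennrealI coef_lim)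
  qed simp
  then have "\<rho> (\<lambda>x. ennreal (sqV F f x)) = \<rho> (\<lambda>x. liminf (\<lambda>n. ennreal (sqV F (h n) x)))" by simp
  also have "\<dots> \<le> ennreal C * \<rho> (\<lambda>x. ennreal (cmod (f x)))" by (rule rho_Fatou [OF _ bound]) measurable
  finally show ?thesis .
qed

text \<open>The constant does not depend on the index set, and the truncated square functions
  increase along the boxes. The Fatou property passes to the limit even though the full square
  function might be infinite at some points.\<close>

lemma rho_wavelet_sqfun:
  assumes "f \<in> bfs \<rho>"
  shows "\<rho> (wavelet_sqfun \<psi> f) \<le> ennreal C * \<rho> (\<lambda>x. ennreal (cmod (f x)))"
proof (rule LIMSEQ_le_const2)
  have lim: "(\<lambda>n. ennreal (sqV (index_box n) f x)) \<longlonglongrightarrow> wavelet_sqfun \<psi> f x" for x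
  proof -
    let ?t = "\<lambda>I. (cmod (coef f I * psi I x))\<^sup>2"
    have "(\<lambda>n. ennreal (\<Sum>I\<in>index_box n. ?t I)) \<longlonglongrightarrow> (\<integral>\<^sup>+ I. ennreal (?t I) \<partial>count_space UNIV)"
      using sum_index_box_tendsto [of "\<lambda>I. ennreal (?t I)"] by (simp add: sum_ennreal)
    then have "(\<lambda>n. ennreal (sqrt (\<Sum>I\<in>index_box n. ?t I))) \<longlonglongrightarrow> wavelet_sqfun \<psi> f x"
      unfolding wavelet_sqfun_def by (intro ennreal_sqrt_tendsto) (auto intro: sum_nonneg)
    then show ?thesis by (simp add: sqV_def L2_set_def norm_mult)
  qed
  show "(\<lambda>n. \<rho> (\<lambda>x. ennreal (sqV (index_box n) f x))) \<longlonglongrightarrow> \<rho> (wavelet_sqfun \<psi> f)"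
  proof (rule rho_incseq [OF _ _ _ lim])
    show "wavelet_sqfun \<psi> f \<in> borel_measurable lebesgue"
      by (rule borel_measurable_LIMSEQ_order [OF lim]) measurable
    show "incseq (\<lambda>n. ennreal (sqV (index_box n) f x))" for x
      using index_box_mono by (intro incseq_SucI ennreal_leI sqV_mono) auto
  qed measurable
  show "\<exists>N. \<forall>n\<ge>N. \<rho> (\<lambda>x. ennreal (sqV (index_box n) f x)) \<le> ennreal C * \<rho> (\<lambda>x. ennreal (cmod (f x)))"
    using rho_sqV [OF assms] by auto
qed

end

theorem theorem2p9:
  fixes \<rho> :: bfnorm and \<psi> :: "real \<Rightarrow> complex" and W :: "real \<Rightarrow> real"
  assumes "banach_function_norm \<rho>"
    and "separable_bfs \<rho>"
    and "maximal_bounded_on \<rho>"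
    and "maximal_bounded_on (assoc_norm \<rho>)"
    and "orthonormal_wavelet \<psi>"
    and "\<forall>x. \<psi> differentiable (at x)"
    and "radial_decr_L1_majorant W \<psi>"
    and "radial_decr_L1_majorant W (\<lambda>x. vector_derivative \<psi> (at x))"
    and "set_integrable lborel {0..} (\<lambda>s. s * W s)"
    and "\<forall>j k. wavelet_dil \<psi> j k \<in> bfs (assoc_norm \<rho>)"
  shows "\<exists>C::real. C > 0 \<and> (\<forall>f\<in>bfs \<rho>.
           \<rho> (wavelet_sqfun \<psi> f) \<le> ennreal C * \<rho> (\<lambda>x. ennreal (cmod (f x))))"
proof -
  obtain c where "wavelet_kernel \<psi> c"
    using wavelet_kernel_exists [OF assms(6-9)] by blast
  then interpret wavelet_kernel \<psi> c .
  obtain C1 where C1: "C1 > 0" "\<forall>f\<in>bfs \<rho>. \<rho> (maximal_op f) \<le> ennreal C1 * \<rho> (\<lambda>x. ennreal (cmod (f x)))"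
    using assms(3) unfolding maximal_bounded_on_def by blast
  obtain C2 where C2: "C2 > 0" "\<forall>g\<in>bfs (assoc_norm \<rho>).
      assoc_norm \<rho> (maximal_op g) \<le> ennreal C2 * assoc_norm \<rho> (\<lambda>x. ennreal (cmod (g x)))"
    using assms(4) unfolding maximal_bounded_on_def by blast
  interpret wavelet_bfn \<rho> \<psi> c C1 C2
  proof
    show "banach_function_norm \<rho>" by fact
    show "L2_inner (wavelet_dil \<psi> j k) (wavelet_dil \<psi> j' k') = (if j = j' \<and> k = k' then 1 else 0)" for j k j' k'
      using assms(5) unfolding orthonormal_wavelet_def by blast
  qed (use C1 C2 assms(10) in auto)
  show ?thesis using C_pos rho_wavelet_sqfun by blast
qed

end
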